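(* Let $R$ be a Noetherian commutative ring and let $F$ be a countably generated flat $R$-module. Then $F$ is quite flat.
   Context: For a commutative ring $R$, an $R$-module $C$ is called almost cotorsion if $\mathrm{Ext}^1_R(S^{-1}R, C) = 0$ for every (at most) countable multiplicative subset $S \subseteq R$. An $R$-module $F$ is called quite flat if $\mathrm{Ext}^1_R(F, C) = 0$ for every almost cotorsion $R$-module $C$. (Equivalently, the quite flat modules are the direct summands of transfinite extensions of modules of the form $S^{-1}R$ with $S$ a countable multiplicative subset of $R$.) *)

theory Defs
  imports "HOL-Algebra.Algebra" "HOL-Library.Countable_Set"
begin

definition lin_hom :: "('r, 'x) ring_scheme \<Rightarrow> ('r, 'm, 'e1) module_scheme
    \<Rightarrow> ('r, 'n, 'e2) module_scheme \<Rightarrow> ('m \<Rightarrow> 'n) set" where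
  "lin_hom R M N = {f. f \<in> carrier M \<rightarrow> carrier N
     \<and> (\<forall>x\<in>carrier M. \<forall>y\<in>carrier M. f (x \<oplus>\<^bsub>M\<^esub> y) = f x \<oplus>\<^bsub>N\<^esub> f y)
     \<and> (\<forall>a\<in>carrier R. \<forall>x\<in>carrier M. f (a \<odot>\<^bsub>M\<^esub> x) = a \<odot>\<^bsub>N\<^esub> f x)}"

definition coeffs :: "('r, 'x) ring_scheme \<Rightarrow> ('r, 'm, 'e) module_scheme \<Rightarrow> ('m \<Rightarrow> 'r) set" where
  "coeffs R M = {c. (\<forall>x. c x \<in> carrier R) \<and> finite {x. c x \<noteq> \<zero>\<^bsub>R\<^esub>}
                   \<and> {x. c x \<noteq> \<zero>\<^bsub>R\<^esub>} \<subseteq> carrier M}"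

definition lin_comb :: "('r, 'x) ring_scheme \<Rightarrow> ('r, 'm, 'e) module_scheme \<Rightarrow> ('m \<Rightarrow> 'r) \<Rightarrow> 'm" where
  "lin_comb R M c = (\<Oplus>\<^bsub>M\<^esub> x \<in> {x. c x \<noteq> \<zero>\<^bsub>R\<^esub>}. c x \<odot>\<^bsub>M\<^esub> x)"

definition free_mod :: "('r, 'x) ring_scheme \<Rightarrow> ('r, 'm, 'e) module_scheme \<Rightarrow> ('r, 'm \<Rightarrow> 'r) module" where
  "free_mod R M = \<lparr>carrier = coeffs R M, monoid.mult = (\<lambda>_ _. undefined), one = undefined,
     ring.zero = (\<lambda>_. \<zero>\<^bsub>R\<^esub>), ring.add = (\<lambda>c d x. c x \<oplus>\<^bsub>R\<^esub> d x),
     module.smult = (\<lambda>a c x. a \<otimes>\<^bsub>R\<^esub> c x)\<rparr>"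

definition pres_kernel :: "('r, 'x) ring_scheme \<Rightarrow> ('r, 'm, 'e) module_scheme \<Rightarrow> ('r, 'm \<Rightarrow> 'r) module" where
  "pres_kernel R M = (free_mod R M)
     \<lparr>carrier := {c \<in> coeffs R M. lin_comb R M c = \<zero>\<^bsub>M\<^esub>}\<rparr>"

text \<open>Ext^1_R(M,C) = 0, computed from the projective (free) presentation
  0 \<rightarrow> K \<rightarrow> P \<rightarrow> M \<rightarrow> 0: Ext^1_R(M,C) is the cokernel of the restriction map
  Hom_R(P,C) \<rightarrow> Hom_R(K,C), so it vanishes iff every homomorphism K \<rightarrow> C extends to P.\<close>
definition ext1_vanishes :: "('r, 'x) ring_scheme \<Rightarrow> ('r, 'm, 'e1) module_scheme
    \<Rightarrow> ('r, 'c, 'e2) module_scheme \<Rightarrow> bool" where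
  "ext1_vanishes R M C \<longleftrightarrow>
     (\<forall>\<phi> \<in> lin_hom R (pres_kernel R M) C. \<exists>\<psi> \<in> lin_hom R (free_mod R M) C.
        \<forall>c \<in> carrier (pres_kernel R M). \<psi> c = \<phi> c)"

definition mult_subset :: "('r, 'x) ring_scheme \<Rightarrow> 'r set \<Rightarrow> bool" where
  "mult_subset R S \<longleftrightarrow> S \<subseteq> carrier R \<and> \<one>\<^bsub>R\<^esub> \<in> S
     \<and> (\<forall>s\<in>S. \<forall>t\<in>S. s \<otimes>\<^bsub>R\<^esub> t \<in> S)"

definition loc_rel :: "('r, 'x) ring_scheme \<Rightarrow> 'r set \<Rightarrow> (('r \<times> 'r) \<times> ('r \<times> 'r)) set" where
  "loc_rel R S = {((r, s), (r', s')). r \<in> carrier R \<and> s \<in> S \<and> r' \<in> carrier R \<and> s' \<in> S \<and>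
     (\<exists>t\<in>S. t \<otimes>\<^bsub>R\<^esub> a_minus R (r \<otimes>\<^bsub>R\<^esub> s') (r' \<otimes>\<^bsub>R\<^esub> s) = \<zero>\<^bsub>R\<^esub>)}"

definition loc_class :: "('r, 'x) ring_scheme \<Rightarrow> 'r set \<Rightarrow> 'r \<times> 'r \<Rightarrow> ('r \<times> 'r) set" where
  "loc_class R S p = loc_rel R S `` {p}"

definition loc_rep :: "('r \<times> 'r) set \<Rightarrow> 'r \<times> 'r" where
  "loc_rep U = (SOME p. p \<in> U)"

definition loc :: "('r, 'x) ring_scheme \<Rightarrow> 'r set \<Rightarrow> ('r, ('r \<times> 'r) set) module" where
  "loc R S = \<lparr>carrier = (carrier R \<times> S) // loc_rel R S,
     monoid.mult = (\<lambda>_ _. undefined), one = undefined,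
     ring.zero = loc_class R S (\<zero>\<^bsub>R\<^esub>, \<one>\<^bsub>R\<^esub>),
     ring.add = (\<lambda>U V. loc_class R S
        (fst (loc_rep U) \<otimes>\<^bsub>R\<^esub> snd (loc_rep V) \<oplus>\<^bsub>R\<^esub> fst (loc_rep V) \<otimes>\<^bsub>R\<^esub> snd (loc_rep U),
         snd (loc_rep U) \<otimes>\<^bsub>R\<^esub> snd (loc_rep V))),
     module.smult = (\<lambda>a U. loc_class R S (a \<otimes>\<^bsub>R\<^esub> fst (loc_rep U), snd (loc_rep U)))\<rparr>"

definition almost_cotorsion :: "('r, 'x) ring_scheme \<Rightarrow> ('r, 'c, 'e) module_scheme \<Rightarrow> bool" where
  "almost_cotorsion R C \<longleftrightarrow>
     (\<forall>S. mult_subset R S \<and> countable S \<longrightarrow> ext1_vanishes R (loc R S) C)"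

definition countably_generated :: "('r, 'x) ring_scheme \<Rightarrow> ('r, 'm, 'e) module_scheme \<Rightarrow> bool" where
  "countably_generated R M \<longleftrightarrow> (\<exists>U \<subseteq> carrier M. countable U \<and>
     carrier M = {lin_comb R M c | c. c \<in> coeffs R M \<and> {x. c x \<noteq> \<zero>\<^bsub>R\<^esub>} \<subseteq> U})"

section \<open>Flatness (via ideals: I \<otimes>_R F \<rightarrow> F injective for every ideal I)\<close>

text \<open>I \<otimes>_R F is the free abelian group on I \<times> F modulo the bilinearity and
  balancing relations; formal sums are finitely supported integer-valued functions.\<close>
definition tformal :: "('r, 'x) ring_scheme \<Rightarrow> 'r set \<Rightarrow> ('r, 'm, 'e) module_scheme
    \<Rightarrow> ('r \<times> 'm \<Rightarrow> int) set" where
  "tformal R I F = {t. finite {p. t p \<noteq> 0} \<and> {p. t p \<noteq> 0} \<subseteq> I \<times> carrier F}"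

definition tdelta :: "'r \<times> 'm \<Rightarrow> 'r \<times> 'm \<Rightarrow> int" where
  "tdelta p = (\<lambda>q. if q = p then 1 else 0)"

definition tgens :: "('r, 'x) ring_scheme \<Rightarrow> 'r set \<Rightarrow> ('r, 'm, 'e) module_scheme
    \<Rightarrow> ('r \<times> 'm \<Rightarrow> int) set" where
  "tgens R I F =
     {(\<lambda>q. tdelta (a \<oplus>\<^bsub>R\<^esub> a', x) q - tdelta (a, x) q - tdelta (a', x) q) | a a' x.
        a \<in> I \<and> a' \<in> I \<and> x \<in> carrier F}
   \<union> {(\<lambda>q. tdelta (a, x \<oplus>\<^bsub>F\<^esub> x') q - tdelta (a, x) q - tdelta (a, x') q) | a x x'.
        a \<in> I \<and> x \<in> carrier F \<and> x' \<in> carrier F}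
   \<union> {(\<lambda>q. tdelta (r \<otimes>\<^bsub>R\<^esub> a, x) q - tdelta (a, r \<odot>\<^bsub>F\<^esub> x) q) | r a x.
        r \<in> carrier R \<and> a \<in> I \<and> x \<in> carrier F}"

text \<open>The subgroup generated by the relations (= kernel of the quotient map onto I \<otimes>_R F).\<close>
inductive_set tspan :: "('r, 'x) ring_scheme \<Rightarrow> 'r set \<Rightarrow> ('r, 'm, 'e) module_scheme
    \<Rightarrow> ('r \<times> 'm \<Rightarrow> int) set" for R I F where
  tspan_zero: "(\<lambda>_. 0) \<in> tspan R I F"
| tspan_add: "t \<in> tspan R I F \<Longrightarrow> g \<in> tgens R I F \<Longrightarrow> (\<lambda>q. t q + g q) \<in> tspan R I F"
| tspan_diff: "t \<in> tspan R I F \<Longrightarrow> g \<in> tgens R I F \<Longrightarrow> (\<lambda>q. t q - g q) \<in> tspan R I F"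

definition teval :: "('r, 'x) ring_scheme \<Rightarrow> ('r, 'm, 'e) module_scheme \<Rightarrow> ('r \<times> 'm \<Rightarrow> int) \<Rightarrow> 'm" where
  "teval R F t = (\<Oplus>\<^bsub>F\<^esub> p \<in> {p. t p \<noteq> 0}. add_pow F (t p) (fst p \<odot>\<^bsub>F\<^esub> snd p))"

definition flat :: "('r, 'x) ring_scheme \<Rightarrow> ('r, 'm, 'e) module_scheme \<Rightarrow> bool" where
  "flat R F \<longleftrightarrow> (\<forall>I. ideal I R \<longrightarrow>
     (\<forall>t \<in> tformal R I F. teval R F t = \<zero>\<^bsub>F\<^esub> \<longrightarrow> t \<in> tspan R I F))"

end

theory Submission
  imports Defs
begin

text \<open>
  By the equational criterion and Noetherianity, \<open>F\<close> is the colimit of a sequence of finitely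
  generated free modules \<open>L\<^sub>n\<close>, each map killing the kernel of \<open>L\<^sub>n \<rightarrow> F\<close>. Hence \<open>Ext\<^sup>1(F, C) = 0\<close> as
  soon as every family in \<open>\<Prod>\<^sub>n Hom(L\<^sub>n, C)\<close> is a boundary \<open>x\<^sub>n - x\<^sub>n\<^sub>+\<^sub>1 A\<^sub>n\<close>. Solvability modulo a
  submodule \<open>N \<supseteq> I C\<close> is proved by Noetherian induction on the ideal \<open>I\<close>, which reduces to a prime
  \<open>I = p\<close> and solvability modulo \<open>N + g C\<close> for all \<open>g \<notin> p\<close>.

  Over the fraction field of \<open>R/p\<close> the images of the dual maps stabilise, so the system has the
  Mittag-Leffler property there; only countably many denominators \<open>g\<^sub>i \<notin> p\<close> are needed for this. With
  \<open>t\<^sub>j = g\<^sub>0 \<cdots> g\<^sub>j\<close>, solving successively modulo \<open>N + t\<^sub>j C\<close> and summing up the corrections, which is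
  possible because \<open>Ext\<^sup>1(R[g\<^sub>0\<^sup>-\<^sup>1, g\<^sub>1\<^sup>-\<^sup>1, \<dots>], C) = 0\<close>, leaves a right-hand side \<open>z\<^sub>0\<close> in a sequence with
  \<open>z\<^sub>j = t\<^sub>j z\<^sub>j\<^sub>+\<^sub>1\<close> modulo \<open>N\<close>. On such sequences the \<open>g\<^sub>i\<close> act invertibly, and Mittag-Leffler applies.
\<close>

section \<open>Linear combinations and congruences\<close>

text \<open>Solving modulo t_0 C, then solving for the remainder modulo t_1 C, and so on, leaves
  corrections x_j whose formal sum x_0 + t_0 x_1 + t_0 t_1 x_2 + ... has no meaning in C. The
  vanishing of Ext for the localisation supplies elements with y_j = x_j + t_j y_{j+1}, and y_0
  stands in for that sum. This hypothesis concerns C itself and is never transferred to a quotient: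
  equations over C/N are congruences in C, and the exact chain equations are solved in C only.

  Countability enters twice. Countably many generators make the colimit a sequence, so that lim^1 is
  the only obstruction; and stabilisation needs one denominator for each triple (level, delay,
  coordinate), so a single countable localisation inverts them all. The dual maps stabilise only up
  to these denominators, and in C/N one cannot divide by them. One can divide in the sequences with
  z_j = t_j z_{j+1}, which are the homomorphisms from the localisation to C/N. The products t_j =
  g_0 ... g_j are taken, rather than g_j, so that every g_i divides all later t_j and hence is
  inverted in the colimit of the multiplications by the t_j.\<close>

abbreviation vec :: "'a set \<Rightarrow> (nat \<Rightarrow> 'a) \<Rightarrow> bool" where
  "vec S v \<equiv> (\<forall>i. v i \<in> S)"

text \<open>Recursion on the length, instead of a finite sum over a set, turns each identity into an
  induction. Vectors are total sequences with every entry in the carrier, so closure needs no index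
  bounds; entries from \<open>k\<close> on are never read.\<close>

primrec lc :: "('r, 'm, 'e) module_scheme \<Rightarrow> nat \<Rightarrow> (nat \<Rightarrow> 'r) \<Rightarrow> (nat \<Rightarrow> 'm) \<Rightarrow> 'm" where
  "lc M 0 v x = \<zero>\<^bsub>M\<^esub>"
| "lc M (Suc k) v x = lc M k v x \<oplus>\<^bsub>M\<^esub> v k \<odot>\<^bsub>M\<^esub> x k"

text \<open>With \<open>R\<close> as a module over itself, \<open>lc (self R)\<close> is the dot
  product, and matrix identities are instances of those for modules.\<close>

definition self :: "('r, 'e) ring_scheme \<Rightarrow> ('r, 'r) module" where
  "self R = \<lparr>carrier = carrier R, monoid.mult = monoid.mult R, one = one R, ring.zero = ring.zero R,
     ring.add = ring.add R, module.smult = monoid.mult R\<rparr>"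

definition unit_vec :: "('r, 'e) ring_scheme \<Rightarrow> nat \<Rightarrow> nat \<Rightarrow> 'r" where
  "unit_vec R i = (\<lambda>j. if j = i then \<one>\<^bsub>R\<^esub> else \<zero>\<^bsub>R\<^esub>)"

lemma self_simps [simp]:
  "carrier (self R) = carrier R" "\<zero>\<^bsub>self R\<^esub> = \<zero>\<^bsub>R\<^esub>" "(\<oplus>\<^bsub>self R\<^esub>) = (\<oplus>\<^bsub>R\<^esub>)" "(\<odot>\<^bsub>self R\<^esub>) = (\<otimes>\<^bsub>R\<^esub>)"
  "a_inv (self R) = a_inv R" "a_minus (self R) = a_minus R"
  by (auto simp: self_def a_inv_def m_inv_def a_minus_def fun_eq_iff)

lemma (in cring) self_module: "module R (self R)"
proof (rule moduleI)
  show "abelian_group (self R)"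
  proof (rule abelian_groupI)
    show "\<exists>y\<in>carrier (self R). y \<oplus>\<^bsub>self R\<^esub> x = \<zero>\<^bsub>self R\<^esub>" if "x \<in> carrier (self R)" for x
      using that l_neg[of x] by (intro bexI[of _ "\<ominus> x"]) auto
  qed (simp_all add: a_ac)
qed (simp_all add: is_cring l_distr r_distr m_assoc)

context module
begin

lemma minus_zero_module [simp]: "\<ominus>\<^bsub>M\<^esub> \<zero>\<^bsub>M\<^esub> = \<zero>\<^bsub>M\<^esub>"
  using smult_r_minus[of \<zero> "\<zero>\<^bsub>M\<^esub>"] M.r_neg[of "\<zero>\<^bsub>M\<^esub>"] by simp

lemma add_diff: "\<lbrakk>a \<in> carrier M; b \<in> carrier M; c \<in> carrier M; d \<in> carrier M\<rbrakk> \<Longrightarrow>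
   (a \<oplus>\<^bsub>M\<^esub> b) \<ominus>\<^bsub>M\<^esub> (c \<oplus>\<^bsub>M\<^esub> d) = (a \<ominus>\<^bsub>M\<^esub> c) \<oplus>\<^bsub>M\<^esub> (b \<ominus>\<^bsub>M\<^esub> d)"
  by (simp add: M.minus_eq M.minus_add M.a_ac)

lemma diff_cancel_mid: "\<lbrakk>a \<in> carrier M; b \<in> carrier M; c \<in> carrier M\<rbrakk> \<Longrightarrow>
   (a \<ominus>\<^bsub>M\<^esub> b) \<oplus>\<^bsub>M\<^esub> (b \<ominus>\<^bsub>M\<^esub> c) = a \<ominus>\<^bsub>M\<^esub> c"
  by (simp add: M.minus_eq M.a_assoc M.r_neg1)

lemma diff_add_cancel: "\<lbrakk>a \<in> carrier M; b \<in> carrier M\<rbrakk> \<Longrightarrow> (a \<ominus>\<^bsub>M\<^esub> b) \<oplus>\<^bsub>M\<^esub> b = a"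
  by (simp add: M.minus_eq M.a_assoc M.l_neg)

lemma add_diff_cancel: "\<lbrakk>a \<in> carrier M; b \<in> carrier M\<rbrakk> \<Longrightarrow> (a \<oplus>\<^bsub>M\<^esub> b) \<ominus>\<^bsub>M\<^esub> b = a"
  by (simp add: M.minus_eq M.a_assoc M.r_neg)

lemma diff_self: "a \<in> carrier M \<Longrightarrow> a \<ominus>\<^bsub>M\<^esub> a = \<zero>\<^bsub>M\<^esub>"
  by (simp add: M.minus_eq M.r_neg)

lemma diff_zeroD: "\<lbrakk>a \<ominus>\<^bsub>M\<^esub> b = \<zero>\<^bsub>M\<^esub>; a \<in> carrier M; b \<in> carrier M\<rbrakk> \<Longrightarrow> a = b"
  using diff_add_cancel[of a b] by simp

lemma minus_diff: "\<lbrakk>a \<in> carrier M; b \<in> carrier M\<rbrakk> \<Longrightarrow> \<ominus>\<^bsub>M\<^esub> (a \<ominus>\<^bsub>M\<^esub> b) = b \<ominus>\<^bsub>M\<^esub> a"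
  by (simp add: M.minus_eq M.minus_add M.a_comm)

lemma smult_diff: "\<lbrakk>r \<in> carrier R; a \<in> carrier M; b \<in> carrier M\<rbrakk> \<Longrightarrow>
   r \<odot>\<^bsub>M\<^esub> (a \<ominus>\<^bsub>M\<^esub> b) = r \<odot>\<^bsub>M\<^esub> a \<ominus>\<^bsub>M\<^esub> r \<odot>\<^bsub>M\<^esub> b"
  by (simp add: M.minus_eq smult_r_distr smult_r_minus)

lemma smult_diff_left: "\<lbrakk>r \<in> carrier R; s \<in> carrier R; a \<in> carrier M\<rbrakk> \<Longrightarrow>
   (r \<ominus> s) \<odot>\<^bsub>M\<^esub> a = r \<odot>\<^bsub>M\<^esub> a \<ominus>\<^bsub>M\<^esub> s \<odot>\<^bsub>M\<^esub> a"
  by (simp add: M.minus_eq R.minus_eq smult_l_distr smult_l_minus)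

lemma smult_lcomm: "\<lbrakk>r \<in> carrier R; s \<in> carrier R; a \<in> carrier M\<rbrakk> \<Longrightarrow>
   r \<odot>\<^bsub>M\<^esub> (s \<odot>\<^bsub>M\<^esub> a) = s \<odot>\<^bsub>M\<^esub> (r \<odot>\<^bsub>M\<^esub> a)"
  by (metis R.m_comm smult_assoc1)

lemma lc_closed [simp]: "vec (carrier R) v \<Longrightarrow> vec (carrier M) x \<Longrightarrow> lc M k v x \<in> carrier M"
  by (induction k) auto

lemma lc_cong:
  "(\<And>i. i < k \<Longrightarrow> v i = w i) \<Longrightarrow> (\<And>i. i < k \<Longrightarrow> x i = y i) \<Longrightarrow> lc M k v x = lc M k w y"
  by (induction k) auto

lemma lc_add_right:
  "vec (carrier R) v \<Longrightarrow> vec (carrier M) x \<Longrightarrow> vec (carrier M) y \<Longrightarrow>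
   lc M k v (\<lambda>i. x i \<oplus>\<^bsub>M\<^esub> y i) = lc M k v x \<oplus>\<^bsub>M\<^esub> lc M k v y"
  by (induction k) (auto simp: smult_r_distr M.a_ac)

lemma lc_diff_right:
  "vec (carrier R) v \<Longrightarrow> vec (carrier M) x \<Longrightarrow> vec (carrier M) y \<Longrightarrow>
   lc M k v (\<lambda>i. x i \<ominus>\<^bsub>M\<^esub> y i) = lc M k v x \<ominus>\<^bsub>M\<^esub> lc M k v y"
  by (induction k) (auto simp: smult_diff add_diff diff_self)

lemma lc_add_left:
  "vec (carrier R) v \<Longrightarrow> vec (carrier R) w \<Longrightarrow> vec (carrier M) x \<Longrightarrow>
   lc M k (\<lambda>i. v i \<oplus> w i) x = lc M k v x \<oplus>\<^bsub>M\<^esub> lc M k w x"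
  by (induction k) (auto simp: smult_l_distr M.a_ac)

lemma lc_diff_left:
  "vec (carrier R) v \<Longrightarrow> vec (carrier R) w \<Longrightarrow> vec (carrier M) x \<Longrightarrow>
   lc M k (\<lambda>i. v i \<ominus> w i) x = lc M k v x \<ominus>\<^bsub>M\<^esub> lc M k w x"
  by (induction k) (auto simp: smult_diff_left add_diff diff_self)

lemma lc_smult_left:
  "a \<in> carrier R \<Longrightarrow> vec (carrier R) v \<Longrightarrow> vec (carrier M) x \<Longrightarrow>
   lc M k (\<lambda>i. a \<otimes> v i) x = a \<odot>\<^bsub>M\<^esub> lc M k v x"
  by (induction k) (auto simp: smult_assoc1 smult_r_distr)

lemma lc_smult_right:
  "a \<in> carrier R \<Longrightarrow> vec (carrier R) v \<Longrightarrow> vec (carrier M) x \<Longrightarrow>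
   lc M k v (\<lambda>i. a \<odot>\<^bsub>M\<^esub> x i) = a \<odot>\<^bsub>M\<^esub> lc M k v x"
  by (induction k) (auto simp: smult_lcomm smult_r_distr)

lemma lc_mult_smult:
  "vec (carrier R) a \<Longrightarrow> vec (carrier R) v \<Longrightarrow> vec (carrier M) x \<Longrightarrow>
   lc M k v (\<lambda>i. a i \<odot>\<^bsub>M\<^esub> x i) = lc M k (\<lambda>i. a i \<otimes> v i) x"
  by (induction k) (auto simp: smult_assoc1 smult_lcomm)

lemma lc_zero_right: "vec (carrier R) v \<Longrightarrow> lc M k v (\<lambda>i. \<zero>\<^bsub>M\<^esub>) = \<zero>\<^bsub>M\<^esub>"
  by (induction k) auto

lemma lc_zero_left: "vec (carrier M) x \<Longrightarrow> (\<And>i. i < k \<Longrightarrow> v i = \<zero>) \<Longrightarrow> lc M k v x = \<zero>\<^bsub>M\<^esub>"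
  by (induction k) auto

text \<open>The associative law (v B) x = v (B x), where \<open>B i\<close> is row \<open>i\<close>
  of the matrix. Composition of linear maps is always reduced to it.\<close>

lemma lc_assoc:
  assumes "vec (carrier R) v" "\<And>i. vec (carrier R) (B i)" "vec (carrier M) x"
  shows "lc M k (\<lambda>j. lc (self R) l v (\<lambda>i. B i j)) x = lc M l v (\<lambda>i. lc M k (B i) x)"
proof (induction l)
  case 0
  show ?case using assms by (simp add: lc_zero_left)
next
  case (Suc l)
  interpret S: module R "self R" by (rule R.self_module)
  have c: "lc (self R) l v (\<lambda>i. B i j) \<in> carrier R" for j
    using assms S.lc_closed[of v "\<lambda>i. B i j" l] by simp
  show ?case using assms c Suc
    by (simp add: lc_add_left lc_smult_left)
qed

lemma unit_vec_vec [simp]: "vec (carrier R) (unit_vec R i)"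
  by (simp add: unit_vec_def)

lemma lc_unit_vec: "vec (carrier M) x \<Longrightarrow> lc M k (unit_vec R i) x = (if i < k then x i else \<zero>\<^bsub>M\<^esub>)"
  by (induction k) (auto simp: unit_vec_def less_Suc_eq)

end

lemma (in cring) dot_comm:
  "vec (carrier R) v \<Longrightarrow> vec (carrier R) w \<Longrightarrow> lc (self R) k v w = lc (self R) k w v"
  by (induction k) (auto simp: m_comm)

lemma (in cring) dot_closed [simp]:
  "vec (carrier R) v \<Longrightarrow> vec (carrier R) w \<Longrightarrow> lc (self R) k v w \<in> carrier R"
  by (induction k) auto

section \<open>Congruence modulo a submodule\<close>

locale module_cong = module + fixes N assumes sub: "submodule N R M"
begin

text \<open>Quotient modules are never formed, so one module and one type serve for all
  \<open>N\<close> of the induction. Membership of both sides in the carrier is included to spare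
  side conditions in calculations.\<close>

definition cg :: "'c \<Rightarrow> 'c \<Rightarrow> bool" (infix \<open>\<asymp>\<close> 50)
  where "x \<asymp> y \<longleftrightarrow> x \<in> carrier M \<and> y \<in> carrier M \<and> x \<ominus>\<^bsub>M\<^esub> y \<in> N"

lemmas subE = submoduleE[OF sub]

lemma N_zero: "\<zero>\<^bsub>M\<^esub> \<in> N"
  using submodule.axioms(1)[OF sub] subgroup.one_closed by fastforce

lemma cgD: "x \<asymp> y \<Longrightarrow> x \<in> carrier M \<and> y \<in> carrier M"
  by (simp add: cg_def)

lemma cg_refl [simp]: "x \<in> carrier M \<Longrightarrow> x \<asymp> x"
  by (simp add: cg_def diff_self N_zero)

lemma cg_sym: "x \<asymp> y \<Longrightarrow> y \<asymp> x"
  unfolding cg_def using subE(3)[of "x \<ominus>\<^bsub>M\<^esub> y"] minus_diff[of x y] by simp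

lemma cg_trans [trans]: "x \<asymp> y \<Longrightarrow> y \<asymp> z \<Longrightarrow> x \<asymp> z"
  unfolding cg_def using subE(5)[of "x \<ominus>\<^bsub>M\<^esub> y" "y \<ominus>\<^bsub>M\<^esub> z"] diff_cancel_mid[of x y z] by simp

lemma cg_eq_trans [trans]: "x \<asymp> y \<Longrightarrow> y = z \<Longrightarrow> x \<asymp> z"
  by simp

lemma eq_cg_trans [trans]: "x = y \<Longrightarrow> y \<asymp> z \<Longrightarrow> x \<asymp> z"
  by simp

lemma cg_add: "x \<asymp> y \<Longrightarrow> x' \<asymp> y' \<Longrightarrow> x \<oplus>\<^bsub>M\<^esub> x' \<asymp> y \<oplus>\<^bsub>M\<^esub> y'"
  unfolding cg_def using subE(5) by (auto simp: add_diff)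

lemma cg_smult: "r \<in> carrier R \<Longrightarrow> x \<asymp> y \<Longrightarrow> r \<odot>\<^bsub>M\<^esub> x \<asymp> r \<odot>\<^bsub>M\<^esub> y"
  unfolding cg_def using subE(4) by (auto simp flip: smult_diff)

lemma cg_minus: "x \<asymp> y \<Longrightarrow> \<ominus>\<^bsub>M\<^esub> x \<asymp> \<ominus>\<^bsub>M\<^esub> y"
  using cg_smult[of "\<ominus> \<one>" x y] cgD[of x y] by (simp add: smult_l_minus)

lemma cg_diff: "x \<asymp> y \<Longrightarrow> x' \<asymp> y' \<Longrightarrow> x \<ominus>\<^bsub>M\<^esub> x' \<asymp> y \<ominus>\<^bsub>M\<^esub> y'"
  unfolding M.minus_eq by (intro cg_add cg_minus)

lemma cg_lc: "vec (carrier R) v \<Longrightarrow> (\<And>i. i < k \<Longrightarrow> x i \<asymp> y i) \<Longrightarrow> lc M k v x \<asymp> lc M k v y"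
  by (induction k) (auto intro!: cg_add cg_smult)

end

section \<open>Submodules of finite free modules over a Noetherian ring\<close>

text \<open>Submodules of \<open>R\<^sup>k\<close>: vectors are infinite sequences of which only the first \<open>k\<close> entries matter.\<close>

definition (in cring) vsub :: "nat \<Rightarrow> (nat \<Rightarrow> 'a) set \<Rightarrow> bool" where
  "vsub k V \<longleftrightarrow> (\<forall>v\<in>V. vec (carrier R) v) \<and> (\<lambda>i. \<zero>) \<in> V
     \<and> (\<forall>v\<in>V. \<forall>w\<in>V. (\<lambda>i. v i \<oplus> w i) \<in> V)
     \<and> (\<forall>a\<in>carrier R. \<forall>v\<in>V. (\<lambda>i. a \<otimes> v i) \<in> V)
     \<and> (\<forall>v\<in>V. \<forall>w. vec (carrier R) w \<longrightarrow> (\<forall>i<k. v i = w i) \<longrightarrow> w \<in> V)"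

context cring
begin

lemma vsubD:
  assumes "vsub k V"
  shows "\<And>v i. v \<in> V \<Longrightarrow> v i \<in> carrier R" "(\<lambda>i. \<zero>) \<in> V"
    "\<And>v w. v \<in> V \<Longrightarrow> w \<in> V \<Longrightarrow> (\<lambda>i. v i \<oplus> w i) \<in> V"
    "\<And>a v. a \<in> carrier R \<Longrightarrow> v \<in> V \<Longrightarrow> (\<lambda>i. a \<otimes> v i) \<in> V"
    "\<And>v w. v \<in> V \<Longrightarrow> vec (carrier R) w \<Longrightarrow> (\<And>i. i < k \<Longrightarrow> v i = w i) \<Longrightarrow> w \<in> V"
  using assms unfolding vsub_def by blast+

lemma vsub_diff:
  assumes V: "vsub k V" and "v \<in> V" "w \<in> V"
  shows "(\<lambda>i. v i \<ominus> w i) \<in> V"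
proof -
  have "(\<lambda>i. v i \<oplus> (\<ominus> \<one>) \<otimes> w i) \<in> V"
    using vsubD(3)[OF V \<open>v \<in> V\<close> vsubD(4)[OF V _ \<open>w \<in> V\<close>, of "\<ominus> \<one>"]] by simp
  moreover have "(\<lambda>i. v i \<oplus> (\<ominus> \<one>) \<otimes> w i) = (\<lambda>i. v i \<ominus> w i)"
    using vsubD(1)[OF V] assms(2,3) by (simp add: minus_eq l_minus)
  ultimately show ?thesis by simp
qed

lemma vsub_entries_ideal:
  assumes V: "vsub k V"
  shows "ideal ((\<lambda>v. v j) ` V) R"
proof (rule idealI)
  show "subgroup ((\<lambda>v. v j) ` V) (add_monoid R)"
  proof (rule group.subgroupI[OF a_group])
    show "(\<lambda>v. v j) ` V \<subseteq> carrier (add_monoid R)"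
      using vsubD(1)[OF V] by auto
    show "(\<lambda>v. v j) ` V \<noteq> {}" using vsubD(2)[OF V] by auto
    fix a b assume "a \<in> (\<lambda>v. v j) ` V" "b \<in> (\<lambda>v. v j) ` V"
    then obtain v w where vw: "v \<in> V" "a = v j" "w \<in> V" "b = w j" by auto
    show "a \<otimes>\<^bsub>add_monoid R\<^esub> b \<in> (\<lambda>v. v j) ` V"
      using vsubD(3)[OF V vw(1) vw(3)] vw(2,4) by (intro rev_image_eqI) auto
    have "(\<lambda>i. \<zero> \<ominus> v i) \<in> V" by (rule vsub_diff[OF V vsubD(2)[OF V] vw(1)])
    then show "inv\<^bsub>add_monoid R\<^esub> a \<in> (\<lambda>v. v j) ` V"
      using vw(2) vsubD(1)[OF V vw(1)] by (intro rev_image_eqI) (auto simp: minus_eq a_inv_def[symmetric])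
  qed
  fix a x assume "a \<in> (\<lambda>v. v j) ` V" and x: "x \<in> carrier R"
  then obtain v where v: "v \<in> V" "a = v j" by auto
  show "x \<otimes> a \<in> (\<lambda>v. v j) ` V"
    using vsubD(4)[OF V x v(1)] v(2) by (intro rev_image_eqI) auto
  then show "a \<otimes> x \<in> (\<lambda>v. v j) ` V"
    using x v vsubD(1)[OF V v(1)] by (simp add: m_comm)
qed (rule ring_axioms)

end

lemma (in noetherian_ring) ideal_sequence_stabilises:
  assumes "\<And>l::nat. ideal (J l) R" "\<And>l. J l \<subseteq> J (Suc l)"
  shows "\<exists>m. \<forall>l\<ge>m. J l = J m"
proof -
  have mono: "J a \<subseteq> J b" if "a \<le> b" for a b
    using lift_Suc_mono_le[of J, OF assms(2) that] .
  have total: "J a \<subseteq> J b \<or> J b \<subseteq> J a" for a b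
    using mono nle_le[of a b] by blast
  have "subset.chain {I. ideal I R} (range J)"
    unfolding subset.chain_def using assms(1) total by auto
  from ideal_chain_is_trivial[OF _ this] obtain m where m: "\<Union>(range J) = J m" by auto
  have "J l = J m" if "l \<ge> m" for l
    using mono[OF that] m by auto
  then show ?thesis by blast
qed

locale noetherian_cring = cring + noetherian_ring
begin

text \<open>Finite free modules are Noetherian, by induction on the rank: the last entries form an
  ascending chain of ideals, the vectors with last entry zero a chain in rank one less, and once
  both are constant so is the given chain.\<close>

lemma vsub_chain_stabilises:
  assumes "\<And>l. vsub k (V l)" "\<And>l. V l \<subseteq> V (Suc l)"
  shows "\<exists>m. \<forall>l\<ge>m. V l = V m"
  using assms
proof (induction k arbitrary: V)
  case 0
  \<comment> \<open>In rank 0 no entry matters, so every vector counts as equal to the zero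
    vector.\<close>
  have "V l = {v. vec (carrier R) v}" for l
    using vsubD(1)[OF 0(1)[of l]] vsubD(5)[OF 0(1)[of l] vsubD(2)[OF 0(1)[of l]]] by blast
  then show ?case by simp
next
  case (Suc k)
  note V = Suc.prems(1)
  have mono: "V a \<subseteq> V b" if "a \<le> b" for a b
    using lift_Suc_mono_le[of V, OF Suc.prems(2) that] .
  \<comment> \<open>Overwriting entry \<open>k\<close> by zero, rather than requiring it to be zero,
    keeps membership in \<open>W l\<close> independent of all entries from \<open>k\<close>
    on.\<close>
  define W where "W l = {v. vec (carrier R) v \<and> v(k := \<zero>) \<in> V l}" for l
  have upd_add: "(\<lambda>i. v i \<oplus> w i)(k := \<zero>) = (\<lambda>i. (v(k := \<zero>)) i \<oplus> (w(k := \<zero>)) i)" for v w :: "nat \<Rightarrow> 'a"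
    by auto
  have upd_mult: "(\<lambda>i. a \<otimes> v i)(k := \<zero>) = (\<lambda>i. a \<otimes> (v(k := \<zero>)) i)" if "a \<in> carrier R" for a and v :: "nat \<Rightarrow> 'a"
    using that by auto
  have "vsub k (W l)" for l
  proof -
    have z: "(\<lambda>i. \<zero>)(k := \<zero>) = (\<lambda>i. \<zero>)" by auto
    have loc: "w(k := \<zero>) \<in> V l"
      if "v(k := \<zero>) \<in> V l" "vec (carrier R) w" "\<forall>i<k. v i = w i" for v w
      by (rule vsubD(5)[OF V that(1)]) (use that in \<open>auto simp: less_Suc_eq\<close>)
    show ?thesis
      unfolding vsub_def W_def
      using vsubD(2)[OF V[of l]] vsubD(3,4)[OF V[of l]] loc
      by (auto simp only: mem_Collect_eq z upd_add upd_mult zero_closed a_closed m_closed)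
  qed
  moreover have "W l \<subseteq> W (Suc l)" for l
    using Suc.prems(2) by (auto simp: W_def)
  ultimately obtain m1 where m1: "\<forall>l\<ge>m1. W l = W m1"
    using Suc.IH[of W] by blast
  obtain m2 where m2: "\<forall>l\<ge>m2. (\<lambda>v. v k) ` V l = (\<lambda>v. v k) ` V m2"
    using ideal_sequence_stabilises[of "\<lambda>l. (\<lambda>v. v k) ` V l", OF vsub_entries_ideal[OF V]] Suc.prems(2)
    by blast
  define m where "m = max m1 m2"
  have "V l \<subseteq> V m" if l: "l \<ge> m" for l
  proof
    fix v assume v: "v \<in> V l"
    have "v k \<in> (\<lambda>v. v k) ` V m"
      using v m2 l unfolding m_def by (metis imageI max.cobounded2 order_trans)
    \<comment> \<open>Subtracting a vector of \<open>V m\<close> with the same last entry moves the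
      question into \<open>W l\<close>, which equals \<open>W m\<close>.\<close>
    then obtain v' where v': "v' \<in> V m" "v' k = v k" by auto
    have v'l: "v' \<in> V l" using v'(1) mono[OF l] by auto
    define d where "d = (\<lambda>i. v i \<ominus> v' i)"
    have dl: "d \<in> V l" unfolding d_def by (rule vsub_diff[OF V v v'l])
    have "d k = \<zero>"
      using v' vsubD(1)[OF V v] by (simp add: d_def minus_eq r_neg)
    then have dk: "d(k := \<zero>) = d" by auto
    have "d \<in> W l" using dl dk vsubD(1)[OF V dl] by (simp add: W_def)
    moreover have "W l = W m" using m1 l unfolding m_def by (metis max.cobounded1 order_trans)
    ultimately have "d \<in> W m" by simp
    then have "d \<in> V m" using dk by (simp add: W_def)
    from vsubD(3)[OF V v'(1) this] have "(\<lambda>i. v' i \<oplus> d i) \<in> V m" .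
    moreover have "v' i \<oplus> d i = v i" for i
      using vsubD(1)[OF V v, of i] vsubD(1)[OF V v'(1), of i]
        a_lcomm[of "v' i" "v i" "\<ominus> v' i"] by (simp add: d_def minus_eq r_neg)
    ultimately show "v \<in> V m" by simp
  qed
  then show ?case using mono by blast
qed

text \<open>Otherwise dependent choice would give a strictly ascending chain. The index
  \<open>w\<close> will be a factorisation of a map through a finite free module.\<close>

lemma vsub_maximal:
  assumes "P w0" "\<And>w. P w \<Longrightarrow> vsub k (V w)"
  shows "\<exists>w. P w \<and> (\<forall>w'. P w' \<longrightarrow> V w \<subseteq> V w' \<longrightarrow> V w' = V w)"
proof (rule ccontr)
  assume "\<not> ?thesis"
  then have *: "\<exists>w'. P w' \<and> V w \<subseteq> V w' \<and> V w' \<noteq> V w" if "P w" for w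
    using that by blast
  have "\<exists>f. \<forall>l. P (f l) \<and> (V (f l) \<subseteq> V (f (Suc l)) \<and> V (f (Suc l)) \<noteq> V (f l))"
    by (rule dependent_nat_choice) (use assms(1) * in blast)+
  then obtain f where f: "\<And>l. P (f l)" "\<And>l. V (f l) \<subseteq> V (f (Suc l))" "\<And>l. V (f (Suc l)) \<noteq> V (f l)"
    by blast
  obtain m where "\<forall>l\<ge>m. V (f l) = V (f m)"
    using vsub_chain_stabilises[of k "\<lambda>l. V (f l)", OF assms(2)[OF f(1)] f(2)] by blast
  then have "V (f (Suc m)) = V (f m)" using le_Suc_eq by blast
  with f(3) show False by blast
qed

end

text \<open>The double annihilator property of a finite family of functionals over the domain \<open>R/p\<close>,
  with denominators cleared.\<close>

lemma (in cring) functional_mod_prime: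
  fixes k :: nat and \<xi> :: "nat \<Rightarrow> (nat \<Rightarrow> 'a) \<Rightarrow> 'a"
  assumes p: "primeideal p R"
    and lin: "\<And>i v w. vec (carrier R) v \<Longrightarrow> vec (carrier R) w \<Longrightarrow> \<xi> i (\<lambda>j. v j \<ominus> w j) = \<xi> i v \<ominus> \<xi> i w"
      "\<And>i a v. a \<in> carrier R \<Longrightarrow> vec (carrier R) v \<Longrightarrow> \<xi> i (\<lambda>j. a \<otimes> v j) = a \<otimes> \<xi> i v"
      "\<And>i v. vec (carrier R) v \<Longrightarrow> \<xi> i v \<in> carrier R"
    and eta: "\<And>v w. vec (carrier R) v \<Longrightarrow> vec (carrier R) w \<Longrightarrow> \<eta> (\<lambda>j. v j \<ominus> w j) = \<eta> v \<ominus> \<eta> w"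
      "\<And>a v. a \<in> carrier R \<Longrightarrow> vec (carrier R) v \<Longrightarrow> \<eta> (\<lambda>j. a \<otimes> v j) = a \<otimes> \<eta> v"
      "\<And>v. vec (carrier R) v \<Longrightarrow> \<eta> v \<in> carrier R"
    and ker: "\<And>v. vec (carrier R) v \<Longrightarrow> (\<And>i. i < k \<Longrightarrow> \<xi> i v \<in> p) \<Longrightarrow> \<eta> v \<in> p"
  shows "\<exists>s u. s \<in> carrier R \<and> s \<notin> p \<and> vec (carrier R) u \<and>
    (\<forall>v. vec (carrier R) v \<longrightarrow> s \<otimes> \<eta> v \<ominus> lc (self R) k u (\<lambda>i. \<xi> i v) \<in> p)"
  using eta ker
proof (induction k arbitrary: \<eta>)
  case 0
  interpret p: primeideal p R by (rule p)
  have "\<one> \<notin> p" using p.I_notcarr p.one_imp_carrier by blast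
  \<comment> \<open>Without functionals, \<open>ker\<close> puts all values of \<open>\<eta>\<close>
    into \<open>p\<close>, so the denominator 1 will do.\<close>
  then show ?case using 0
    by (intro exI[of _ \<one>] exI[of _ "\<lambda>_. \<zero>"]) (auto simp: minus_eq)
next
  case (Suc k)
  interpret p: primeideal p R by (rule p)
  interpret S: module R "self R" by (rule self_module)
  note cl = Suc.prems(3) lin(3)
  show ?case
  \<comment> \<open>Either the last functional vanishes mod \<open>p\<close> wherever the earlier
    ones do, and it gets coefficient 0, or some common zero \<open>v0\<close> of the earlier ones
    serves as a pivot for it.\<close>
  proof (cases "\<forall>v. vec (carrier R) v \<longrightarrow> (\<forall>i<k. \<xi> i v \<in> p) \<longrightarrow> \<xi> k v \<in> p")
    case True
    have "\<eta> v \<in> p" if "vec (carrier R) v" "\<And>i. i < k \<Longrightarrow> \<xi> i v \<in> p" for v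
      using Suc.prems(4)[OF that(1)] True that by (metis less_Suc_eq)
    from Suc.IH[of \<eta>, OF Suc.prems(1-3) this]
    obtain s u where su: "s \<in> carrier R" "s \<notin> p" "vec (carrier R) u"
      "\<And>v. vec (carrier R) v \<Longrightarrow> s \<otimes> \<eta> v \<ominus> lc (self R) k u (\<lambda>i. \<xi> i v) \<in> p" by blast
    define u' where "u' = u(k := \<zero>)"
    have u': "vec (carrier R) u'" using su(3) by (simp add: u'_def)
    have "lc (self R) k u' (\<lambda>i. \<xi> i v) = lc (self R) k u (\<lambda>i. \<xi> i v)" for v
      by (rule S.lc_cong) (auto simp: u'_def)
    then have "lc (self R) (Suc k) u' (\<lambda>i. \<xi> i v) = lc (self R) k u (\<lambda>i. \<xi> i v)"
      if "vec (carrier R) v" for v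
      using that su(3) cl dot_closed[of u "\<lambda>i. \<xi> i v" k] by (simp add: u'_def)
    with su u' show ?thesis by metis
  next
    case False
    then obtain v0 where v0: "vec (carrier R) v0" "\<And>i. i < k \<Longrightarrow> \<xi> i v0 \<in> p" "\<xi> k v0 \<notin> p" by blast
    define a where "a = \<xi> k v0"
    define b where "b = \<eta> v0"
    have ab: "a \<in> carrier R" "b \<in> carrier R" using v0 cl by (auto simp: a_def b_def)
    \<comment> \<open>Gaussian elimination without division: \<open>\<eta>' v\<close> is the value
      of \<open>\<eta>\<close> at the vector \<open>w\<close> below, on which \<open>\<xi> k\<close>
      vanishes.\<close>
    define \<eta>' where "\<eta>' v = a \<otimes> \<eta> v \<ominus> b \<otimes> \<xi> k v" for v
    have "\<exists>s u. s \<in> carrier R \<and> s \<notin> p \<and> vec (carrier R) u \<and>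
       (\<forall>v. vec (carrier R) v \<longrightarrow> s \<otimes> \<eta>' v \<ominus> lc (self R) k u (\<lambda>i. \<xi> i v) \<in> p)"
    proof (rule Suc.IH)
      fix v w assume "vec (carrier R) v" "vec (carrier R) w"
      then show "\<eta>' (\<lambda>j. v j \<ominus> w j) = \<eta>' v \<ominus> \<eta>' w"
        unfolding \<eta>'_def Suc.prems(1)[OF \<open>vec (carrier R) v\<close> \<open>vec (carrier R) w\<close>] lin(1)[OF \<open>vec (carrier R) v\<close> \<open>vec (carrier R) w\<close>]
        using ab cl by (simp add: minus_eq r_distr r_minus minus_add a_ac)
    next
      fix c v assume "c \<in> carrier R" "vec (carrier R) v"
      then show "\<eta>' (\<lambda>j. c \<otimes> v j) = c \<otimes> \<eta>' v"
        using ab cl by (simp add: \<eta>'_def Suc.prems(2) lin(2) minus_eq r_distr r_minus m_lcomm)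
    next
      fix v assume "vec (carrier R) v"
      then show "\<eta>' v \<in> carrier R" using ab cl by (simp add: \<eta>'_def)
    next
      fix v assume v: "vec (carrier R) v" and vp: "\<And>i. i < k \<Longrightarrow> \<xi> i v \<in> p"
      define w where "w = (\<lambda>j. a \<otimes> v j \<ominus> \<xi> k v \<otimes> v0 j)"
      have w: "vec (carrier R) w" using ab v v0 cl by (simp add: w_def)
      have xw: "\<xi> i w = a \<otimes> \<xi> i v \<ominus> \<xi> k v \<otimes> \<xi> i v0" for i
        using ab v v0(1) cl by (simp add: w_def lin(1,2))
      have "\<xi> i w \<in> p" if "i < Suc k" for i
      proof (cases "i = k")
        case True
        then show ?thesis using xw[of k] ab v cl by (simp add: a_def[symmetric] m_comm minus_eq r_neg)
      next
        case False
        with that have "i < k" by simp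
        then show ?thesis using xw[of i] vp[of i] v0(2)[of i] ab v cl
          by (simp add: minus_eq p.I_l_closed)
      qed
      then have "\<eta> w \<in> p" by (rule Suc.prems(4)[OF w])
      moreover have "\<eta> w = \<eta>' v"
        using ab v v0(1) cl by (simp add: w_def \<eta>'_def Suc.prems(1,2) b_def[symmetric] m_comm[of b])
      ultimately show "\<eta>' v \<in> p" by simp
    qed
    then obtain s u where su: "s \<in> carrier R" "s \<notin> p" "vec (carrier R) u"
      "\<And>v. vec (carrier R) v \<Longrightarrow> s \<otimes> \<eta>' v \<ominus> lc (self R) k u (\<lambda>i. \<xi> i v) \<in> p" by blast
    \<comment> \<open>Expanding \<open>s \<otimes> \<eta>' v\<close> gives the coefficient
      \<open>s \<otimes> b\<close> at the last functional and the new denominator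
      \<open>s \<otimes> a\<close>, which stays outside \<open>p\<close> by primality.\<close>
    define u' where "u' = u(k := s \<otimes> b)"
    have sa: "s \<otimes> a \<in> carrier R" "s \<otimes> a \<notin> p"
      using su ab v0(3) p.I_prime[of s a] by (auto simp: a_def)
    have u': "vec (carrier R) u'" using su(1,3) ab by (simp add: u'_def)
    have "s \<otimes> a \<otimes> \<eta> v \<ominus> lc (self R) (Suc k) u' (\<lambda>i. \<xi> i v) \<in> p" if v: "vec (carrier R) v" for v
    proof -
      have "lc (self R) k u' (\<lambda>i. \<xi> i v) = lc (self R) k u (\<lambda>i. \<xi> i v)"
        by (rule S.lc_cong) (auto simp: u'_def)
      then have "s \<otimes> a \<otimes> \<eta> v \<ominus> lc (self R) (Suc k) u' (\<lambda>i. \<xi> i v) =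
        s \<otimes> \<eta>' v \<ominus> lc (self R) k u (\<lambda>i. \<xi> i v)"
        using v su(1,3) ab cl dot_closed[of u "\<lambda>i. \<xi> i v" k]
        by (simp add: u'_def \<eta>'_def minus_eq r_distr r_minus minus_add a_ac m_ac)
      with su(4)[OF v] show ?thesis by simp
    qed
    with sa u' show ?thesis by blast
  qed
qed

section \<open>The Mittag-Leffler argument\<close>

text \<open>In an inverse system with \<open>f n\<close> from level \<open>Suc n\<close> to level
  \<open>n\<close>, this comes down from level \<open>n + d\<close> to level \<open>n\<close>; the
  highest map is applied first.\<close>

primrec iter :: "(nat \<Rightarrow> 'h \<Rightarrow> 'h) \<Rightarrow> nat \<Rightarrow> nat \<Rightarrow> 'h \<Rightarrow> 'h" where
  "iter f n 0 h = h"
| "iter f n (Suc d) h = iter f n d (f (n + d) h)"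

lemma iter_add: "iter f n (d + e) h = iter f n d (iter f (n + d) e h)"
  by (induction e arbitrary: h) (simp_all add: add.assoc)

lemma iter_Suc: "iter f n (Suc d) h = f n (iter f (Suc n) d h)"
  using iter_add[of f n 1 d h] by simp

lemma iter_closed:
  "(\<And>n h. h \<in> H (Suc n) \<Longrightarrow> f n h \<in> H n) \<Longrightarrow> h \<in> H (n + d) \<Longrightarrow> iter f n d h \<in> H n"
  by (induction d arbitrary: h) auto

text \<open>Let \<open>st n\<close> consist of the elements that lift to every higher level. The
  image of a sufficiently high level lies in \<open>st n\<close>, hence each element of
  \<open>st n\<close> lifts to \<open>st (Suc n)\<close>, and dependent choice finishes.
  \<open>E n\<close> is a bare reflexive relation because the application compares only the first
  \<open>k n\<close> entries, modulo \<open>N\<close>.\<close>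

lemma mittag_leffler:
  fixes H :: "nat \<Rightarrow> 'h set" and f :: "nat \<Rightarrow> 'h \<Rightarrow> 'h" and E :: "nat \<Rightarrow> 'h \<Rightarrow> 'h \<Rightarrow> bool"
  assumes cl: "\<And>n h. h \<in> H (Suc n) \<Longrightarrow> f n h \<in> H n"
    and refl: "\<And>n h. h \<in> H n \<Longrightarrow> E n h h"
    and ne: "\<And>n. h0 \<in> H n"
    and stable: "\<And>n. \<exists>d. \<forall>e. \<forall>h\<in>H (n + d). \<exists>h'\<in>H (n + d + e). E n (iter f n d h) (iter f n (d + e) h')"
  shows "\<exists>y. \<forall>n. y n \<in> H n \<and> E n (y n) (f n (y (Suc n)))"
proof -
  from stable obtain d where d: "\<And>n e h. h \<in> H (n + d n) \<Longrightarrow>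
     \<exists>h'\<in>H (n + d n + e). E n (iter f n (d n) h) (iter f n (d n + e) h')" by metis
  define st where "st n = {y \<in> H n. \<forall>e. \<exists>h\<in>H (n + e). E n y (iter f n e h)}" for n
  have st: "iter f n (d n) h \<in> st n" if h: "h \<in> H (n + d n)" for n h
  proof -
    have "\<exists>h'\<in>H (n + e). E n (iter f n (d n) h) (iter f n e h')" for e
    proof (cases "e \<le> d n")
      case True
      then obtain c where c: "d n = e + c" using le_Suc_ex by blast
      have "iter f (n + e) c h \<in> H (n + e)"
        using iter_closed[of H f, OF cl] h c by (metis add.assoc)
      moreover have "E n (iter f n (d n) h) (iter f n (d n) h)"
        using refl iter_closed[of H f, OF cl] h by metis
      ultimately show ?thesis unfolding c iter_add by blast
    next
      case False
      then obtain c where "e = d n + c" using le_Suc_ex nle_le by metis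
      then show ?thesis using d[OF h, of c] by (simp add: add.assoc)
    qed
    then show ?thesis using iter_closed[of H f, OF cl] h by (auto simp: st_def)
  qed
  have "\<exists>y'. y' \<in> st (Suc n) \<and> E n y (f n y')" if y: "y \<in> st n" for n y
  proof -
    \<comment> \<open>The lift goes beyond level \<open>Suc n\<close> by the stabilisation index of
      that level, so coming down just to \<open>Suc n\<close> ends in
      \<open>st (Suc n)\<close>.\<close>
    obtain h where h: "h \<in> H (n + Suc (d (Suc n)))" "E n y (iter f n (Suc (d (Suc n))) h)"
      using y unfolding st_def by blast
    have "iter f (Suc n) (d (Suc n)) h \<in> st (Suc n)" using st h(1) by simp
    with h(2) show ?thesis unfolding iter_Suc by blast
  qed
  moreover have "\<exists>y. y \<in> st 0" using st ne by blast
  ultimately have "\<exists>y. \<forall>n. y n \<in> st n \<and> E n (y n) (f n (y (Suc n)))"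
    by (intro dependent_nat_choice) auto
  then show ?thesis unfolding st_def by blast
qed

text \<open>A sequence of linear maps between free modules, from rank \<open>k n\<close> to rank \<open>k (Suc n)\<close>,
  sending the \<open>i\<close>-th basis vector to \<open>A n i\<close>.\<close>

locale telescope = module +
  fixes k :: "nat \<Rightarrow> nat" and A :: "nat \<Rightarrow> nat \<Rightarrow> nat \<Rightarrow> 'a"
  assumes A_closed [simp]: "A n i j \<in> carrier R"
begin

text \<open>The row vector \<open>v\<close> times \<open>d\<close> successive matrices: the
  composite transition map from rank \<open>k n\<close> to rank \<open>k (n + d)\<close>.\<close>

primrec push :: "nat \<Rightarrow> nat \<Rightarrow> (nat \<Rightarrow> 'a) \<Rightarrow> nat \<Rightarrow> 'a" where
  "push n 0 v = v"
| "push n (Suc d) v = (\<lambda>j. lc (self R) (k (n + d)) (push n d v) (\<lambda>i. A (n + d) i j))"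

lemma push_closed [simp]: "vec (carrier R) v \<Longrightarrow> push n d v j \<in> carrier R"
  by (induction d arbitrary: j) auto

lemma push_diff:
  "vec (carrier R) v \<Longrightarrow> vec (carrier R) w \<Longrightarrow> push n d (\<lambda>j. v j \<ominus> w j) = (\<lambda>j. push n d v j \<ominus> push n d w j)"
  using module.lc_diff_left[OF R.self_module] by (induction d) auto

lemma push_add:
  "vec (carrier R) v \<Longrightarrow> vec (carrier R) w \<Longrightarrow> push n d (\<lambda>j. v j \<oplus> w j) = (\<lambda>j. push n d v j \<oplus> push n d w j)"
  using module.lc_add_left[OF R.self_module] by (induction d) auto

lemma push_smult:
  "a \<in> carrier R \<Longrightarrow> vec (carrier R) v \<Longrightarrow> push n d (\<lambda>j. a \<otimes> v j) = (\<lambda>j. a \<otimes> push n d v j)"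
  using module.lc_smult_left[OF R.self_module] by (induction d) auto

lemma push_zero: "push n d (\<lambda>j. \<zero>) = (\<lambda>j. \<zero>)"
  using module.lc_zero_left[OF R.self_module] by (induction d) auto

lemma push_local:
  "(\<And>i. i < k n \<Longrightarrow> v i = w i) \<Longrightarrow> j < k (n + d) \<Longrightarrow> push n d v j = push n d w j"
proof (induction d arbitrary: j)
  case (Suc d)
  show ?case by (simp, rule module.lc_cong[OF R.self_module]) (use Suc in auto)
qed auto

text \<open>The dual map: restriction of homomorphisms along \<open>A n\<close>, with
  \<open>h i\<close> the value at basis vector \<open>i\<close>. The index \<open>j\<close> is a
  passenger, later the position in a tower.\<close>

definition lin_step :: "nat \<Rightarrow> (nat \<Rightarrow> nat \<Rightarrow> 'c) \<Rightarrow> nat \<Rightarrow> nat \<Rightarrow> 'c" where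
  "lin_step n h = (\<lambda>i j. lc M (k (Suc n)) (A n i) (\<lambda>i'. h i' j))"

lemma lin_step_closed: "(\<And>i j. h i j \<in> carrier M) \<Longrightarrow> lin_step n h i j \<in> carrier M"
  by (simp add: lin_step_def)

text \<open>Adjointness of restriction and \<open>push\<close>, by repeated use of
  \<open>lc_assoc\<close>.\<close>

lemma lc_iter_lin_step:
  assumes "vec (carrier R) v" "\<And>i j. h i j \<in> carrier M"
  shows "lc M (k n) v (\<lambda>i. iter lin_step n d h i j) = lc M (k (n + d)) (push n d v) (\<lambda>i. h i j)"
  using assms(2)
proof (induction d arbitrary: h)
  case (Suc d)
  have "lc M (k n) v (\<lambda>i. iter lin_step n (Suc d) h i j)
    = lc M (k (n + d)) (push n d v) (\<lambda>i. lin_step (n + d) h i j)"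
    using Suc.IH[of "lin_step (n + d) h"] Suc.prems lin_step_closed by simp
  also have "\<dots> = lc M (k (n + Suc d)) (push n (Suc d) v) (\<lambda>i. h i j)"
    using assms(1) Suc.prems by (simp add: lin_step_def lc_assoc)
  finally show ?case .
qed simp

lemma iter_lin_step_eq:
  assumes "i < k n" "\<And>i j. h i j \<in> carrier M"
  shows "iter lin_step n d h i j = lc M (k (n + d)) (push n d (unit_vec R i)) (\<lambda>i. h i j)"
proof -
  have "iter lin_step n d h \<in> {h. \<forall>i j. h i j \<in> carrier M}"
    by (rule iter_closed[where H = "\<lambda>_. {h. \<forall>i j. h i j \<in> carrier M}"]) (use assms lin_step_closed in auto)
  then show ?thesis
    using lc_iter_lin_step[of "unit_vec R i" h n d j] assms by (simp add: lc_unit_vec)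
qed

text \<open>The differential on the product of the Hom(L_n, M) whose cokernel is lim^1;
  \<open>x n i\<close> is the value at basis vector \<open>i\<close> of level
  \<open>n\<close>.\<close>

definition bdry :: "(nat \<Rightarrow> nat \<Rightarrow> 'c) \<Rightarrow> nat \<Rightarrow> nat \<Rightarrow> 'c" where
  "bdry x n i = x n i \<ominus>\<^bsub>M\<^esub> lc M (k (Suc n)) (A n i) (x (Suc n))"

lemma bdry_closed [simp]: "(\<And>n i. x n i \<in> carrier M) \<Longrightarrow> bdry x n i \<in> carrier M"
  by (simp add: bdry_def)

lemma bdry_add: "(\<And>n i. x n i \<in> carrier M) \<Longrightarrow> (\<And>n i. y n i \<in> carrier M) \<Longrightarrow>
    bdry (\<lambda>n i. x n i \<oplus>\<^bsub>M\<^esub> y n i) n i = bdry x n i \<oplus>\<^bsub>M\<^esub> bdry y n i"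
  by (simp add: bdry_def lc_add_right add_diff)

lemma bdry_diff: "(\<And>n i. x n i \<in> carrier M) \<Longrightarrow> (\<And>n i. y n i \<in> carrier M) \<Longrightarrow>
    bdry (\<lambda>n i. x n i \<ominus>\<^bsub>M\<^esub> y n i) n i = bdry x n i \<ominus>\<^bsub>M\<^esub> bdry y n i"
  unfolding bdry_def by (subst lc_diff_right) (simp_all add: M.minus_eq M.minus_add M.a_ac)

lemma bdry_smult: "a \<in> carrier R \<Longrightarrow> (\<And>n i. x n i \<in> carrier M) \<Longrightarrow>
    bdry (\<lambda>n i. a \<odot>\<^bsub>M\<^esub> x n i) n i = a \<odot>\<^bsub>M\<^esub> bdry x n i"
  by (simp add: bdry_def lc_smult_right smult_diff)

text \<open>Every family is a boundary modulo \<open>N\<close>; for \<open>N = 0\<close> this is the vanishing of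
  \<open>Ext\<^sup>1\<close> from the colimit.\<close>

definition solvable_mod :: "'c set \<Rightarrow> bool" where
  "solvable_mod N \<longleftrightarrow> (\<forall>c. (\<forall>n i. c n i \<in> carrier M) \<longrightarrow>
     (\<exists>x. (\<forall>n i. x n i \<in> carrier M) \<and> (\<forall>n. \<forall>i<k n. c n i \<ominus>\<^bsub>M\<^esub> bdry x n i \<in> N)))"

end

text \<open>The vectors at level \<open>n\<close> whose image at level \<open>n + d\<close> vanishes
  mod \<open>p\<close> grow with \<open>d\<close>, so they are constant from some \<open>d\<close>
  on. Then each coordinate at level \<open>n + d\<close> vanishes mod \<open>p\<close> wherever all
  coordinates at level \<open>n + (d + e)\<close> do, and \<open>functional_mod_prime\<close>
  applies. This is the stabilisation of the dual images over the fraction field of R/p, read off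
  from kernels.\<close>

lemma (in telescope) mod_prime_relation:
  assumes noeth: "noetherian_cring R" and p: "primeideal p R"
  shows "\<exists>d. \<forall>e. \<forall>i<k (n + d). \<exists>s u. s \<in> carrier R \<and> s \<notin> p \<and> vec (carrier R) u \<and>
    (\<forall>v. vec (carrier R) v \<longrightarrow>
      s \<otimes> push n d v i \<ominus> lc (self R) (k (n + (d + e))) u (push n (d + e) v) \<in> p)"
proof -
  interpret N: noetherian_cring R by (rule noeth)
  interpret p: primeideal p R by (rule p)
  define V where "V d = {v. vec (carrier R) v \<and> (\<forall>j<k (n + d). push n d v j \<in> p)}" for d
  have "R.vsub (k n) (V d)" for d
    unfolding R.vsub_def
  proof (intro conjI ballI allI impI)
    fix v w assume v: "v \<in> V d" and w: "vec (carrier R) w" "\<forall>i<k n. v i = w i"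
    have "push n d w j \<in> p" if "j < k (n + d)" for j
      using push_local[of n v w j d] v w that unfolding V_def by auto
    then show "w \<in> V d" using w by (simp add: V_def)
  qed (auto simp: V_def push_zero push_add push_smult p.I_l_closed)
  moreover have lcp: "lc (self R) l u w \<in> p" if "\<And>i. i < l \<Longrightarrow> u i \<in> p" "vec (carrier R) w" for l u w
    using that by (induction l) (auto simp: p.I_r_closed)
  then have "V d \<subseteq> V (Suc d)" for d
    unfolding V_def by auto
  ultimately obtain d where d: "\<forall>l\<ge>d. V l = V d"
    using N.vsub_chain_stabilises[of "k n" V] by blast
  have "\<exists>s u. s \<in> carrier R \<and> s \<notin> p \<and> vec (carrier R) u \<and>
    (\<forall>v. vec (carrier R) v \<longrightarrow>
      s \<otimes> push n d v i \<ominus> lc (self R) (k (n + (d + e))) u (\<lambda>j. push n (d + e) v j) \<in> p)"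
    if i: "i < k (n + d)" for e i
  proof (rule R.functional_mod_prime[OF p])
    fix v assume v: "vec (carrier R) v" "\<And>i. i < k (n + (d + e)) \<Longrightarrow> push n (d + e) v i \<in> p"
    then have "v \<in> V (d + e)" by (simp add: V_def)
    moreover have "V (d + e) = V d" using d le_add1 by blast
    ultimately have "v \<in> V d" by simp
    then show "push n d v i \<in> p" using i by (simp add: V_def)
  qed (simp_all add: push_diff push_smult)
  then show ?thesis by blast
qed

section \<open>Towers modulo a submodule and the inhomogeneous system\<close>

locale telescope_cong = telescope + module_cong
begin

text \<open>Modulo \<open>N\<close> these are the homomorphisms to M/N from the colimit of R -> R ->
  ..., whose maps are the multiplications by \<open>t 0\<close>, \<open>t 1\<close>, ...\<close>

definition tower :: "(nat \<Rightarrow> 'a) \<Rightarrow> (nat \<Rightarrow> 'c) set" where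
  "tower t = {z. \<forall>j. z j \<asymp> t j \<odot>\<^bsub>M\<^esub> z (Suc j)}"

lemma towerD: "z \<in> tower t \<Longrightarrow> z j \<in> carrier M" "z \<in> tower t \<Longrightarrow> z j \<asymp> t j \<odot>\<^bsub>M\<^esub> z (Suc j)"
  by (auto simp: tower_def dest: cgD)

lemma tower_lc:
  assumes t: "vec (carrier R) t" and v: "vec (carrier R) v" and h: "\<And>i. h i \<in> tower t"
  shows "(\<lambda>j. lc M l v (\<lambda>i. h i j)) \<in> tower t"
  unfolding tower_def
proof (intro CollectI allI)
  fix j
  have "lc M l v (\<lambda>i. h i j) \<asymp> lc M l v (\<lambda>i. t j \<odot>\<^bsub>M\<^esub> h i (Suc j))"
    by (intro cg_lc v towerD(2)[OF h])
  also have "lc M l v (\<lambda>i. t j \<odot>\<^bsub>M\<^esub> h i (Suc j)) = t j \<odot>\<^bsub>M\<^esub> lc M l v (\<lambda>i. h i (Suc j))"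
    using t v towerD(1)[OF h] by (simp add: lc_smult_right)
  finally show "lc M l v (\<lambda>i. h i j) \<asymp> t j \<odot>\<^bsub>M\<^esub> lc M l v (\<lambda>i. h i (Suc j))" .
qed

lemma tower_zero: "vec (carrier R) t \<Longrightarrow> (\<lambda>j. \<zero>\<^bsub>M\<^esub>) \<in> tower t"
  by (auto simp: tower_def)

lemma tower_add:
  assumes t: "vec (carrier R) t" and z: "z \<in> tower t" "w \<in> tower t"
  shows "(\<lambda>j. z j \<oplus>\<^bsub>M\<^esub> w j) \<in> tower t"
  unfolding tower_def using cg_add[OF towerD(2)[OF z(1)] towerD(2)[OF z(2)]]
    t towerD(1)[OF z(1)] towerD(1)[OF z(2)] by (simp add: smult_r_distr)

lemma tower_diff:
  assumes t: "vec (carrier R) t" and z: "z \<in> tower t" "w \<in> tower t"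
  shows "(\<lambda>j. z j \<ominus>\<^bsub>M\<^esub> w j) \<in> tower t"
  unfolding tower_def using cg_diff[OF towerD(2)[OF z(1)] towerD(2)[OF z(2)]]
    t towerD(1)[OF z(1)] towerD(1)[OF z(2)] by (simp add: smult_diff)

text \<open>Writing t_j = g h_j for late j gives z_j = g (h_j z_{j+1}) modulo \<open>N\<close>, and
  the elements h_j z_{j+1} form a tower again. Thus a divisor of almost all \<open>t j\<close> acts
  surjectively on towers, up to congruence.\<close>

lemma tower_divisible:
  assumes t: "vec (carrier R) t" and g: "g \<in> carrier R"
    and div: "\<And>j. j \<ge> j0 \<Longrightarrow> \<exists>h\<in>carrier R. t j = g \<otimes> h" and z: "z \<in> tower t"
  shows "\<exists>w\<in>tower t. \<forall>j. z j \<asymp> g \<odot>\<^bsub>M\<^esub> w j"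
proof -
  \<comment> \<open>Earlier entries can be computed from later ones, so it is enough to give a tower
    from some index on.\<close>
  have extend: "\<exists>w\<in>tower t. \<forall>j. z j \<asymp> g \<odot>\<^bsub>M\<^esub> w j"
    if "vec (carrier M) w" "\<forall>j\<ge>l. w j \<asymp> t j \<odot>\<^bsub>M\<^esub> w (Suc j) \<and> z j \<asymp> g \<odot>\<^bsub>M\<^esub> w j" for l w
    using that
  proof (induction l arbitrary: w)
    case 0
    then show ?case unfolding tower_def by blast
  next
    case (Suc l)
    define w' where "w' = w(l := t l \<odot>\<^bsub>M\<^esub> w (Suc l))"
    have c: "vec (carrier M) w'" using Suc.prems(1) t by (simp add: w'_def)
    have "z l \<asymp> t l \<odot>\<^bsub>M\<^esub> z (Suc l)" by (rule towerD(2)[OF z])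
    also have "t l \<odot>\<^bsub>M\<^esub> z (Suc l) \<asymp> t l \<odot>\<^bsub>M\<^esub> (g \<odot>\<^bsub>M\<^esub> w (Suc l))"
      using Suc.prems(2) t by (intro cg_smult) auto
    also have "t l \<odot>\<^bsub>M\<^esub> (g \<odot>\<^bsub>M\<^esub> w (Suc l)) = g \<odot>\<^bsub>M\<^esub> w' l"
      using t g Suc.prems(1) by (simp add: w'_def smult_lcomm)
    finally have zl: "z l \<asymp> g \<odot>\<^bsub>M\<^esub> w' l" .
    have wl: "w' l \<asymp> t l \<odot>\<^bsub>M\<^esub> w' (Suc l)"
      using Suc.prems(1) t by (simp add: w'_def)
    have "w' j \<asymp> t j \<odot>\<^bsub>M\<^esub> w' (Suc j) \<and> z j \<asymp> g \<odot>\<^bsub>M\<^esub> w' j" if "j \<ge> l" for j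
    proof (cases "j = l")
      case False
      then have "j \<ge> Suc l" using that by simp
      then show ?thesis using Suc.prems(2) by (auto simp: w'_def)
    qed (use zl wl in auto)
    then show ?case by (intro Suc.IH[of w'] c) blast
  qed
  \<comment> \<open>Below \<open>j0\<close> the factor \<open>h j\<close> is arbitrary;
    \<open>extend\<close> replaces those entries of \<open>w\<close>.\<close>
  from div have "\<exists>h. \<forall>j. h j \<in> carrier R \<and> (j \<ge> j0 \<longrightarrow> t j = g \<otimes> h j)"
    by (intro choice) (metis g R.one_closed)
  then obtain h where h: "vec (carrier R) h" "\<And>j. j \<ge> j0 \<Longrightarrow> t j = g \<otimes> h j" by blast
  define w where "w j = h j \<odot>\<^bsub>M\<^esub> z (Suc j)" for j
  have "w j \<asymp> t j \<odot>\<^bsub>M\<^esub> w (Suc j) \<and> z j \<asymp> g \<odot>\<^bsub>M\<^esub> w j" if j: "j \<ge> j0" for j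
  proof
    have "h j \<odot>\<^bsub>M\<^esub> z (Suc j) \<asymp> h j \<odot>\<^bsub>M\<^esub> (t (Suc j) \<odot>\<^bsub>M\<^esub> z (Suc (Suc j)))"
      using h(1) towerD(2)[OF z] by (intro cg_smult) auto
    also have "h j \<odot>\<^bsub>M\<^esub> (t (Suc j) \<odot>\<^bsub>M\<^esub> z (Suc (Suc j))) = t j \<odot>\<^bsub>M\<^esub> (h (Suc j) \<odot>\<^bsub>M\<^esub> z (Suc (Suc j)))"
      using h(1) g towerD(1)[OF z] h(2)[of j] h(2)[of "Suc j"] j
      by (simp flip: smult_assoc1 add: R.m_ac)
    finally show "w j \<asymp> t j \<odot>\<^bsub>M\<^esub> w (Suc j)" by (simp add: w_def)
    show "z j \<asymp> g \<odot>\<^bsub>M\<^esub> w j"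
      using towerD(2)[OF z, of j] h g j towerD(1)[OF z] by (simp add: w_def smult_assoc1)
  qed
  then show ?thesis using extend[of w j0] h(1) towerD(1)[OF z] by (simp add: w_def)
qed

end

context telescope_cong
begin

lemma cg_of_ideal:
  assumes "\<And>a m. a \<in> p \<Longrightarrow> m \<in> carrier M \<Longrightarrow> a \<odot>\<^bsub>M\<^esub> m \<in> N"
    and "r \<ominus> s \<in> p" "r \<in> carrier R" "s \<in> carrier R" "m \<in> carrier M"
  shows "r \<odot>\<^bsub>M\<^esub> m \<asymp> s \<odot>\<^bsub>M\<^esub> m"
  using assms(1)[OF assms(2,5)] assms(3-5) by (simp add: cg_def smult_diff_left)

lemma cg_lc_left:
  assumes "\<And>a m. a \<in> p \<Longrightarrow> m \<in> carrier M \<Longrightarrow> a \<odot>\<^bsub>M\<^esub> m \<in> N"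
    and "\<And>i. i < l \<Longrightarrow> v i \<ominus> w i \<in> p" "vec (carrier R) v" "vec (carrier R) w" "vec (carrier M) x"
  shows "lc M l v x \<asymp> lc M l w x"
  using assms(2) by (induction l) (auto intro!: cg_add cg_of_ideal[OF assms(1)] simp: assms(3-5))

text \<open>Divide by the denominators: h_i = s_i w_i modulo \<open>N\<close>. After restriction to
  level \<open>n\<close> the factors s_i meet the coordinates of \<open>push n d v\<close>, and
  \<open>rel\<close> exchanges them for coordinates at level \<open>n + (d + e)\<close>. Collecting
  what multiplies these gives \<open>h'\<close>, so the image of level \<open>n + d\<close> is
  already reached from each higher level.\<close>

lemma tower_linear_stable:
  assumes pN: "\<And>a m. a \<in> p \<Longrightarrow> m \<in> carrier M \<Longrightarrow> a \<odot>\<^bsub>M\<^esub> m \<in> N"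
    and t: "vec (carrier R) t"
    and s: "\<And>i. s i \<in> carrier R" and u: "\<And>i. vec (carrier R) (u i)"
    and rel: "\<And>i v. i < k (n + d) \<Longrightarrow> vec (carrier R) v \<Longrightarrow>
       s i \<otimes> push n d v i \<ominus> lc (self R) (k (n + (d + e))) (u i) (push n (d + e) v) \<in> p"
    and div: "\<And>i z. z \<in> tower t \<Longrightarrow> \<exists>w\<in>tower t. \<forall>j. z j \<asymp> s i \<odot>\<^bsub>M\<^esub> w j"
    and h: "\<And>i. h i \<in> tower t"
  shows "\<exists>h'. (\<forall>i. h' i \<in> tower t) \<and>
    (\<forall>i<k n. \<forall>j. iter lin_step n d h i j \<asymp> iter lin_step n (d + e) h' i j)"
proof -
  have "\<exists>w. \<forall>i. w i \<in> tower t \<and> (\<forall>j. h i j \<asymp> s i \<odot>\<^bsub>M\<^esub> w i j)"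
    by (intro choice allI) (use div[OF h] in blast)
  then obtain w where w: "\<And>i. w i \<in> tower t" "\<And>i j. h i j \<asymp> s i \<odot>\<^bsub>M\<^esub> w i j" by blast
  \<comment> \<open>The transpose of the coefficient matrix \<open>u\<close>, applied to the
    quotients \<open>w\<close>.\<close>
  define h' where "h' i' = (\<lambda>j. lc M (k (n + d)) (\<lambda>i. u i i') (\<lambda>i. w i j))" for i'
  have h': "h' i \<in> tower t" for i
    unfolding h'_def by (rule tower_lc[OF t]) (use u w(1) in auto)
  have hM: "h i j \<in> carrier M" "w i j \<in> carrier M" "h' i j \<in> carrier M" for i j
    using towerD(1)[OF h] towerD(1)[OF w(1)] towerD(1)[OF h'] by auto
  have "iter lin_step n d h i j \<asymp> iter lin_step n (d + e) h' i j" if i: "i < k n" for i j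
  proof -
    define v where "v = unit_vec R i"
    have v: "vec (carrier R) v" by (simp add: v_def)
    have "iter lin_step n d h i j = lc M (k (n + d)) (push n d v) (\<lambda>i. h i j)"
      unfolding v_def by (rule iter_lin_step_eq[OF i hM(1)])
    also have "\<dots> \<asymp> lc M (k (n + d)) (push n d v) (\<lambda>i. s i \<odot>\<^bsub>M\<^esub> w i j)"
      using v w(2) by (intro cg_lc) auto
    also have "lc M (k (n + d)) (push n d v) (\<lambda>i. s i \<odot>\<^bsub>M\<^esub> w i j)
       = lc M (k (n + d)) (\<lambda>i. s i \<otimes> push n d v i) (\<lambda>i. w i j)"
      using v s hM by (simp add: lc_mult_smult)
    also have "\<dots> \<asymp> lc M (k (n + d)) (\<lambda>i. lc (self R) (k (n + (d + e))) (u i) (push n (d + e) v)) (\<lambda>i. w i j)"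
      by (rule cg_lc_left[OF pN]) (use rel v s u hM in auto)
    also have "lc M (k (n + d)) (\<lambda>i. lc (self R) (k (n + (d + e))) (u i) (push n (d + e) v)) (\<lambda>i. w i j)
       = lc M (k (n + d)) (\<lambda>i. lc (self R) (k (n + (d + e))) (push n (d + e) v) (u i)) (\<lambda>i. w i j)"
      using v u by (simp add: R.dot_comm)
    also have "\<dots> = lc M (k (n + (d + e))) (push n (d + e) v) (\<lambda>i'. h' i' j)"
      using v u hM lc_assoc[of "push n (d + e) v" "\<lambda>i' i. u i i'" "\<lambda>i. w i j" "k (n + d)" "k (n + (d + e))"]
      by (simp add: h'_def)
    also have "\<dots> = iter lin_step n (d + e) h' i j"
      unfolding v_def by (rule iter_lin_step_eq[OF i hM(3), symmetric])
    finally show ?thesis .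
  qed
  with h' show ?thesis by blast
qed

text \<open>A sequence compatible under these affine maps solves x = c + A x, so a boundary problem
  becomes the search for a point of an inverse limit.\<close>

definition aff_step :: "(nat \<Rightarrow> nat \<Rightarrow> nat \<Rightarrow> 'c) \<Rightarrow> nat \<Rightarrow> (nat \<Rightarrow> nat \<Rightarrow> 'c) \<Rightarrow> nat \<Rightarrow> nat \<Rightarrow> 'c" where
  "aff_step c n h = (\<lambda>i j. c n i j \<oplus>\<^bsub>M\<^esub> lin_step n h i j)"

lemma iter_aff_step_diff:
  assumes c: "\<And>n i j. c n i j \<in> carrier M"
    and "\<And>i j. h i j \<in> carrier M" "\<And>i j. h' i j \<in> carrier M"
  shows "iter (aff_step c) n d h i j \<ominus>\<^bsub>M\<^esub> iter (aff_step c) n d h' i j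
    = iter lin_step n d (\<lambda>i j. h i j \<ominus>\<^bsub>M\<^esub> h' i j) i j"
  using assms(2,3)
proof (induction d arbitrary: h h')
  case (Suc d)
  have cl: "aff_step c n h i j \<in> carrier M" if "\<And>i j. h i j \<in> carrier M" for n h i j
    using that c lin_step_closed by (simp add: aff_step_def)
  have "aff_step c (n + d) h i j \<ominus>\<^bsub>M\<^esub> aff_step c (n + d) h' i j
      = lin_step (n + d) (\<lambda>i j. h i j \<ominus>\<^bsub>M\<^esub> h' i j) i j" for i j
    using c Suc.prems by (simp add: aff_step_def add_diff diff_self lin_step_closed)
      (simp add: lin_step_def lc_diff_right)
  then show ?case using Suc.IH[OF cl cl, OF Suc.prems] by simp
qed simp

text \<open>Mittag-Leffler for the affine maps. Differences of points evolve linearly, so stability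
  follows from \<open>tower_linear_stable\<close> once a base point from the higher level is
  available.\<close>

lemma tower_solvable:
  assumes pN: "\<And>a m. a \<in> p \<Longrightarrow> m \<in> carrier M \<Longrightarrow> a \<odot>\<^bsub>M\<^esub> m \<in> N"
    and t: "vec (carrier R) t"
    and s: "\<And>n e i. s n e i \<in> carrier R" and u: "\<And>n e i. vec (carrier R) (u n e i)"
    and rel: "\<And>n e i v. i < k (n + d n) \<Longrightarrow> vec (carrier R) v \<Longrightarrow>
       s n e i \<otimes> push n (d n) v i \<ominus> lc (self R) (k (n + (d n + e))) (u n e i) (push n (d n + e) v) \<in> p"
    and div: "\<And>n e i z. z \<in> tower t \<Longrightarrow> \<exists>w\<in>tower t. \<forall>j. z j \<asymp> s n e i \<odot>\<^bsub>M\<^esub> w j"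
    and c: "\<And>n i. c n i \<in> tower t"
  shows "\<exists>x. (\<forall>n i. x n i \<in> tower t) \<and> (\<forall>n. \<forall>i<k n. \<forall>j. x n i j \<asymp>
     c n i j \<oplus>\<^bsub>M\<^esub> lc M (k (Suc n)) (A n i) (\<lambda>i'. x (Suc n) i' j))"
proof -
  let ?H = "\<lambda>n::nat. {h. \<forall>i::nat. h i \<in> tower t}"
  let ?E = "\<lambda>n h h'. \<forall>i<k n. \<forall>j. h i j \<asymp> h' i j"
  have cM: "c n i j \<in> carrier M" for n i j using towerD(1)[OF c] .
  have step: "aff_step c n h \<in> ?H n" if "h \<in> ?H (Suc n)" for n h
    using that unfolding aff_step_def lin_step_def
    by (auto intro!: tower_add[OF t] tower_lc[OF t] c)
  have H0: "(\<lambda>i j. \<zero>\<^bsub>M\<^esub>) \<in> ?H n" for n using tower_zero[OF t] by simp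
  have itH: "iter (aff_step c) n l h i j \<in> carrier M" if "h \<in> ?H (n + l)" for n l h i j
    using iter_closed[of ?H "aff_step c", OF step that] towerD(1) by blast
  have "\<exists>y. \<forall>n. y n \<in> ?H n \<and> ?E n (y n) (aff_step c n (y (Suc n)))"
  proof (rule mittag_leffler)
    show "?E n h h" if "h \<in> ?H n" for n h
      using that by (simp add: towerD(1)[of _ t])
    show "\<exists>d. \<forall>e. \<forall>h\<in>?H (n + d). \<exists>h'\<in>?H (n + d + e).
        ?E n (iter (aff_step c) n d h) (iter (aff_step c) n (d + e) h')" for n
    proof (intro exI[of _ "d n"] allI ballI)
      fix e h assume h: "h \<in> ?H (n + d n)"
      \<comment> \<open>A base point at level \<open>n + d n\<close> that itself comes from level
        \<open>n + d n + e\<close>. Only the difference of \<open>h\<close> and \<open>q\<close> has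
        to be lifted, and for it the linear case suffices.\<close>
      define q where "q = iter (aff_step c) (n + d n) e (\<lambda>i j. \<zero>\<^bsub>M\<^esub>)"
      have q: "q \<in> ?H (n + d n)"
        unfolding q_def by (rule iter_closed[of ?H "aff_step c", OF step H0])
      have hq: "(\<lambda>j. h i j \<ominus>\<^bsub>M\<^esub> q i j) \<in> tower t" for i
        using tower_diff[OF t] h q by blast
      obtain h' where h': "\<And>i. h' i \<in> tower t"
        "\<And>i j. i < k n \<Longrightarrow> iter lin_step n (d n) (\<lambda>i j. h i j \<ominus>\<^bsub>M\<^esub> q i j) i j \<asymp> iter lin_step n (d n + e) h' i j"
        using tower_linear_stable[where n = n and d = "d n" and e = e and s = "s n e" and u = "u n e"
            and p = p and h = "\<lambda>i j. h i j \<ominus>\<^bsub>M\<^esub> q i j", OF pN t s u rel div hq]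
        by blast
      have M: "h i j \<in> carrier M" "q i j \<in> carrier M" "h' i j \<in> carrier M" for i j
        using towerD(1)[of "h i" t] towerD(1)[of "q i" t] towerD(1)[of "h' i" t] h q h'(1) by auto
      have h'': "h' \<in> ?H (n + (d n + e))" "h' \<in> ?H (n + d n + e)" using h'(1) by auto
      have eq: "iter (aff_step c) n (d n + e) (\<lambda>i j. \<zero>\<^bsub>M\<^esub>) = iter (aff_step c) n (d n) q"
        by (simp add: q_def iter_add)
      have "iter (aff_step c) n (d n) h i j \<asymp> iter (aff_step c) n (d n + e) h' i j" if i: "i < k n" for i j
      proof -
        let ?b = "iter (aff_step c) n (d n) q i j"
        have b: "?b \<in> carrier M" using itH[OF q] .
        have "iter (aff_step c) n (d n) h i j \<ominus>\<^bsub>M\<^esub> ?b = iter lin_step n (d n) (\<lambda>i j. h i j \<ominus>\<^bsub>M\<^esub> q i j) i j"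
          by (rule iter_aff_step_diff) (use cM M in auto)
        also have "\<dots> \<asymp> iter lin_step n (d n + e) h' i j" by (rule h'(2)[OF i])
        also have "iter lin_step n (d n + e) h' i j = iter (aff_step c) n (d n + e) h' i j \<ominus>\<^bsub>M\<^esub> ?b"
          using iter_aff_step_diff[of c h' "\<lambda>i j. \<zero>\<^bsub>M\<^esub>" n "d n + e" i j] cM M
          by (simp add: eq M.minus_eq)
        finally have "(iter (aff_step c) n (d n) h i j \<ominus>\<^bsub>M\<^esub> ?b) \<oplus>\<^bsub>M\<^esub> ?b
            \<asymp> (iter (aff_step c) n (d n + e) h' i j \<ominus>\<^bsub>M\<^esub> ?b) \<oplus>\<^bsub>M\<^esub> ?b"
          using b by (intro cg_add) auto
        then show ?thesis using b itH[OF h] itH[OF h''(1)] by (simp add: diff_add_cancel)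
      qed
      then show "\<exists>h'\<in>?H (n + d n + e). ?E n (iter (aff_step c) n (d n) h) (iter (aff_step c) n (d n + e) h')"
        using h''(2) by blast
    qed
  qed (use step H0 in auto)
  then show ?thesis unfolding aff_step_def lin_step_def by blast
qed

end

section \<open>Noetherian induction\<close>

lemma choice2: "(\<And>a b. \<exists>x. P a b x) \<Longrightarrow> \<exists>f. \<forall>a b. P a b (f a b)"
  by metis

lemma choice3: "(\<And>a b c. \<exists>x y. P a b c x y) \<Longrightarrow> \<exists>f g. \<forall>a b c. P a b c (f a b c) (g a b c)"
  by metis

text \<open>\<open>y 0\<close> plays the part of the sum x_0 + t_0 x_1 + t_0 t_1 x_2 + ... The
  divisibility condition makes the colimit of the multiplications by the t_j the localisation that
  inverts all of them.\<close>

definition (in module) chain_solvable :: bool where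
  "chain_solvable \<longleftrightarrow> (\<forall>t x. vec (carrier R) t \<longrightarrow> (\<forall>i j. i \<le> j \<longrightarrow> (\<exists>h\<in>carrier R. t j = t i \<otimes> h)) \<longrightarrow>
     vec (carrier M) x \<longrightarrow> (\<exists>y. vec (carrier M) y \<and> (\<forall>j. y j \<ominus>\<^bsub>M\<^esub> t j \<odot>\<^bsub>M\<^esub> y (Suc j) = x j)))"

text \<open>Solvability modulo N + a M with the cofactor \<open>d\<close> recorded, because the next
  reduction is applied to \<open>d\<close>.\<close>

definition (in telescope_cong) reducible :: "'a \<Rightarrow> bool" where
  "reducible a \<longleftrightarrow> (\<forall>c. (\<forall>n i. c n i \<in> carrier M) \<longrightarrow>
     (\<exists>x d. (\<forall>n i. x n i \<in> carrier M) \<and> (\<forall>n i. d n i \<in> carrier M) \<and>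
        (\<forall>n. \<forall>i<k n. c n i \<asymp> bdry x n i \<oplus>\<^bsub>M\<^esub> a \<odot>\<^bsub>M\<^esub> d n i)))"

context telescope_cong
begin

lemma reducibleD:
  "reducible a \<Longrightarrow> (\<forall>n i. c n i \<in> carrier M) \<Longrightarrow>
     \<exists>x d. (\<forall>n i. x n i \<in> carrier M) \<and> (\<forall>n i. d n i \<in> carrier M) \<and>
        (\<forall>n. \<forall>i<k n. c n i \<asymp> bdry x n i \<oplus>\<^bsub>M\<^esub> a \<odot>\<^bsub>M\<^esub> d n i)"
  unfolding reducible_def by (drule spec, erule mp)

lemma submodule_add_multiples:
  assumes a: "a \<in> carrier R"
  shows "submodule {n \<oplus>\<^bsub>M\<^esub> a \<odot>\<^bsub>M\<^esub> m |n m. n \<in> N \<and> m \<in> carrier M} R M" (is "submodule ?S R M")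
proof (rule submoduleI)
  have NM: "n \<in> carrier M" if "n \<in> N" for n using subE(1) that by auto
  show "?S \<subseteq> carrier M" using NM a by auto
  show "\<zero>\<^bsub>M\<^esub> \<in> ?S" using N_zero a by (auto intro!: exI[of _ "\<zero>\<^bsub>M\<^esub>"])
  fix x assume "x \<in> ?S"
  then obtain n m where x: "x = n \<oplus>\<^bsub>M\<^esub> a \<odot>\<^bsub>M\<^esub> m" "n \<in> N" "m \<in> carrier M" by auto
  have "\<ominus>\<^bsub>M\<^esub> x = \<ominus>\<^bsub>M\<^esub> n \<oplus>\<^bsub>M\<^esub> a \<odot>\<^bsub>M\<^esub> (\<ominus>\<^bsub>M\<^esub> m)"
    using x NM a by (simp add: M.minus_add smult_r_minus)
  then show "\<ominus>\<^bsub>M\<^esub> x \<in> ?S" using subE(3)[OF x(2)] x(3) by blast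
  show "b \<odot>\<^bsub>M\<^esub> x \<in> ?S" if b: "b \<in> carrier R" for b
  proof -
    have "b \<odot>\<^bsub>M\<^esub> x = b \<odot>\<^bsub>M\<^esub> n \<oplus>\<^bsub>M\<^esub> a \<odot>\<^bsub>M\<^esub> (b \<odot>\<^bsub>M\<^esub> m)"
      using x NM a b by (simp add: smult_r_distr smult_lcomm)
    then show ?thesis using subE(4)[OF b x(2)] x(3) b by blast
  qed
  fix y assume "y \<in> ?S"
  then obtain n' m' where y: "y = n' \<oplus>\<^bsub>M\<^esub> a \<odot>\<^bsub>M\<^esub> m'" "n' \<in> N" "m' \<in> carrier M" by auto
  have "x \<oplus>\<^bsub>M\<^esub> y = (n \<oplus>\<^bsub>M\<^esub> n') \<oplus>\<^bsub>M\<^esub> a \<odot>\<^bsub>M\<^esub> (m \<oplus>\<^bsub>M\<^esub> m')"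
    using x y NM a by (simp add: smult_r_distr M.a_ac)
  then show "x \<oplus>\<^bsub>M\<^esub> y \<in> ?S" using subE(5)[OF x(2) y(2)] x(3) y(3) by blast
qed

lemma reducible_if_solvable:
  assumes a: "a \<in> carrier R"
    and sol: "solvable_mod {n \<oplus>\<^bsub>M\<^esub> a \<odot>\<^bsub>M\<^esub> m |n m. n \<in> N \<and> m \<in> carrier M}"
  shows "reducible a"
  unfolding reducible_def
proof (intro allI impI)
  fix c :: "nat \<Rightarrow> nat \<Rightarrow> 'c" assume c: "\<forall>n i. c n i \<in> carrier M"
  with sol obtain x where x: "\<forall>n i. x n i \<in> carrier M"
    and cx: "\<And>n i. i < k n \<Longrightarrow> c n i \<ominus>\<^bsub>M\<^esub> bdry x n i \<in> {n \<oplus>\<^bsub>M\<^esub> a \<odot>\<^bsub>M\<^esub> m |n m. n \<in> N \<and> m \<in> carrier M}"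
    unfolding solvable_mod_def by blast
  have "\<exists>m. m \<in> carrier M \<and> (i < k n \<longrightarrow> c n i \<asymp> bdry x n i \<oplus>\<^bsub>M\<^esub> a \<odot>\<^bsub>M\<^esub> m)" for n i
  proof (cases "i < k n")
    case True
    obtain b m where bm: "c n i \<ominus>\<^bsub>M\<^esub> bdry x n i = b \<oplus>\<^bsub>M\<^esub> a \<odot>\<^bsub>M\<^esub> m" "b \<in> N" "m \<in> carrier M"
      using cx[OF True] by blast
    have bM: "b \<in> carrier M" using subE(1) bm(2) by blast
    have "c n i \<ominus>\<^bsub>M\<^esub> (bdry x n i \<oplus>\<^bsub>M\<^esub> a \<odot>\<^bsub>M\<^esub> m) = (c n i \<ominus>\<^bsub>M\<^esub> bdry x n i) \<ominus>\<^bsub>M\<^esub> a \<odot>\<^bsub>M\<^esub> m"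
      using c x a bm(3) by (simp add: M.minus_eq M.minus_add M.a_ac)
    also have "\<dots> = b" unfolding bm(1) using a bM bm(3) by (simp add: add_diff_cancel)
    finally show ?thesis using bm c x a by (auto simp: cg_def)
  qed auto
  then have "\<exists>d. \<forall>n i. d n i \<in> carrier M \<and> (i < k n \<longrightarrow> c n i \<asymp> bdry x n i \<oplus>\<^bsub>M\<^esub> a \<odot>\<^bsub>M\<^esub> d n i)"
    by (rule choice2)
  then obtain d where "\<And>n i. d n i \<in> carrier M"
    "\<And>n i. i < k n \<Longrightarrow> c n i \<asymp> bdry x n i \<oplus>\<^bsub>M\<^esub> a \<odot>\<^bsub>M\<^esub> d n i" by blast
  then show "\<exists>x d. (\<forall>n i. x n i \<in> carrier M) \<and> (\<forall>n i. d n i \<in> carrier M) \<and>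
        (\<forall>n. \<forall>i<k n. c n i \<asymp> bdry x n i \<oplus>\<^bsub>M\<^esub> a \<odot>\<^bsub>M\<^esub> d n i)"
    using x by blast
qed

text \<open>From c = bdry x + a d and d = bdry y + b e follows c = bdry (x + a y) + a b e, and the
  last term lies in \<open>N\<close>. This deals with ideals that are not prime.\<close>

lemma solvable_if_reducible_product:
  assumes a: "a \<in> carrier R" "reducible a" and b: "b \<in> carrier R" "reducible b"
    and ab: "\<And>m. m \<in> carrier M \<Longrightarrow> (a \<otimes> b) \<odot>\<^bsub>M\<^esub> m \<in> N"
  shows "solvable_mod N"
  unfolding solvable_mod_def
proof (intro allI impI)
  fix c :: "nat \<Rightarrow> nat \<Rightarrow> 'c" assume c: "\<forall>n i. c n i \<in> carrier M"
  obtain x d where x: "\<forall>n i. x n i \<in> carrier M" and d: "\<forall>n i. d n i \<in> carrier M"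
    and cx: "\<And>n i. i < k n \<Longrightarrow> c n i \<asymp> bdry x n i \<oplus>\<^bsub>M\<^esub> a \<odot>\<^bsub>M\<^esub> d n i"
    using reducibleD[OF a(2) c] by blast
  obtain y e where y: "\<forall>n i. y n i \<in> carrier M" and e: "\<forall>n i. e n i \<in> carrier M"
    and dy: "\<And>n i. i < k n \<Longrightarrow> d n i \<asymp> bdry y n i \<oplus>\<^bsub>M\<^esub> b \<odot>\<^bsub>M\<^esub> e n i"
    using reducibleD[OF b(2) d] by blast
  define z where "z n i = x n i \<oplus>\<^bsub>M\<^esub> a \<odot>\<^bsub>M\<^esub> y n i" for n i
  have z: "\<forall>n i. z n i \<in> carrier M" using x y a by (simp add: z_def)
  have "c n i \<asymp> bdry z n i" if i: "i < k n" for n i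
  proof -
    have "c n i \<asymp> bdry x n i \<oplus>\<^bsub>M\<^esub> a \<odot>\<^bsub>M\<^esub> d n i" by (rule cx[OF i])
    also have "\<dots> \<asymp> bdry x n i \<oplus>\<^bsub>M\<^esub> a \<odot>\<^bsub>M\<^esub> (bdry y n i \<oplus>\<^bsub>M\<^esub> b \<odot>\<^bsub>M\<^esub> e n i)"
      using a x by (intro cg_add cg_smult dy i) auto
    also have "\<dots> = bdry z n i \<oplus>\<^bsub>M\<^esub> (a \<otimes> b) \<odot>\<^bsub>M\<^esub> e n i"
      using a b x y e by (simp add: z_def[abs_def] bdry_add bdry_smult smult_r_distr smult_assoc1 M.a_assoc)
    also have "\<dots> \<asymp> bdry z n i \<oplus>\<^bsub>M\<^esub> \<zero>\<^bsub>M\<^esub>"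
      using ab e a b z by (intro cg_add) (auto simp: cg_def M.minus_eq M.r_neg N_zero)
    finally show ?thesis using z by simp
  qed
  then show "\<exists>x. (\<forall>n i. x n i \<in> carrier M) \<and> (\<forall>n. \<forall>i<k n. c n i \<ominus>\<^bsub>M\<^esub> bdry x n i \<in> N)"
    using z unfolding cg_def by blast
qed

lemma solvable_mod_prime:
  assumes noeth: "noetherian_cring R" and p: "primeideal p R"
    and pN: "\<And>a m. a \<in> p \<Longrightarrow> m \<in> carrier M \<Longrightarrow> a \<odot>\<^bsub>M\<^esub> m \<in> N"
    and red: "\<And>a. a \<in> carrier R \<Longrightarrow> a \<notin> p \<Longrightarrow> reducible a"
    and chain: chain_solvable
  shows "solvable_mod N"
  unfolding solvable_mod_def
proof (intro allI impI)
  interpret p: primeideal p R by (rule p)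
  have one: "\<one> \<notin> p" using p.I_notcarr p.one_imp_carrier by blast
  fix c :: "nat \<Rightarrow> nat \<Rightarrow> 'c" assume c: "\<forall>n i. c n i \<in> carrier M"
  from mod_prime_relation[OF noeth p] obtain d where d: "\<And>n e i. i < k (n + d n) \<Longrightarrow>
     \<exists>s u. s \<in> carrier R \<and> s \<notin> p \<and> vec (carrier R) u \<and>
      (\<forall>v. vec (carrier R) v \<longrightarrow>
        s \<otimes> push n (d n) v i \<ominus> lc (self R) (k (n + (d n + e))) u (push n (d n + e) v) \<in> p)"
    by metis
  \<comment> \<open>Outside the index range the denominator 1 and zero coefficients are taken, so
    that \<open>s\<close> and \<open>u\<close> are total and all values of \<open>s\<close> avoid
    \<open>p\<close>.\<close>
  have "\<exists>s u. s \<in> carrier R \<and> s \<notin> p \<and> vec (carrier R) u \<and> (i < k (n + d n) \<longrightarrow>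
      (\<forall>v. vec (carrier R) v \<longrightarrow>
        s \<otimes> push n (d n) v i \<ominus> lc (self R) (k (n + (d n + e))) u (push n (d n + e) v) \<in> p))" for n e i
  proof (cases "i < k (n + d n)")
    case False
    then show ?thesis using one by (intro exI[of _ \<one>] exI[of _ "\<lambda>_. \<zero>"]) simp
  qed (use d in simp)
  from choice3[of "\<lambda>n e i s u. s \<in> carrier R \<and> s \<notin> p \<and> vec (carrier R) u \<and> (i < k (n + d n) \<longrightarrow>
      (\<forall>v. vec (carrier R) v \<longrightarrow>
        s \<otimes> push n (d n) v i \<ominus> lc (self R) (k (n + (d n + e))) u (push n (d n + e) v) \<in> p))", OF this]
  obtain s u where s: "\<And>n e i. s n e i \<in> carrier R" "\<And>n e i. s n e i \<notin> p"
    and u: "\<And>n e i. vec (carrier R) (u n e i)"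
    and rel: "\<And>n e i v. i < k (n + d n) \<Longrightarrow> vec (carrier R) v \<Longrightarrow>
       s n e i \<otimes> push n (d n) v i \<ominus> lc (self R) (k (n + (d n + e))) (u n e i) (push n (d n + e) v) \<in> p"
    by blast
  \<comment> \<open>A single sequence running through all denominators
    \<open>s n e i\<close>.\<close>
  define g where "g m = (case prod_decode m of (n, m') \<Rightarrow> case prod_decode m' of (e, i) \<Rightarrow> s n e i)" for m
  have g: "g m \<in> carrier R" "g m \<notin> p" for m by (simp_all add: g_def s split: prod.split)
  have sg: "s n e i = g (prod_encode (n, prod_encode (e, i)))" for n e i by (simp add: g_def)
  define t where "t = rec_nat (g 0) (\<lambda>j r. r \<otimes> g (Suc j))"
  have t0: "t 0 = g 0" and tS: "t (Suc j) = t j \<otimes> g (Suc j)" for j by (simp_all add: t_def)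
  have tR: "t j \<in> carrier R" for j using g by (induction j) (simp_all add: t0 tS)
  have tp: "t j \<notin> p" for j
  proof (induction j)
    case (Suc j)
    then show ?case using p.I_prime[OF tR g(1)] g(2) by (auto simp: tS)
  qed (simp add: t0 g)
  have tdiv: "\<exists>h\<in>carrier R. t j = t i \<otimes> h" if "i \<le> j" for i j
    using that
  proof (induction j rule: dec_induct)
    case base then show ?case using tR by (intro bexI[of _ \<one>]) auto
  next
    case (step j)
    then obtain h where h: "h \<in> carrier R" "t j = t i \<otimes> h" by blast
    then show ?case using tR g by (intro bexI[of _ "h \<otimes> g (Suc j)"]) (auto simp: tS R.m_assoc)
  qed
  have gdiv: "\<exists>h\<in>carrier R. t j = g m \<otimes> h" if mj: "m \<le> j" for m j
  proof -
    obtain h where h: "h \<in> carrier R" "t j = t m \<otimes> h" using tdiv[OF mj] by blast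
    obtain r where r: "r \<in> carrier R" "t m = g m \<otimes> r"
    proof (cases m)
      case 0
      then show ?thesis using that[of \<one>] g by (simp add: t0)
    next
      case (Suc m')
      then show ?thesis using that[of "t m'"] g tR by (simp add: tS R.m_comm)
    qed
    show ?thesis using h r g by (intro bexI[of _ "r \<otimes> h"]) (auto simp: R.m_assoc)
  qed
  define Q where "Q j cj cn x \<longleftrightarrow> (\<forall>n i. x n i \<in> carrier M) \<and>
     (\<forall>n. \<forall>i<k n. cj n i \<asymp> bdry x n i \<oplus>\<^bsub>M\<^esub> t j \<odot>\<^bsub>M\<^esub> cn n i)" for j cj cn x
  have step: "\<exists>cn. ((\<forall>n i. cn n i \<in> carrier M) \<and> (Suc j = 0 \<longrightarrow> cn = c)) \<and> (\<exists>x. Q j cj cn x)"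
    if "(\<forall>n i. cj n i \<in> carrier M) \<and> (j = 0 \<longrightarrow> cj = c)" for cj and j :: nat
    using reducibleD[OF red[OF tR tp], of cj j] that unfolding Q_def by blast
  \<comment> \<open>Iterated reduction c_j = bdry x_j + t_j c_{j+1} modulo \<open>N\<close>. The
    clause for \<open>j = 0\<close> pins the initial value to \<open>c\<close> inside the dependent
    choice.\<close>
  have "\<exists>cc. \<forall>j. ((\<forall>n i. cc j n i \<in> carrier M) \<and> (j = 0 \<longrightarrow> cc j = c)) \<and> (\<exists>x. Q j (cc j) (cc (Suc j)) x)"
  proof (rule dependent_nat_choice)
    show "\<exists>x. (\<forall>n i. x n i \<in> carrier M) \<and> ((0::nat) = 0 \<longrightarrow> x = c)" using c by auto
  qed (rule step)
  then obtain cc where cc0: "cc 0 = c" and cc: "\<And>j n i. cc j n i \<in> carrier M"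
    and ccQ: "\<forall>j. \<exists>x. Q j (cc j) (cc (Suc j)) x" by blast
  from choice[OF ccQ] obtain x where xQ: "\<And>j. Q j (cc j) (cc (Suc j)) (x j)" by blast
  have x: "\<And>j n i. x j n i \<in> carrier M"
    and ccx: "\<And>j n i. i < k n \<Longrightarrow> cc j n i \<asymp> bdry (x j) n i \<oplus>\<^bsub>M\<^esub> t j \<odot>\<^bsub>M\<^esub> cc (Suc j) n i"
    using xQ unfolding Q_def by blast+
  \<comment> \<open>These equations hold exactly in \<open>M\<close> and are solved separately for
    each coordinate \<open>(n, i)\<close>.\<close>
  have "\<exists>y. vec (carrier M) y \<and> (\<forall>j. y j \<ominus>\<^bsub>M\<^esub> t j \<odot>\<^bsub>M\<^esub> y (Suc j) = x j n i)" for n i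
    using chain[unfolded chain_solvable_def, rule_format, of t "\<lambda>j. x j n i"] tR tdiv x by blast
  then obtain y where y: "\<And>n i j. y n i j \<in> carrier M"
    and yx: "\<And>n i j. y n i j \<ominus>\<^bsub>M\<^esub> t j \<odot>\<^bsub>M\<^esub> y n i (Suc j) = x j n i" by metis
  \<comment> \<open>Substituting x_j = y_j - t_j y_{j+1} into the reduction shows that c_j - bdry
    y_j is t_j times its successor. From \<open>k n\<close> on the zero tower is used, because
    \<open>tower_solvable\<close> expects a tower at every index.\<close>
  define z where "z n i = (if i < k n then (\<lambda>j. cc j n i \<ominus>\<^bsub>M\<^esub> bdry (\<lambda>n i. y n i j) n i) else (\<lambda>j. \<zero>\<^bsub>M\<^esub>))" for n i
  have z: "z n i \<in> tower t" for n i
  proof (cases "i < k n")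
    case True
    have "z n i j \<asymp> t j \<odot>\<^bsub>M\<^esub> z n i (Suc j)" for j
    proof -
      let ?B = "\<lambda>j. bdry (\<lambda>n i. y n i j) n i"
      have B: "?B j \<in> carrier M" for j using y by simp
      have X: "bdry (x j) n i = ?B j \<ominus>\<^bsub>M\<^esub> t j \<odot>\<^bsub>M\<^esub> ?B (Suc j)"
        using bdry_diff[of "\<lambda>n i. y n i j" "\<lambda>n i. t j \<odot>\<^bsub>M\<^esub> y n i (Suc j)" n i]
          bdry_smult[of "t j" "\<lambda>n i. y n i (Suc j)" n i] y tR by (simp add: yx)
      have "cc j n i \<ominus>\<^bsub>M\<^esub> ?B j \<asymp> (bdry (x j) n i \<oplus>\<^bsub>M\<^esub> t j \<odot>\<^bsub>M\<^esub> cc (Suc j) n i) \<ominus>\<^bsub>M\<^esub> ?B j"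
        using True B by (intro cg_diff ccx) auto
      also have "\<dots> = t j \<odot>\<^bsub>M\<^esub> (cc (Suc j) n i \<ominus>\<^bsub>M\<^esub> ?B (Suc j))"
        unfolding X using B[of j] B[of "Suc j"] tR[of j] cc[of "Suc j" n i]
        by (simp add: M.minus_eq smult_r_distr smult_r_minus M.a_ac M.r_neg1 M.r_neg2)
      finally show ?thesis using True by (simp add: z_def)
    qed
    then show ?thesis by (simp add: tower_def)
  next
    case False
    then show ?thesis using tower_zero[of t] tR by (simp add: z_def)
  qed
  obtain w where w: "\<And>n i. w n i \<in> tower t" and wz: "\<And>n i j. i < k n \<Longrightarrow>
     w n i j \<asymp> z n i j \<oplus>\<^bsub>M\<^esub> lc M (k (Suc n)) (A n i) (\<lambda>i'. w (Suc n) i' j)"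
  proof -
    have "\<exists>w\<in>tower t. \<forall>j. z' j \<asymp> s n e i \<odot>\<^bsub>M\<^esub> w j" if "z' \<in> tower t" for n e i z'
      unfolding sg by (rule tower_divisible[OF _ g(1) gdiv that]) (use tR in auto)
    note div = this
    have tv: "vec (carrier R) t" using tR by simp
    have "\<exists>w. (\<forall>n i. w n i \<in> tower t) \<and> (\<forall>n. \<forall>i<k n. \<forall>j. w n i j \<asymp>
       z n i j \<oplus>\<^bsub>M\<^esub> lc M (k (Suc n)) (A n i) (\<lambda>i'. w (Suc n) i' j))"
      by (rule tower_solvable[where d = d and p = p and s = s and u = u])
        (fact pN, fact tv, fact s(1), fact u, fact rel, fact div, fact z)
    then show ?thesis using that by blast
  qed
  \<comment> \<open>At position 0 the boundary of w is z_0 = c - bdry y_0 modulo \<open>N\<close>,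
    so adding y_0 gives boundary c.\<close>
  define sol where "sol n i = w n i 0 \<oplus>\<^bsub>M\<^esub> y n i 0" for n i
  have wM: "w n i j \<in> carrier M" for n i j using towerD(1)[OF w] .
  have solM: "\<forall>n i. sol n i \<in> carrier M" using wM y by (simp add: sol_def)
  have "c n i \<asymp> bdry sol n i" if i: "i < k n" for n i
  proof -
    let ?L = "lc M (k (Suc n)) (A n i) (\<lambda>i'. w (Suc n) i' 0)"
    let ?B = "bdry (\<lambda>n i. y n i 0) n i"
    have L: "?L \<in> carrier M" "?B \<in> carrier M" using wM y by auto
    have "bdry sol n i = (w n i 0 \<ominus>\<^bsub>M\<^esub> ?L) \<oplus>\<^bsub>M\<^esub> ?B"
      unfolding sol_def[abs_def] using wM y by (subst bdry_add) (simp_all add: bdry_def)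
    also have "\<dots> \<asymp> (z n i 0 \<oplus>\<^bsub>M\<^esub> ?L \<ominus>\<^bsub>M\<^esub> ?L) \<oplus>\<^bsub>M\<^esub> ?B"
      using L by (intro cg_add cg_diff wz i) auto
    also have "\<dots> = c n i"
      using L i c by (simp add: add_diff_cancel z_def cc0 diff_add_cancel)
    finally show ?thesis by (rule cg_sym)
  qed
  then show "\<exists>x. (\<forall>n i. x n i \<in> carrier M) \<and> (\<forall>n. \<forall>i<k n. c n i \<ominus>\<^bsub>M\<^esub> bdry x n i \<in> N)"
    using solM unfolding cg_def by blast
qed

end

lemma (in noetherian_ring) ideal_maximal:
  assumes "ideal I0 R" "P I0"
  shows "\<exists>I. ideal I R \<and> P I \<and> (\<forall>J. ideal J R \<longrightarrow> I \<subset> J \<longrightarrow> \<not> P J)"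
proof (rule ccontr)
  assume "\<not> ?thesis"
  then have *: "\<exists>J. (ideal J R \<and> P J) \<and> I \<subset> J" if "ideal I R \<and> P I" for I
    using that by blast
  have "\<exists>f. \<forall>l. (ideal (f l) R \<and> P (f l)) \<and> f l \<subset> f (Suc l)"
    by (rule dependent_nat_choice) (use assms * in blast)+
  then obtain f where f: "\<And>l. ideal (f l) R" "\<And>l. f l \<subset> f (Suc l)" by blast
  obtain m where "\<forall>l\<ge>m. f l = f m"
    using ideal_sequence_stabilises[of f, OF f(1) psubset_imp_subset[OF f(2)]] by blast
  then have "f (Suc m) = f m" using le_Suc_eq by blast
  with f(2)[of m] show False by blast
qed

text \<open>Noetherian induction by a maximal bad ideal \<open>I\<close>. Since \<open>bad\<close>
  quantifies over all \<open>N\<close> that contain the products of \<open>I\<close> and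
  \<open>M\<close>, the submodule generated by these is never formed. Every \<open>a\<close> outside
  \<open>I\<close> is reducible; \<open>I\<close> can neither be \<open>R\<close>, where
  \<open>N\<close> is everything, nor be prime, and otherwise a product in \<open>I\<close> of two
  outside elements gives the contradiction.\<close>

lemma (in telescope) solvable_if_chain_solvable:
  assumes noeth: "noetherian_cring R" and chain: chain_solvable
  shows "solvable_mod {\<zero>\<^bsub>M\<^esub>}"
proof (rule ccontr)
  interpret Nr: noetherian_cring R by (rule noeth)
  define bad where "bad I \<longleftrightarrow> (\<exists>N. submodule N R M \<and> (\<forall>a\<in>I. \<forall>m\<in>carrier M. a \<odot>\<^bsub>M\<^esub> m \<in> N) \<and> \<not> solvable_mod N)" for I
  assume "\<not> solvable_mod {\<zero>\<^bsub>M\<^esub>}"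
  moreover have "submodule {\<zero>\<^bsub>M\<^esub>} R M" by (rule submoduleI) auto
  ultimately have "bad {\<zero>}" unfolding bad_def by (intro exI[of _ "{\<zero>\<^bsub>M\<^esub>}"]) auto
  from Nr.ideal_maximal[of "{\<zero>}" bad, OF R.zeroideal this]
  obtain I where I: "ideal I R" and bad: "bad I" and max: "\<And>J. ideal J R \<Longrightarrow> I \<subset> J \<Longrightarrow> \<not> bad J" by blast
  interpret I: ideal I R by (rule I)
  from bad obtain N where N: "submodule N R M" and IN: "\<And>a m. a \<in> I \<Longrightarrow> m \<in> carrier M \<Longrightarrow> a \<odot>\<^bsub>M\<^esub> m \<in> N"
    and unsol: "\<not> solvable_mod N" unfolding bad_def by blast
  interpret tc: telescope_cong R M k A N 
    by (intro telescope_cong.intro telescope_axioms module_cong.intro module_axioms module_cong_axioms.intro N)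
  \<comment> \<open>N + a M contains the products of the strictly larger ideal I + (a) with
    \<open>M\<close>, and by maximality that ideal is not bad.\<close>
  have red: "tc.reducible a" if a: "a \<in> carrier R" "a \<notin> I" for a
  proof (rule tc.reducible_if_solvable[OF a(1)])
    let ?N = "{n \<oplus>\<^bsub>M\<^esub> a \<odot>\<^bsub>M\<^esub> m |n m. n \<in> N \<and> m \<in> carrier M}"
    let ?J = "I <+>\<^bsub>R\<^esub> PIdl a"
    have J: "ideal ?J R" by (rule R.add_ideals[OF I R.cgenideal_ideal[OF a(1)]])
    have Jelt: "\<exists>b\<in>I. \<exists>r\<in>carrier R. j = b \<oplus> r \<otimes> a" if "j \<in> ?J" for j
      using that by (auto simp: set_add_def' cgenideal_def)
    have "I \<subseteq> ?J"
    proof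
      fix b assume b: "b \<in> I"
      have "\<zero> \<in> PIdl a" using R.cgenideal_ideal[OF a(1)] by (simp add: additive_subgroup.zero_closed ideal.axioms(1))
      then have "b \<oplus> \<zero> \<in> ?J" using b unfolding set_add_def' by blast
      then show "b \<in> ?J" using I.a_Hcarr[OF b] by simp
    qed
    moreover have "\<zero> \<oplus> a \<in> ?J"
      using R.cgenideal_self[OF a(1)] I.zero_closed unfolding set_add_def' by blast
    then have "a \<in> ?J" using a(1) by simp
    ultimately have "I \<subset> ?J" using a(2) by blast
    from max[OF J this] have "\<not> bad ?J" .
    moreover have "submodule ?N R M" by (rule tc.submodule_add_multiples[OF a(1)])
    moreover have "j \<odot>\<^bsub>M\<^esub> m \<in> ?N" if j: "j \<in> ?J" and m: "m \<in> carrier M" for j m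
    proof -
      obtain b r where br: "b \<in> I" "r \<in> carrier R" "j = b \<oplus> r \<otimes> a" using Jelt[OF j] by blast
      have "j \<odot>\<^bsub>M\<^esub> m = b \<odot>\<^bsub>M\<^esub> m \<oplus>\<^bsub>M\<^esub> a \<odot>\<^bsub>M\<^esub> (r \<odot>\<^bsub>M\<^esub> m)"
        using br m a I.a_Hcarr[OF br(1)] by (simp add: smult_l_distr smult_assoc1 smult_lcomm)
      then show ?thesis using IN[OF br(1) m] br(2) m by blast
    qed
    ultimately show "solvable_mod ?N" unfolding bad_def by blast
  qed
  show False
  proof (cases "I = carrier R")
    case True
    then have MN: "carrier M \<subseteq> N" using IN[of \<one>] by auto
    have "solvable_mod N" unfolding solvable_mod_def
      by (intro allI impI exI[of _ "\<lambda>_ _. \<zero>\<^bsub>M\<^esub>"]) (use MN in auto)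
    with unsol show False ..
  next
    case False
    show False
    proof (cases "primeideal I R")
      case True
      show False using tc.solvable_mod_prime[OF noeth True IN red chain] unsol by blast
    next
      case np: False
      have "\<exists>a b. a \<in> carrier R \<and> b \<in> carrier R \<and> a \<otimes> b \<in> I \<and> a \<notin> I \<and> b \<notin> I"
        using np primeidealI[OF I R.is_cring False[symmetric]] by blast
      then obtain a b where ab: "a \<in> carrier R" "b \<in> carrier R" "a \<otimes> b \<in> I" "a \<notin> I" "b \<notin> I" by blast
      show False
        using tc.solvable_if_reducible_product[OF ab(1) red[OF ab(1,4)] ab(2) red[OF ab(2,5)] IN[OF ab(3)]] unsol by blast
    qed
  qed
qed

section \<open>Free presentations\<close>

lemma lin_homD:
  assumes "f \<in> lin_hom R M N"
  shows "\<And>x. x \<in> carrier M \<Longrightarrow> f x \<in> carrier N"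
    "\<And>x y. x \<in> carrier M \<Longrightarrow> y \<in> carrier M \<Longrightarrow> f (x \<oplus>\<^bsub>M\<^esub> y) = f x \<oplus>\<^bsub>N\<^esub> f y"
    "\<And>a x. a \<in> carrier R \<Longrightarrow> x \<in> carrier M \<Longrightarrow> f (a \<odot>\<^bsub>M\<^esub> x) = a \<odot>\<^bsub>N\<^esub> f x"
  using assms unfolding lin_hom_def by auto

text \<open>The value at \<open>c\<close> of the linear map on the free module that sends the
  generator \<open>x\<close> to \<open>e x\<close>; with \<open>e\<close> the identity it is
  \<open>lin_comb\<close>.\<close>

definition fsum :: "('r, 'x) ring_scheme \<Rightarrow> ('r, 'n, 'e) module_scheme \<Rightarrow> ('m \<Rightarrow> 'r) \<Rightarrow> ('m \<Rightarrow> 'n) \<Rightarrow> 'n" where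
  "fsum R N c e = (\<Oplus>\<^bsub>N\<^esub> x \<in> {x. c x \<noteq> \<zero>\<^bsub>R\<^esub>}. c x \<odot>\<^bsub>N\<^esub> e x)"

definition single :: "('r, 'x) ring_scheme \<Rightarrow> 'm \<Rightarrow> 'm \<Rightarrow> 'r" where
  "single R z = (\<lambda>x. if x = z then \<one>\<^bsub>R\<^esub> else \<zero>\<^bsub>R\<^esub>)"

lemma lin_comb_eq_fsum: "lin_comb R M c = fsum R M c (\<lambda>x. x)"
  by (simp add: lin_comb_def fsum_def)

lemma coeffsD:
  assumes "c \<in> coeffs R L"
  shows "\<And>x. c x \<in> carrier R" "finite {x. c x \<noteq> \<zero>\<^bsub>R\<^esub>}" "{x. c x \<noteq> \<zero>\<^bsub>R\<^esub>} \<subseteq> carrier L"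
  using assms unfolding coeffs_def by auto

context module
begin

text \<open>Addition and scaling change the support, so sums are compared over a common larger
  set.\<close>

lemma fsum_superset:
  assumes "finite S" "{x. c x \<noteq> \<zero>} \<subseteq> S" "\<And>x. c x \<in> carrier R" "\<And>x. x \<in> S \<Longrightarrow> e x \<in> carrier M"
  shows "fsum R M c e = (\<Oplus>\<^bsub>M\<^esub> x \<in> S. c x \<odot>\<^bsub>M\<^esub> e x)"
  unfolding fsum_def
  by (rule M.add.finprod_mono_neutral_cong_left) (use assms in auto)

lemma fsum_closed [simp]:
  assumes "c \<in> coeffs R L" "\<And>x. x \<in> carrier L \<Longrightarrow> e x \<in> carrier M"
  shows "fsum R M c e \<in> carrier M"
  unfolding fsum_def using assms by (intro M.finsum_closed) (auto simp: coeffs_def)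

lemma coeffs_add: "c \<in> coeffs R L \<Longrightarrow> d \<in> coeffs R L \<Longrightarrow> (\<lambda>x. c x \<oplus> d x) \<in> coeffs R L"
  unfolding coeffs_def
proof (intro CollectI conjI; (elim CollectE conjE)?)
  assume c: "\<forall>x. c x \<in> carrier R" "finite {x. c x \<noteq> \<zero>}" "{x. c x \<noteq> \<zero>} \<subseteq> carrier L"
    and d: "\<forall>x. d x \<in> carrier R" "finite {x. d x \<noteq> \<zero>}" "{x. d x \<noteq> \<zero>} \<subseteq> carrier L"
  have sub: "{x. c x \<oplus> d x \<noteq> \<zero>} \<subseteq> {x. c x \<noteq> \<zero>} \<union> {x. d x \<noteq> \<zero>}" by auto
  show "\<forall>x. c x \<oplus> d x \<in> carrier R" using c d by auto
  show "finite {x. c x \<oplus> d x \<noteq> \<zero>}" using finite_subset[OF sub] c d by auto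
  show "{x. c x \<oplus> d x \<noteq> \<zero>} \<subseteq> carrier L" using sub c d by blast
qed

lemma coeffs_smult: "a \<in> carrier R \<Longrightarrow> c \<in> coeffs R L \<Longrightarrow> (\<lambda>x. a \<otimes> c x) \<in> coeffs R L"
  unfolding coeffs_def
proof (intro CollectI conjI; (elim CollectE conjE)?)
  assume a: "a \<in> carrier R"
    and c: "\<forall>x. c x \<in> carrier R" "finite {x. c x \<noteq> \<zero>}" "{x. c x \<noteq> \<zero>} \<subseteq> carrier L"
  have sub: "{x. a \<otimes> c x \<noteq> \<zero>} \<subseteq> {x. c x \<noteq> \<zero>}" using a by auto
  show "\<forall>x. a \<otimes> c x \<in> carrier R" using c a by auto
  show "finite {x. a \<otimes> c x \<noteq> \<zero>}" using finite_subset[OF sub] c by auto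
  show "{x. a \<otimes> c x \<noteq> \<zero>} \<subseteq> carrier L" using sub c by blast
qed

lemma single_coeffs: "z \<in> carrier L \<Longrightarrow> single R z \<in> coeffs R L"
  unfolding coeffs_def single_def by (auto intro: finite_subset[of _ "{z}"])

lemma fsum_add:
  assumes c: "c \<in> coeffs R L" and d: "d \<in> coeffs R L" and e: "\<And>x. x \<in> carrier L \<Longrightarrow> e x \<in> carrier M"
  shows "fsum R M (\<lambda>x. c x \<oplus> d x) e = fsum R M c e \<oplus>\<^bsub>M\<^esub> fsum R M d e"
proof -
  let ?S = "{x. c x \<noteq> \<zero>} \<union> {x. d x \<noteq> \<zero>}"
  have S: "finite ?S" "?S \<subseteq> carrier L" using coeffsD[OF c] coeffsD[OF d] by auto
  have "fsum R M (\<lambda>x. c x \<oplus> d x) e = (\<Oplus>\<^bsub>M\<^esub> x \<in> ?S. (c x \<oplus> d x) \<odot>\<^bsub>M\<^esub> e x)"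
    by (rule fsum_superset) (use S coeffsD(1)[OF c] coeffsD(1)[OF d] e in auto)
  also have "\<dots> = (\<Oplus>\<^bsub>M\<^esub> x \<in> ?S. c x \<odot>\<^bsub>M\<^esub> e x \<oplus>\<^bsub>M\<^esub> d x \<odot>\<^bsub>M\<^esub> e x)"
    by (rule M.finsum_cong') (use S e coeffsD(1)[OF c] coeffsD(1)[OF d] in \<open>auto simp: smult_l_distr\<close>)
  also have "\<dots> = (\<Oplus>\<^bsub>M\<^esub> x \<in> ?S. c x \<odot>\<^bsub>M\<^esub> e x) \<oplus>\<^bsub>M\<^esub> (\<Oplus>\<^bsub>M\<^esub> x \<in> ?S. d x \<odot>\<^bsub>M\<^esub> e x)"
    by (rule M.finsum_addf) (use S e coeffsD(1)[OF c] coeffsD(1)[OF d] in auto)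
  also have "(\<Oplus>\<^bsub>M\<^esub> x \<in> ?S. c x \<odot>\<^bsub>M\<^esub> e x) = fsum R M c e"
    by (rule fsum_superset[symmetric]) (use S coeffsD(1)[OF c] e in auto)
  also have "(\<Oplus>\<^bsub>M\<^esub> x \<in> ?S. d x \<odot>\<^bsub>M\<^esub> e x) = fsum R M d e"
    by (rule fsum_superset[symmetric]) (use S coeffsD(1)[OF d] e in auto)
  finally show ?thesis .
qed

lemma fsum_smult:
  assumes a: "a \<in> carrier R" and c: "c \<in> coeffs R L" and e: "\<And>x. x \<in> carrier L \<Longrightarrow> e x \<in> carrier M"
  shows "fsum R M (\<lambda>x. a \<otimes> c x) e = a \<odot>\<^bsub>M\<^esub> fsum R M c e"
proof -
  let ?S = "{x. c x \<noteq> \<zero>}"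
  note S = coeffsD[OF c]
  have "fsum R M (\<lambda>x. a \<otimes> c x) e = (\<Oplus>\<^bsub>M\<^esub> x \<in> ?S. (a \<otimes> c x) \<odot>\<^bsub>M\<^esub> e x)"
    by (rule fsum_superset) (use S a e in auto)
  also have "\<dots> = (\<Oplus>\<^bsub>M\<^esub> x \<in> ?S. a \<odot>\<^bsub>M\<^esub> (c x \<odot>\<^bsub>M\<^esub> e x))"
    by (rule M.finsum_cong') (use S a e in \<open>auto simp: smult_assoc1\<close>)
  also have "\<dots> = a \<odot>\<^bsub>M\<^esub> fsum R M c e"
    unfolding fsum_def by (rule finsum_smult_ldistr[symmetric]) (use S a e in auto)
  finally show ?thesis .
qed

lemma fsum_single: "e z \<in> carrier M \<Longrightarrow> fsum R M (single R z) e = e z"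
proof -
  assume e: "e z \<in> carrier M"
  have "fsum R M (single R z) e = (\<Oplus>\<^bsub>M\<^esub> x \<in> {z}. single R z x \<odot>\<^bsub>M\<^esub> e x)"
    by (rule fsum_superset) (use e in \<open>auto simp: single_def\<close>)
  then show ?thesis using e by (simp add: single_def)
qed

lemma fsum_cong:
  assumes c: "c \<in> coeffs R L" and e: "\<And>x. x \<in> carrier L \<Longrightarrow> e x \<in> carrier M"
    and "\<And>x. c x \<noteq> \<zero> \<Longrightarrow> e x = f x"
  shows "fsum R M c e = fsum R M c f"
  unfolding fsum_def by (rule M.finsum_cong') (use coeffsD[OF c] assms(2,3) in fastforce)+

lemma fsum_add_right:
  assumes c: "c \<in> coeffs R L" and e: "\<And>x. x \<in> carrier L \<Longrightarrow> e x \<in> carrier M" "\<And>x. x \<in> carrier L \<Longrightarrow> f x \<in> carrier M"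
  shows "fsum R M c (\<lambda>x. e x \<oplus>\<^bsub>M\<^esub> f x) = fsum R M c e \<oplus>\<^bsub>M\<^esub> fsum R M c f"
proof -
  note S = coeffsD[OF c]
  have "fsum R M c (\<lambda>x. e x \<oplus>\<^bsub>M\<^esub> f x) = (\<Oplus>\<^bsub>M\<^esub> x \<in> {x. c x \<noteq> \<zero>}. c x \<odot>\<^bsub>M\<^esub> e x \<oplus>\<^bsub>M\<^esub> c x \<odot>\<^bsub>M\<^esub> f x)"
    unfolding fsum_def by (rule M.finsum_cong') (use S e in \<open>auto intro!: smult_r_distr\<close>)
  also have "\<dots> = fsum R M c e \<oplus>\<^bsub>M\<^esub> fsum R M c f"
    unfolding fsum_def by (rule M.finsum_addf) (use S e in auto)
  finally show ?thesis .
qed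

lemma fsum_hom:
  assumes N: "module R N" and h: "h \<in> lin_hom R M N"
    and c: "c \<in> coeffs R L" and e: "\<And>x. x \<in> carrier L \<Longrightarrow> e x \<in> carrier M"
  shows "fsum R N c (\<lambda>x. h (e x)) = h (fsum R M c e)"
proof -
  interpret N: module R N by (rule N)
  have "(\<Oplus>\<^bsub>N\<^esub> x \<in> S. c x \<odot>\<^bsub>N\<^esub> h (e x)) = h (\<Oplus>\<^bsub>M\<^esub> x \<in> S. c x \<odot>\<^bsub>M\<^esub> e x)"
    if "finite S" "S \<subseteq> carrier L" for S
    using that
  proof (induction S rule: finite_induct)
    case empty
    have "h (\<zero> \<odot>\<^bsub>M\<^esub> \<zero>\<^bsub>M\<^esub>) = \<zero> \<odot>\<^bsub>N\<^esub> h \<zero>\<^bsub>M\<^esub>" by (rule lin_homD(3)[OF h]) auto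
    then show ?case using lin_homD(1)[OF h M.zero_closed] by simp
  next
    case (insert x S)
    have cl: "c x \<odot>\<^bsub>M\<^esub> e x \<in> carrier M" if "x \<in> carrier L" for x using that coeffsD(1)[OF c] e by auto
    have fin: "(\<Oplus>\<^bsub>M\<^esub> x \<in> S. c x \<odot>\<^bsub>M\<^esub> e x) \<in> carrier M"
      by (rule M.finsum_closed) (use insert cl in auto)
    have "(\<Oplus>\<^bsub>N\<^esub> x \<in> insert x S. c x \<odot>\<^bsub>N\<^esub> h (e x)) = c x \<odot>\<^bsub>N\<^esub> h (e x) \<oplus>\<^bsub>N\<^esub> (\<Oplus>\<^bsub>N\<^esub> x \<in> S. c x \<odot>\<^bsub>N\<^esub> h (e x))"
      by (rule N.finsum_insert) (use insert coeffsD(1)[OF c] e lin_homD(1)[OF h] in auto)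
    also have "\<dots> = h (c x \<odot>\<^bsub>M\<^esub> e x \<oplus>\<^bsub>M\<^esub> (\<Oplus>\<^bsub>M\<^esub> x \<in> S. c x \<odot>\<^bsub>M\<^esub> e x))"
      using insert cl fin e coeffsD(1)[OF c] by (simp add: lin_homD(2,3)[OF h])
    also have "c x \<odot>\<^bsub>M\<^esub> e x \<oplus>\<^bsub>M\<^esub> (\<Oplus>\<^bsub>M\<^esub> x \<in> S. c x \<odot>\<^bsub>M\<^esub> e x) = (\<Oplus>\<^bsub>M\<^esub> x \<in> insert x S. c x \<odot>\<^bsub>M\<^esub> e x)"
      by (rule M.finsum_insert[symmetric]) (use insert cl in auto)
    finally show ?case .
  qed
  then show ?thesis unfolding fsum_def using coeffsD[OF c] by blast
qed

end

lemma free_mod_simps [simp]: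
  "carrier (free_mod R L) = coeffs R L" "\<zero>\<^bsub>free_mod R L\<^esub> = (\<lambda>x. \<zero>\<^bsub>R\<^esub>)"
  "c \<oplus>\<^bsub>free_mod R L\<^esub> d = (\<lambda>x. c x \<oplus>\<^bsub>R\<^esub> d x)" "a \<odot>\<^bsub>free_mod R L\<^esub> c = (\<lambda>x. a \<otimes>\<^bsub>R\<^esub> c x)"
  by (simp_all add: free_mod_def)

lemma pres_kernel_simps [simp]:
  "carrier (pres_kernel R L) = {c \<in> coeffs R L. lin_comb R L c = \<zero>\<^bsub>L\<^esub>}"
  "c \<oplus>\<^bsub>pres_kernel R L\<^esub> d = (\<lambda>x. c x \<oplus>\<^bsub>R\<^esub> d x)" "a \<odot>\<^bsub>pres_kernel R L\<^esub> c = (\<lambda>x. a \<otimes>\<^bsub>R\<^esub> c x)"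
  by (simp_all add: pres_kernel_def free_mod_def)

lemma (in module) free_mod_module: "module R (free_mod R L)"
proof (rule moduleI)
  show "abelian_group (free_mod R L)"
  proof (rule abelian_groupI)
    fix c assume c: "c \<in> carrier (free_mod R L)"
    show "\<exists>d\<in>carrier (free_mod R L). d \<oplus>\<^bsub>free_mod R L\<^esub> c = \<zero>\<^bsub>free_mod R L\<^esub>"
      using c coeffs_smult[of "\<ominus> \<one>" c L] coeffsD(1)[of c R L]
      by (intro bexI[of _ "\<lambda>x. (\<ominus> \<one>) \<otimes> c x"]) (auto simp: R.l_minus R.l_neg)
  next
    show "\<zero>\<^bsub>free_mod R L\<^esub> \<in> carrier (free_mod R L)" by (simp add: coeffs_def)
  qed (simp_all add: coeffs_add coeffsD(1)[of _ R L] R.a_ac)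
qed (simp_all add: R.is_cring coeffs_smult coeffsD(1)[of _ R L] R.l_distr R.r_distr R.m_assoc)

lemma (in module) lin_comb_hom: "lin_comb R M \<in> lin_hom R (free_mod R M) M"
  unfolding lin_hom_def lin_comb_eq_fsum
  by (auto simp: fsum_add[where L = M] fsum_smult[where L = M])

section \<open>Localisation at a countable multiplicative subset\<close>

locale mult_cring = cring + fixes S assumes S: "mult_subset R S"
begin

lemma S_carrier [simp]: "s \<in> S \<Longrightarrow> s \<in> carrier R"
  and S_one [simp]: "\<one> \<in> S"
  and S_mult [simp]: "s \<in> S \<Longrightarrow> t \<in> S \<Longrightarrow> s \<otimes> t \<in> S"
  using S unfolding mult_subset_def by auto

lemma loc_rel_iff: "((r, s), (r', s')) \<in> loc_rel R S \<longleftrightarrow> r \<in> carrier R \<and> s \<in> S \<and> r' \<in> carrier R \<and> s' \<in> S \<and>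
    (\<exists>t\<in>S. t \<otimes> (r \<otimes> s') = t \<otimes> (r' \<otimes> s))"
proof -
  interpret module R "self R" by (rule self_module)
  have "t \<otimes> (a \<ominus> b) = \<zero> \<longleftrightarrow> t \<otimes> a = t \<otimes> b" if "t \<in> carrier R" "a \<in> carrier R" "b \<in> carrier R" for t a b
    using that smult_diff[of t a b] diff_zeroD[of "t \<otimes> a" "t \<otimes> b"] diff_self[of "t \<otimes> b"] by auto
  then show ?thesis unfolding loc_rel_def by auto
qed

lemma loc_rel_equiv: "equiv (carrier R \<times> S) (loc_rel R S)"
proof (rule equivI)
  show "loc_rel R S \<subseteq> (carrier R \<times> S) \<times> carrier R \<times> S" by (auto simp: loc_rel_def)
  show "refl_on (carrier R \<times> S) (loc_rel R S)"
    by (rule refl_onI) (auto simp: loc_rel_iff intro: S_one)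
  show "sym (loc_rel R S)"
    by (rule symI) (auto simp: loc_rel_iff; metis)
  show "trans (loc_rel R S)"
  proof (rule transI)
    fix p q w assume "(p, q) \<in> loc_rel R S" "(q, w) \<in> loc_rel R S"
    moreover obtain r s where p: "p = (r, s)" by (cases p)
    moreover obtain r' s' where q: "q = (r', s')" by (cases q)
    moreover obtain r'' s'' where w: "w = (r'', s'')" by (cases w)
    ultimately obtain t t' where c: "r \<in> carrier R" "s \<in> S" "r' \<in> carrier R" "s' \<in> S" "r'' \<in> carrier R" "s'' \<in> S" "t \<in> S" "t' \<in> S"
      and h: "t \<otimes> (r \<otimes> s') = t \<otimes> (r' \<otimes> s)" "t' \<otimes> (r' \<otimes> s'') = t' \<otimes> (r'' \<otimes> s')"
      by (auto simp: loc_rel_iff)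
    have "(t \<otimes> t' \<otimes> s') \<otimes> (r \<otimes> s'') = (t \<otimes> (r \<otimes> s')) \<otimes> (t' \<otimes> s'')" using c by (simp add: m_ac)
    also have "\<dots> = (t' \<otimes> (r' \<otimes> s'')) \<otimes> (t \<otimes> s)" unfolding h(1) using c by (simp add: m_ac)
    also have "\<dots> = (t \<otimes> t' \<otimes> s') \<otimes> (r'' \<otimes> s)" unfolding h(2) using c by (simp add: m_ac)
    finally show "(p, w) \<in> loc_rel R S"
      unfolding p w loc_rel_iff using c by (auto intro!: bexI[of _ "t \<otimes> t' \<otimes> s'"])
  qed
qed

lemma loc_class_eq_iff:
  assumes "r \<in> carrier R" "s \<in> S" "r' \<in> carrier R" "s' \<in> S"
  shows "loc_class R S (r, s) = loc_class R S (r', s') \<longleftrightarrow> (\<exists>t\<in>S. t \<otimes> (r \<otimes> s') = t \<otimes> (r' \<otimes> s))"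
  unfolding loc_class_def
  using eq_equiv_class_iff[OF loc_rel_equiv, of "(r, s)" "(r', s')"] assms by (simp add: loc_rel_iff)

lemma loc_class_eqI:
  assumes "r \<in> carrier R" "s \<in> S" "r' \<in> carrier R" "s' \<in> S" "r \<otimes> s' = r' \<otimes> s"
  shows "loc_class R S (r, s) = loc_class R S (r', s')"
  using assms by (subst loc_class_eq_iff) (auto intro: S_one)

lemma loc_class_closed [simp]: "r \<in> carrier R \<Longrightarrow> s \<in> S \<Longrightarrow> loc_class R S (r, s) \<in> carrier (loc R S)"
  by (auto simp: loc_def loc_class_def quotient_def)

lemma loc_carrierE:
  assumes "U \<in> carrier (loc R S)"
  obtains r s where "r \<in> carrier R" "s \<in> S" "U = loc_class R S (r, s)"
  using assms by (auto simp: loc_def loc_class_def quotient_def)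

lemma loc_zero: "\<zero>\<^bsub>loc R S\<^esub> = loc_class R S (\<zero>, \<one>)"
  by (simp add: loc_def)

text \<open>The operations of \<open>loc\<close> act on representatives picked by
  \<open>SOME\<close>. Equivalence to the given fraction is all that is known of such a
  representative, and it suffices for the usual formulas.\<close>

lemma loc_rep_class:
  assumes "r \<in> carrier R" "s \<in> S"
  shows "\<exists>p q t. loc_rep (loc_class R S (r, s)) = (p, q) \<and> p \<in> carrier R \<and> q \<in> S \<and> t \<in> S \<and> t \<otimes> (r \<otimes> q) = t \<otimes> (p \<otimes> s)"
proof -
  have "(r, s) \<in> loc_class R S (r, s)"
    unfolding loc_class_def using equiv_class_self[OF loc_rel_equiv] assms by auto
  then have "loc_rep (loc_class R S (r, s)) \<in> loc_class R S (r, s)"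
    unfolding loc_rep_def by (rule someI)
  then have "((r, s), loc_rep (loc_class R S (r, s))) \<in> loc_rel R S" by (simp add: loc_class_def)
  then show ?thesis by (cases "loc_rep (loc_class R S (r, s))") (auto simp: loc_rel_iff)
qed

lemma loc_add:
  assumes a: "r \<in> carrier R" "s \<in> S" "r' \<in> carrier R" "s' \<in> S"
  shows "loc_class R S (r, s) \<oplus>\<^bsub>loc R S\<^esub> loc_class R S (r', s') = loc_class R S (r \<otimes> s' \<oplus> r' \<otimes> s, s \<otimes> s')"
proof -
  obtain p q t where 1: "loc_rep (loc_class R S (r, s)) = (p, q)" "p \<in> carrier R" "q \<in> S" "t \<in> S"
    "t \<otimes> (r \<otimes> q) = t \<otimes> (p \<otimes> s)"
    using loc_rep_class[OF a(1,2)] by blast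
  obtain p' q' t' where 2: "loc_rep (loc_class R S (r', s')) = (p', q')" "p' \<in> carrier R" "q' \<in> S" "t' \<in> S"
    "t' \<otimes> (r' \<otimes> q') = t' \<otimes> (p' \<otimes> s')"
    using loc_rep_class[OF a(3,4)] by blast
  have "(t \<otimes> t') \<otimes> ((r \<otimes> s' \<oplus> r' \<otimes> s) \<otimes> (q \<otimes> q'))
     = (t \<otimes> (r \<otimes> q)) \<otimes> (t' \<otimes> (s' \<otimes> q')) \<oplus> (t' \<otimes> (r' \<otimes> q')) \<otimes> (t \<otimes> (s \<otimes> q))"
    using a 1(2-4) 2(2-4) by (simp add: r_distr l_distr m_ac)
  also have "\<dots> = (t \<otimes> t') \<otimes> ((p \<otimes> q' \<oplus> p' \<otimes> q) \<otimes> (s \<otimes> s'))"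
    unfolding 1(5) 2(5) using a 1(2-4) 2(2-4) by (simp add: r_distr l_distr m_ac)
  finally have "loc_class R S (r \<otimes> s' \<oplus> r' \<otimes> s, s \<otimes> s') = loc_class R S (p \<otimes> q' \<oplus> p' \<otimes> q, q \<otimes> q')"
    using a 1(2-4) 2(2-4) by (subst loc_class_eq_iff) (auto intro!: bexI[of _ "t \<otimes> t'"])
  then show ?thesis using 1(1) 2(1) by (simp add: loc_def)
qed

lemma loc_smult:
  assumes a: "a \<in> carrier R" "r \<in> carrier R" "s \<in> S"
  shows "a \<odot>\<^bsub>loc R S\<^esub> loc_class R S (r, s) = loc_class R S (a \<otimes> r, s)"
proof -
  obtain p q t where 1: "loc_rep (loc_class R S (r, s)) = (p, q)" "p \<in> carrier R" "q \<in> S" "t \<in> S"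
    "t \<otimes> (r \<otimes> q) = t \<otimes> (p \<otimes> s)"
    using loc_rep_class[OF a(2,3)] by blast
  have "t \<otimes> ((a \<otimes> r) \<otimes> q) = a \<otimes> (t \<otimes> (r \<otimes> q))" using a 1(2-4) by (simp add: m_ac)
  also have "\<dots> = t \<otimes> ((a \<otimes> p) \<otimes> s)" unfolding 1(5) using a 1(2-4) by (simp add: m_ac)
  finally have "loc_class R S (a \<otimes> r, s) = loc_class R S (a \<otimes> p, q)"
    using a 1(2-4) by (subst loc_class_eq_iff) auto
  then show ?thesis using 1(1) by (simp add: loc_def)
qed

lemma loc_add_same:
  assumes "r \<in> carrier R" "r' \<in> carrier R" "s \<in> S"
  shows "loc_class R S (r, s) \<oplus>\<^bsub>loc R S\<^esub> loc_class R S (r', s) = loc_class R S (r \<oplus> r', s)"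
  using assms by (simp add: loc_add) (rule loc_class_eqI, auto simp: l_distr r_distr m_ac)

lemma loc_class_zero: "s \<in> S \<Longrightarrow> loc_class R S (\<zero>, s) = \<zero>\<^bsub>loc R S\<^esub>"
  unfolding loc_zero by (rule loc_class_eqI) auto

lemma loc_module: "module R (loc R S)"
proof (rule moduleI)
  show "abelian_group (loc R S)"
  proof (rule abelian_groupI)
    fix U V assume "U \<in> carrier (loc R S)" "V \<in> carrier (loc R S)"
    then obtain r s r' s' where
      UV: "r \<in> carrier R" "s \<in> S" "U = loc_class R S (r, s)" "r' \<in> carrier R" "s' \<in> S" "V = loc_class R S (r', s')"
      by (metis loc_carrierE)
    show "U \<oplus>\<^bsub>loc R S\<^esub> V \<in> carrier (loc R S)" using UV by (simp add: loc_add)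
    show "U \<oplus>\<^bsub>loc R S\<^esub> V = V \<oplus>\<^bsub>loc R S\<^esub> U" using UV by (simp add: loc_add m_comm a_comm)
    fix W assume "W \<in> carrier (loc R S)"
    then obtain r'' s'' where W: "r'' \<in> carrier R" "s'' \<in> S" "W = loc_class R S (r'', s'')"
      by (metis loc_carrierE)
    show "U \<oplus>\<^bsub>loc R S\<^esub> V \<oplus>\<^bsub>loc R S\<^esub> W = U \<oplus>\<^bsub>loc R S\<^esub> (V \<oplus>\<^bsub>loc R S\<^esub> W)"
      using UV W by (simp add: loc_add l_distr r_distr m_ac a_ac)
  next
    fix U assume "U \<in> carrier (loc R S)"
    then obtain r s where U: "r \<in> carrier R" "s \<in> S" "U = loc_class R S (r, s)"
      by (metis loc_carrierE)
    show "\<zero>\<^bsub>loc R S\<^esub> \<oplus>\<^bsub>loc R S\<^esub> U = U" using U by (simp add: loc_zero loc_add)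
    show "\<exists>V\<in>carrier (loc R S). V \<oplus>\<^bsub>loc R S\<^esub> U = \<zero>\<^bsub>loc R S\<^esub>"
      using U by (intro bexI[of _ "loc_class R S (\<ominus> r, s)"]) (auto simp: loc_add_same l_neg loc_class_zero)
  qed (simp add: loc_zero)
next
  fix a b U assume a: "a \<in> carrier R" "b \<in> carrier R" and "U \<in> carrier (loc R S)"
  then obtain r s where U: "r \<in> carrier R" "s \<in> S" "U = loc_class R S (r, s)"
    by (metis loc_carrierE)
  show "(a \<oplus> b) \<odot>\<^bsub>loc R S\<^esub> U = a \<odot>\<^bsub>loc R S\<^esub> U \<oplus>\<^bsub>loc R S\<^esub> b \<odot>\<^bsub>loc R S\<^esub> U"
    using a U by (simp add: loc_smult loc_add_same l_distr)
  show "(a \<otimes> b) \<odot>\<^bsub>loc R S\<^esub> U = a \<odot>\<^bsub>loc R S\<^esub> (b \<odot>\<^bsub>loc R S\<^esub> U)"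
    using a U by (simp add: loc_smult m_assoc)
next
  fix a U V assume a: "a \<in> carrier R" and "U \<in> carrier (loc R S)" "V \<in> carrier (loc R S)"
  then obtain r s r' s' where
    UV: "r \<in> carrier R" "s \<in> S" "U = loc_class R S (r, s)" "r' \<in> carrier R" "s' \<in> S" "V = loc_class R S (r', s')"
    by (metis loc_carrierE)
  show "a \<odot>\<^bsub>loc R S\<^esub> (U \<oplus>\<^bsub>loc R S\<^esub> V) = a \<odot>\<^bsub>loc R S\<^esub> U \<oplus>\<^bsub>loc R S\<^esub> a \<odot>\<^bsub>loc R S\<^esub> V"
    using a UV by (simp add: loc_add loc_smult r_distr m_assoc)
next
  fix a U assume a: "a \<in> carrier R" and "U \<in> carrier (loc R S)"
  then obtain r s where U: "r \<in> carrier R" "s \<in> S" "U = loc_class R S (r, s)"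
    by (metis loc_carrierE)
  show "a \<odot>\<^bsub>loc R S\<^esub> U \<in> carrier (loc R S)" using a U by (simp add: loc_smult)
next
  fix U assume "U \<in> carrier (loc R S)"
  then obtain r s where U: "r \<in> carrier R" "s \<in> S" "U = loc_class R S (r, s)"
    by (metis loc_carrierE)
  show "\<one> \<odot>\<^bsub>loc R S\<^esub> U = U" using U by (simp add: loc_smult)
qed (rule is_cring)

lemma loc_class_hom: "s \<in> S \<Longrightarrow> (\<lambda>r. loc_class R S (r, s)) \<in> lin_hom R (self R) (loc R S)"
  by (auto simp: lin_hom_def loc_add_same loc_smult)

end

section \<open>The localisation as a colimit of multiplications\<close>

locale divisor_chain = module +
  fixes t :: "nat \<Rightarrow> 'a"
  assumes t_closed [simp]: "t j \<in> carrier R"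
    and t_dvd: "i \<le> j \<Longrightarrow> \<exists>h\<in>carrier R. t j = t i \<otimes> h"
begin

text \<open>The submonoid generated by the \<open>t j\<close>; as a set of products over lists of
  indices it is visibly countable.\<close>

definition S where "S = range (\<lambda>l. foldr (\<lambda>j r. t j \<otimes> r) l \<one>)"

lemma foldr_closed: "foldr (\<lambda>j r. t j \<otimes> r) l \<one> \<in> carrier R"
  by (induction l) auto

lemma S_countable: "countable S"
  unfolding S_def by auto

lemma S_mult_subset: "mult_subset R S"
  unfolding mult_subset_def
proof (intro conjI ballI)
  show "S \<subseteq> carrier R" using foldr_closed by (auto simp: S_def)
  show "\<one> \<in> S" by (auto simp: S_def intro: range_eqI[of _ _ "[]"])
  fix a b assume "a \<in> S" "b \<in> S"
  then obtain l l' where l: "a = foldr (\<lambda>j r. t j \<otimes> r) l \<one>" "b = foldr (\<lambda>j r. t j \<otimes> r) l' \<one>"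
    by (auto simp: S_def)
  have "foldr (\<lambda>j r. t j \<otimes> r) l \<one> \<otimes> foldr (\<lambda>j r. t j \<otimes> r) l' \<one> = foldr (\<lambda>j r. t j \<otimes> r) (l @ l') \<one>"
    by (induction l) (simp_all add: foldr_closed m_assoc del: foldr_append)
  then show "a \<otimes> b \<in> S" unfolding l S_def by (rule range_eqI)
qed

sublocale L: mult_cring R S
  by (intro mult_cring.intro mult_cring_axioms.intro R.is_cring S_mult_subset)

sublocale Lm: module R "loc R S"
  by (rule L.loc_module)

sublocale Rm: module R "self R"
  by (rule R.self_module)

text \<open>\<open>T n m\<close> is the product of the \<open>t j\<close> with \<open>n \<le> j < m\<close>.\<close>

primrec T :: "nat \<Rightarrow> nat \<Rightarrow> 'a" where
  "T n 0 = \<one>"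
| "T n (Suc m) = (if n \<le> m then T n m \<otimes> t m else \<one>)"

lemma T_closed [simp]: "T n m \<in> carrier R"
  by (induction m) auto

lemma T_triv: "m \<le> n \<Longrightarrow> T n m = \<one>"
  by (cases m) auto

lemma t_in_S: "t j \<in> S"
  unfolding S_def by (rule range_eqI[of _ _ "[j]"]) simp

lemma T_in_S [simp]: "T n m \<in> S"
  by (induction m) (auto simp: t_in_S)

lemma T_compose: "n \<le> m \<Longrightarrow> m \<le> l \<Longrightarrow> T n l = T n m \<otimes> T m l"
proof (induction l)
  case (Suc l)
  then show ?case by (cases "m = Suc l") (auto simp: T_triv m_assoc)
qed (simp add: T_triv)

lemma T_rec: "j < m \<Longrightarrow> T j m = t j \<otimes> T (Suc j) m"
  using T_compose[of j "Suc j" m] by (simp add: T_triv)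

text \<open>Induction on the list of factors: a further factor \<open>t j\<close> divides every late
  \<open>t m'\<close>. So the products \<open>T n m\<close> are cofinal in \<open>S\<close> for
  divisibility, and denominators of the form \<open>T 0 m\<close> suffice.\<close>

lemma S_dvd_T:
  assumes "s \<in> S"
  shows "\<exists>m\<ge>n. \<exists>h\<in>carrier R. T n m = s \<otimes> h"
proof -
  have "\<exists>m\<ge>n. \<exists>h\<in>carrier R. T n m = foldr (\<lambda>j r. t j \<otimes> r) l \<one> \<otimes> h" for l
  proof (induction l)
    case Nil
    show ?case by (intro exI[of _ n] conjI bexI[of _ \<one>]) (auto simp: T_triv)
  next
    case (Cons j l)
    then obtain m h where m: "m \<ge> n" "h \<in> carrier R" "T n m = foldr (\<lambda>j r. t j \<otimes> r) l \<one> \<otimes> h" by blast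
    \<comment> \<open>At least \<open>m\<close>, so that \<open>t m'\<close> is not yet a factor of
      \<open>T n m\<close>, and at least \<open>j\<close>, so that \<open>t j\<close> divides
      it.\<close>
    define m' where "m' = max m j"
    have mm': "m \<le> m'" "j \<le> m'" "n \<le> m'" using m(1) by (auto simp: m'_def)
    obtain h' where h': "h' \<in> carrier R" "t m' = t j \<otimes> h'" using t_dvd[OF mm'(2)] by auto
    have "T n (Suc m') = T n m \<otimes> T m m' \<otimes> t m'"
      using T_compose[OF m(1) mm'(1)] mm' by simp
    also have "\<dots> = foldr (\<lambda>j r. t j \<otimes> r) (j # l) \<one> \<otimes> (h \<otimes> T m m' \<otimes> h')"
      unfolding m(3) h'(2) using m(2) h'(1) by (simp add: foldr_closed m_ac)
    finally show ?case using m h' by (intro exI[of _ "Suc m'"] conjI bexI[of _ "h \<otimes> T m m' \<otimes> h'"])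
        (use mm' in \<open>auto simp del: T.simps\<close>)
  qed
  with assms show ?thesis by (auto simp: S_def)
qed

abbreviation cls where "cls r n \<equiv> loc_class R S (r, T 0 n)"

lemma cls_rep:
  assumes "U \<in> carrier (loc R S)"
  shows "\<exists>r n. r \<in> carrier R \<and> U = cls r n"
proof -
  obtain r s where U: "r \<in> carrier R" "s \<in> S" "U = loc_class R S (r, s)"
    using assms by (rule L.loc_carrierE)
  obtain m h where h: "h \<in> carrier R" "T 0 m = s \<otimes> h" using S_dvd_T[OF U(2), of 0] by blast
  have "U = cls (r \<otimes> h) m"
    unfolding U(3) by (rule L.loc_class_eqI) (use U h T_in_S[of 0 m] in \<open>auto simp: m_ac simp del: T_in_S\<close>)
  then show ?thesis using U h by blast
qed

lemma cls_lift: "r \<in> carrier R \<Longrightarrow> n \<le> m \<Longrightarrow> cls r n = cls (r \<otimes> T n m) m"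
  using T_compose[of 0 n m] by (intro L.loc_class_eqI) (auto simp: m_ac)

text \<open>The element of \<open>S\<close> witnessing the equality, times \<open>s\<close>, divides
  a late \<open>T n m\<close>: elements that agree in the colimit agree at a finite stage.\<close>

lemma cls_eqD:
  assumes "r \<in> carrier R" "r' \<in> carrier R" "s \<in> S" "loc_class R S (r, s) = loc_class R S (r', s)"
  shows "\<exists>m\<ge>n. r \<otimes> T n m = r' \<otimes> T n m"
proof -
  obtain u where u: "u \<in> S" "u \<otimes> (r \<otimes> s) = u \<otimes> (r' \<otimes> s)"
    using assms by (auto simp: L.loc_class_eq_iff)
  obtain m h where m: "m \<ge> n" "h \<in> carrier R" "T n m = (u \<otimes> s) \<otimes> h"
    using S_dvd_T[of "u \<otimes> s" n] u assms by auto
  have "r \<otimes> T n m = (u \<otimes> (r \<otimes> s)) \<otimes> h" unfolding m(3) using assms u m(2) by (simp add: m_ac)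
  also have "\<dots> = r' \<otimes> T n m" unfolding m(3) u(2) using assms u(1) m(2) by (simp add: m_ac)
  finally show ?thesis using m(1) by blast
qed

text \<open>The free module on \<open>loc R S\<close> has a generator for each fraction, so each
  needs a fixed numerator and stage. Outside the localisation only \<open>r \<in> carrier R\<close>
  is kept, which makes closure unconditional.\<close>

definition rep :: "('a \<times> 'a) set \<Rightarrow> 'a \<times> nat" where
  "rep U = (SOME (r, n). r \<in> carrier R \<and> (U \<in> carrier (loc R S) \<longrightarrow> U = cls r n))"

abbreviation "rr U \<equiv> fst (rep U)"
abbreviation "nn U \<equiv> snd (rep U)"

lemma rep: "rr U \<in> carrier R" "U \<in> carrier (loc R S) \<Longrightarrow> U = cls (rr U) (nn U)"
proof -
  have "\<exists>p. case p of (r, n) \<Rightarrow> r \<in> carrier R \<and> (U \<in> carrier (loc R S) \<longrightarrow> U = cls r n)"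
    using cls_rep[of U] by (cases "U \<in> carrier (loc R S)") (auto intro: zero_closed)
  from someI_ex[OF this] show "rr U \<in> carrier R" "U \<in> carrier (loc R S) \<Longrightarrow> U = cls (rr U) (nn U)"
    by (auto simp: rep_def split: prod.splits)
qed

text \<open>The numerator of \<open>U\<close> over the common denominator \<open>T 0 m\<close>,
  meaningful once \<open>nn U \<le> m\<close>.\<close>

definition numer where "numer m U = rr U \<otimes> T (nn U) m"

lemma numer_closed [simp]: "numer m U \<in> carrier R"
  by (simp add: numer_def rep)

text \<open>The relation \<open>c\<close> between fractions already holds in \<open>R\<close>
  between their numerators at stage \<open>m\<close>.\<close>

definition good where
  "good c m \<longleftrightarrow> (\<forall>U. c U \<noteq> \<zero> \<longrightarrow> nn U \<le> m) \<and> fsum R (self R) c (numer m) = \<zero>"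

text \<open>The finitely many fractions in the support are brought to a common stage. There the sum
  of numerators vanishes only as a fraction, so a later stage from \<open>cls_eqD\<close> is
  needed.\<close>

lemma good_exists:
  assumes c: "c \<in> coeffs R (loc R S)" and zero: "lin_comb R (loc R S) c = \<zero>\<^bsub>loc R S\<^esub>"
  shows "\<exists>m. good c m"
proof -
  define m where "m = Max (insert 0 (nn ` {U. c U \<noteq> \<zero>}))"
  have m: "nn U \<le> m" if "c U \<noteq> \<zero>" for U
    unfolding m_def using coeffsD(2)[OF c] that by (intro Max_ge) auto
  have "lin_comb R (loc R S) c = fsum R (loc R S) c (\<lambda>U. cls (numer m U) m)"
    unfolding lin_comb_eq_fsum
  proof (rule Lm.fsum_cong[OF c])
    fix U assume U: "c U \<noteq> \<zero>"
    then have "U \<in> carrier (loc R S)" using coeffsD(3)[OF c] by auto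
    then show "U = cls (numer m U) m"
      using rep[of U] cls_lift[of "rr U" "nn U" m] m[OF U] by (simp add: numer_def)
  qed auto
  also have "\<dots> = cls (fsum R (self R) c (numer m)) m"
    by (rule Rm.fsum_hom[OF Lm.module_axioms L.loc_class_hom c]) auto
  finally have "cls (fsum R (self R) c (numer m)) m = cls \<zero> m"
    using zero by (simp add: L.loc_class_zero)
  moreover have f: "fsum R (self R) c (numer m) \<in> carrier R"
    using Rm.fsum_closed[OF c, of "numer m"] by simp
  ultimately obtain m' where m': "m' \<ge> m" "fsum R (self R) c (numer m) \<otimes> T m m' = \<zero> \<otimes> T m m'"
    using cls_eqD[of "fsum R (self R) c (numer m)" \<zero> "T 0 m" m] by auto
  have hom: "(\<lambda>r. r \<otimes> T m m') \<in> lin_hom R (self R) (self R)"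
    by (auto simp: lin_hom_def l_distr m_assoc)
  have "fsum R (self R) c (numer m') = fsum R (self R) c (\<lambda>U. numer m U \<otimes> T m m')"
  proof (rule Rm.fsum_cong[OF c])
    fix U assume "c U \<noteq> \<zero>"
    then show "numer m' U = numer m U \<otimes> T m m'"
      using T_compose[OF m m'(1), of U] by (simp add: numer_def rep m_assoc)
  qed auto
  also have "\<dots> = fsum R (self R) c (numer m) \<otimes> T m m'"
    by (rule Rm.fsum_hom[OF Rm.module_axioms hom c]) auto
  finally have "good c m'" unfolding good_def using m m' by (auto intro: order_trans)
  then show ?thesis ..
qed

end

section \<open>The extension of the localisation given by a right-hand side\<close>

locale divisor_chain_rhs = divisor_chain +
  fixes x :: "nat \<Rightarrow> 'c"
  assumes x_closed [simp]: "x j \<in> carrier M"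
begin

text \<open>In the extension of \<open>loc R S\<close> by \<open>M\<close> generated by elements \<open>e\<^sub>n\<close> with
  \<open>e\<^sub>n = t n e\<^sub>n\<^sub>+\<^sub>1 + x n\<close>, one has \<open>e\<^sub>n = T n m e\<^sub>m + P n m\<close>.\<close>

primrec P :: "nat \<Rightarrow> nat \<Rightarrow> 'c" where
  "P n 0 = \<zero>\<^bsub>M\<^esub>"
| "P n (Suc m) = (if n \<le> m then P n m \<oplus>\<^bsub>M\<^esub> T n m \<odot>\<^bsub>M\<^esub> x m else \<zero>\<^bsub>M\<^esub>)"

lemma P_closed [simp]: "P n m \<in> carrier M"
  by (induction m) auto

lemma P_triv: "m \<le> n \<Longrightarrow> P n m = \<zero>\<^bsub>M\<^esub>"
  by (cases m) auto

lemma P_rec: "j < m \<Longrightarrow> P j m = x j \<oplus>\<^bsub>M\<^esub> t j \<odot>\<^bsub>M\<^esub> P (Suc j) m"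
proof (induction m)
  case (Suc m)
  show ?case
  proof (cases "j = m")
    case True
    then show ?thesis by (simp add: P_triv T_triv)
  next
    case False
    then show ?thesis using Suc T_rec[of j m] by (simp add: smult_r_distr smult_assoc1 M.a_assoc)
  qed
qed simp

definition val where "val c m = fsum R M c (\<lambda>U. rr U \<odot>\<^bsub>M\<^esub> P (nn U) m)"

text \<open>One stage up, \<open>val\<close> gains the sum of the numerators times
  \<open>x m\<close>, and this sum is zero for a good relation.\<close>

lemma good_Suc:
  assumes c: "c \<in> coeffs R (loc R S)" and g: "good c m"
  shows "good c (Suc m) \<and> val c (Suc m) = val c m"
proof
  have hom: "(\<lambda>r. r \<otimes> t m) \<in> lin_hom R (self R) (self R)"
    by (auto simp: lin_hom_def l_distr m_assoc)
  have "fsum R (self R) c (numer (Suc m)) = fsum R (self R) c (\<lambda>U. numer m U \<otimes> t m)"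
    by (rule Rm.fsum_cong[OF c]) (use g in \<open>auto simp: good_def numer_def rep m_assoc\<close>)
  also have "\<dots> = fsum R (self R) c (numer m) \<otimes> t m"
    by (rule Rm.fsum_hom[OF Rm.module_axioms hom c]) auto
  finally show "good c (Suc m)" using g by (auto simp: good_def)
  have hom': "(\<lambda>r. r \<odot>\<^bsub>M\<^esub> x m) \<in> lin_hom R (self R) M"
    by (auto simp: lin_hom_def smult_l_distr smult_assoc1)
  have "val c (Suc m) = fsum R M c (\<lambda>U. rr U \<odot>\<^bsub>M\<^esub> P (nn U) m \<oplus>\<^bsub>M\<^esub> numer m U \<odot>\<^bsub>M\<^esub> x m)"
    unfolding val_def
    by (rule fsum_cong[OF c]) (use g in \<open>auto simp: good_def numer_def rep smult_assoc1 smult_r_distr\<close>)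
  also have "\<dots> = val c m \<oplus>\<^bsub>M\<^esub> fsum R M c (\<lambda>U. numer m U \<odot>\<^bsub>M\<^esub> x m)"
    unfolding val_def by (rule fsum_add_right[OF c]) (auto simp: rep)
  also have "fsum R M c (\<lambda>U. numer m U \<odot>\<^bsub>M\<^esub> x m) = fsum R (self R) c (numer m) \<odot>\<^bsub>M\<^esub> x m"
    by (rule Rm.fsum_hom[OF module_axioms hom' c]) auto
  also have "\<dots> = \<zero>\<^bsub>M\<^esub>" using g by (simp add: good_def)
  finally show "val c (Suc m) = val c m"
    using fsum_closed[OF c, of "\<lambda>U. rr U \<odot>\<^bsub>M\<^esub> P (nn U) m"] by (simp add: val_def rep)
qed

lemma good_mono:
  assumes c: "c \<in> coeffs R (loc R S)" and g: "good c m" and "m \<le> m'"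
  shows "good c m' \<and> val c m' = val c m"
  using \<open>m \<le> m'\<close> by (induction m' rule: dec_induct) (use g good_Suc[OF c] in auto)

text \<open>The homomorphism from the relation module to \<open>M\<close> that classifies the
  extension.\<close>

definition phi where "phi c = val c (SOME m. good c m)"

lemma phi_eq:
  assumes c: "c \<in> coeffs R (loc R S)" and g: "good c m"
  shows "phi c = val c m"
proof -
  have "good c (SOME m. good c m)" using g by (rule someI)
  with good_mono[OF c g, of "max m (SOME m. good c m)"]
    good_mono[OF c this, of "max m (SOME m. good c m)"]
  show ?thesis by (simp add: phi_def)
qed

lemma phi_hom: "phi \<in> lin_hom R (pres_kernel R (loc R S)) M"
proof -
  let ?L = "loc R S"
  have e: "rr U \<odot>\<^bsub>M\<^esub> P (nn U) m \<in> carrier M" for U m by (simp add: rep)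
  have ex: "\<exists>m. good c m" if "c \<in> carrier (pres_kernel R ?L)" for c
    using that good_exists by auto
  show ?thesis unfolding lin_hom_def
  proof (intro CollectI conjI ballI funcsetI)
    fix c assume c': "c \<in> carrier (pres_kernel R ?L)"
    then have c: "c \<in> coeffs R ?L" by simp
    obtain m where m: "good c m" using ex[OF c'] by blast
    show "phi c \<in> carrier M" unfolding phi_eq[OF c m] val_def by (rule fsum_closed[OF c]) (rule e)
    fix d assume d': "d \<in> carrier (pres_kernel R ?L)"
    then have d: "d \<in> coeffs R ?L" by simp
    obtain m' where m': "good d m'" using ex[OF d'] by blast
    define l where "l = max m m'"
    have g: "good c l" "good d l"
      using good_mono[OF c m, of l] good_mono[OF d m', of l] by (auto simp: l_def)
    have cd: "(\<lambda>x. c x \<oplus> d x) \<in> coeffs R ?L" by (rule coeffs_add[OF c d])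
    have "c U \<noteq> \<zero> \<or> d U \<noteq> \<zero>" if "c U \<oplus> d U \<noteq> \<zero>" for U using that by auto
    then have "good (\<lambda>x. c x \<oplus> d x) l"
      using g unfolding good_def by (auto simp: Rm.fsum_add[OF c d, simplified])
    from phi_eq[OF cd this] phi_eq[OF c g(1)] phi_eq[OF d g(2)]
    show "phi (c \<oplus>\<^bsub>pres_kernel R ?L\<^esub> d) = phi c \<oplus>\<^bsub>M\<^esub> phi d"
      using fsum_add[OF c d e] by (simp add: val_def)
  next
    fix a c assume a: "a \<in> carrier R" and c': "c \<in> carrier (pres_kernel R ?L)"
    then have c: "c \<in> coeffs R ?L" by simp
    obtain m where m: "good c m" using ex[OF c'] by blast
    have ac: "(\<lambda>x. a \<otimes> c x) \<in> coeffs R ?L" by (rule coeffs_smult[OF a c])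
    have "c U \<noteq> \<zero>" if "a \<otimes> c U \<noteq> \<zero>" for U using that a by auto
    then have "good (\<lambda>x. a \<otimes> c x) m"
      using m a unfolding good_def by (auto simp: Rm.fsum_smult[OF a c, simplified])
    from phi_eq[OF ac this] phi_eq[OF c m]
    show "phi (a \<odot>\<^bsub>pres_kernel R ?L\<^esub> c) = a \<odot>\<^bsub>M\<^esub> phi c"
      using fsum_smult[OF a c e] by (simp add: val_def)
  qed
qed

definition b where "b j = cls \<one> j"

lemma b_carrier [simp]: "b j \<in> carrier (loc R S)"
  by (simp add: b_def)

text \<open>The numerator and stage chosen for \<open>b j\<close> need not be 1 and
  \<open>j\<close>. At an \<open>ok\<close> stage e_j and the chosen lift of \<open>b j\<close> have
  the same coefficient at e_m, so their difference lies in \<open>M\<close>; it is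
  \<open>dev j m\<close>.\<close>

definition ok where "ok j m \<longleftrightarrow> j \<le> m \<and> nn (b j) \<le> m \<and> T j m = rr (b j) \<otimes> T (nn (b j)) m"

definition dev where "dev j m = P j m \<ominus>\<^bsub>M\<^esub> rr (b j) \<odot>\<^bsub>M\<^esub> P (nn (b j)) m"

lemma ok_exists: "\<exists>m. ok j m"
proof -
  let ?U = "b j"
  define m where "m = max j (nn ?U)"
  have "cls (T j m) m = ?U" unfolding b_def using cls_lift[of \<one> j m] by (simp add: m_def)
  also have "\<dots> = cls (rr ?U \<otimes> T (nn ?U) m) m"
    using rep[of ?U] cls_lift[of "rr ?U" "nn ?U" m] by (simp add: m_def)
  finally obtain m' where m': "m' \<ge> m" "T j m \<otimes> T m m' = (rr ?U \<otimes> T (nn ?U) m) \<otimes> T m m'"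
    using cls_eqD[of "T j m" "rr ?U \<otimes> T (nn ?U) m" "T 0 m" m] by (auto simp: rep)
  then show ?thesis
    using T_compose[of j m m'] T_compose[of "nn ?U" m m']
    by (intro exI[of _ m']) (auto simp: ok_def m_def rep m_assoc)
qed

lemma ok_Suc: "ok j m \<Longrightarrow> ok j (Suc m) \<and> dev j (Suc m) = dev j m"
  by (auto simp: ok_def dev_def rep m_assoc smult_r_distr smult_assoc1 add_diff diff_self)

lemma ok_mono:
  assumes "ok j m" "m \<le> m'"
  shows "ok j m' \<and> dev j m' = dev j m"
  using \<open>m \<le> m'\<close> by (induction m' rule: dec_induct) (use assms(1) ok_Suc in auto)

text \<open>An extension \<open>\<psi>\<close> of \<open>phi\<close> yields a retraction to
  \<open>M\<close> that sends the chosen lift of \<open>U\<close> to the value of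
  \<open>\<psi>\<close> at the generator \<open>U\<close>. Then \<open>y j\<close> is the image of
  e_j, and e_j - t_j e_{j+1} = x_j is mapped to the wanted equation.\<close>

lemma solution_from_splitting:
  assumes psi: "\<psi> \<in> lin_hom R (free_mod R (loc R S)) M"
    and ext: "\<And>c. c \<in> carrier (pres_kernel R (loc R S)) \<Longrightarrow> \<psi> c = phi c"
  shows "\<exists>y. vec (carrier M) y \<and> (\<forall>j. y j \<ominus>\<^bsub>M\<^esub> t j \<odot>\<^bsub>M\<^esub> y (Suc j) = x j)"
proof -
  let ?L = "loc R S"
  let ?m = "\<lambda>j. SOME m. ok j m"
  have okm: "ok j (?m j)" for j by (rule someI_ex[OF ok_exists])
  define p where "p j = \<psi> (single R (b j))" for j
  define y where "y j = dev j (?m j) \<oplus>\<^bsub>M\<^esub> p j" for j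
  have sc: "single R (b j) \<in> coeffs R ?L" for j by (rule single_coeffs[OF b_carrier])
  have pM: "p j \<in> carrier M" for j unfolding p_def using lin_homD(1)[OF psi] sc by simp
  have dM: "dev j m \<in> carrier M" for j m by (simp add: dev_def rep)
  have "y j \<ominus>\<^bsub>M\<^esub> t j \<odot>\<^bsub>M\<^esub> y (Suc j) = x j" for j
  proof -
    \<comment> \<open>The relation b_j - t_j b_{j+1} = 0 of the localisation.\<close>
    define c where "c = (\<lambda>U. single R (b j) U \<oplus> (\<ominus> t j) \<otimes> single R (b (Suc j)) U)"
    have sc': "(\<lambda>U. (\<ominus> t j) \<otimes> single R (b (Suc j)) U) \<in> coeffs R ?L" by (rule coeffs_smult[OF _ sc]) simp
    have c: "c \<in> coeffs R ?L" unfolding c_def by (rule coeffs_add[OF sc sc'])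
    have fs: "fsum R N c e = e (b j) \<oplus>\<^bsub>N\<^esub> (\<ominus> t j) \<odot>\<^bsub>N\<^esub> e (b (Suc j))"
      if N: "module R N" and e: "\<And>U. U \<in> carrier ?L \<Longrightarrow> e U \<in> carrier N" for N :: "('a, 'n, 'f) module_scheme" and e
      unfolding c_def using module.fsum_add[OF N sc sc', of e] module.fsum_smult[OF N _ sc, of "\<ominus> t j" e]
        module.fsum_single[OF N, of e] e[OF b_carrier] by (simp add: e)
    have "b j = cls (t j) (Suc j)" unfolding b_def using cls_lift[of \<one> j "Suc j"] by (simp add: T_triv)
    moreover have "b (Suc j) = cls \<one> (Suc j)" by (rule b_def)
    ultimately have "lin_comb R ?L c = cls \<zero> (Suc j)"
      unfolding lin_comb_eq_fsum fs[OF Lm.module_axioms, of "\<lambda>U. U", simplified]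
      by (simp add: L.loc_smult L.loc_add_same R.r_neg del: T.simps)
    then have ck: "c \<in> carrier (pres_kernel R ?L)" using c by (simp add: L.loc_class_zero del: T.simps)
    obtain m0 where m0: "good c m0" using good_exists[OF c] ck by auto
    \<comment> \<open>A stage at which \<open>c\<close> is good and both deviations are settled, and
      larger than \<open>j\<close> as \<open>P_rec\<close> demands.\<close>
    define m where "m = max (max m0 (Suc j)) (max (?m j) (?m (Suc j)))"
    have y1: "y j = dev j m \<oplus>\<^bsub>M\<^esub> p j"
      unfolding y_def using ok_mono[OF okm[of j], of m] by (simp add: m_def)
    have y2: "y (Suc j) = dev (Suc j) m \<oplus>\<^bsub>M\<^esub> p (Suc j)"
      unfolding y_def using ok_mono[OF okm[of "Suc j"], of m] by (simp add: m_def)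
    have "\<psi> c = p j \<oplus>\<^bsub>M\<^esub> (\<ominus> t j) \<odot>\<^bsub>M\<^esub> p (Suc j)"
      using lin_homD(2)[OF psi, of "single R (b j)" "\<lambda>U. (\<ominus> t j) \<otimes> single R (b (Suc j)) U"]
        lin_homD(3)[OF psi, of "\<ominus> t j" "single R (b (Suc j))"] sc sc'
      by (simp add: c_def p_def)
    then have e1: "\<psi> c = p j \<ominus>\<^bsub>M\<^esub> t j \<odot>\<^bsub>M\<^esub> p (Suc j)" using pM by (simp add: smult_l_minus M.minus_eq)
    have "good c m" using good_mono[OF c m0, of m] by (simp add: m_def)
    then have "phi c = val c m" by (rule phi_eq[OF c])
    also have "\<dots> = rr (b j) \<odot>\<^bsub>M\<^esub> P (nn (b j)) m \<ominus>\<^bsub>M\<^esub> t j \<odot>\<^bsub>M\<^esub> (rr (b (Suc j)) \<odot>\<^bsub>M\<^esub> P (nn (b (Suc j))) m)"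
      unfolding val_def by (subst fs[OF module_axioms]) (simp_all add: rep smult_l_minus M.minus_eq)
    finally have e2: "p j \<ominus>\<^bsub>M\<^esub> t j \<odot>\<^bsub>M\<^esub> p (Suc j) = \<dots>" using ext[OF ck] e1 by simp
    define A where "A = rr (b j) \<odot>\<^bsub>M\<^esub> P (nn (b j)) m"
    define B where "B = rr (b (Suc j)) \<odot>\<^bsub>M\<^esub> P (nn (b (Suc j))) m"
    have AB: "A \<in> carrier M" "B \<in> carrier M" by (simp_all add: A_def B_def rep)
    have e2': "p j \<ominus>\<^bsub>M\<^esub> t j \<odot>\<^bsub>M\<^esub> p (Suc j) = A \<ominus>\<^bsub>M\<^esub> t j \<odot>\<^bsub>M\<^esub> B" using e2 by (simp add: A_def B_def)
    have "y j \<ominus>\<^bsub>M\<^esub> t j \<odot>\<^bsub>M\<^esub> y (Suc j)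
      = (dev j m \<ominus>\<^bsub>M\<^esub> t j \<odot>\<^bsub>M\<^esub> dev (Suc j) m) \<oplus>\<^bsub>M\<^esub> (p j \<ominus>\<^bsub>M\<^esub> t j \<odot>\<^bsub>M\<^esub> p (Suc j))"
      unfolding y1 y2 using dM pM by (simp add: smult_r_distr add_diff)
    also have "\<dots> = ((P j m \<ominus>\<^bsub>M\<^esub> A) \<ominus>\<^bsub>M\<^esub> t j \<odot>\<^bsub>M\<^esub> (P (Suc j) m \<ominus>\<^bsub>M\<^esub> B)) \<oplus>\<^bsub>M\<^esub> (A \<ominus>\<^bsub>M\<^esub> t j \<odot>\<^bsub>M\<^esub> B)"
      unfolding e2' by (simp add: dev_def A_def B_def)
    also have "\<dots> = ((P j m \<ominus>\<^bsub>M\<^esub> A) \<oplus>\<^bsub>M\<^esub> A) \<ominus>\<^bsub>M\<^esub> (t j \<odot>\<^bsub>M\<^esub> ((P (Suc j) m \<ominus>\<^bsub>M\<^esub> B) \<oplus>\<^bsub>M\<^esub> B))"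
      using AB by (simp add: smult_r_distr add_diff del: smult_diff)
    also have "\<dots> = P j m \<ominus>\<^bsub>M\<^esub> t j \<odot>\<^bsub>M\<^esub> P (Suc j) m" using AB by (simp add: diff_add_cancel)
    also have "\<dots> = x j" using P_rec[of j m] by (simp add: m_def add_diff_cancel)
    finally show ?thesis .
  qed
  moreover have "vec (carrier M) y" using dM pM by (simp add: y_def)
  ultimately show ?thesis by blast
qed

end

lemma (in module) chain_solvable_if_almost_cotorsion:
  assumes "almost_cotorsion R M"
  shows chain_solvable
  unfolding chain_solvable_def
proof (intro allI impI)
  fix t :: "nat \<Rightarrow> 'a" and x :: "nat \<Rightarrow> 'c"
  assume t: "vec (carrier R) t" and dvd: "\<forall>i j. i \<le> j \<longrightarrow> (\<exists>h\<in>carrier R. t j = t i \<otimes> h)"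
    and x: "vec (carrier M) x"
  interpret D: divisor_chain_rhs R M t x
    by (intro divisor_chain_rhs.intro divisor_chain.intro module_axioms divisor_chain_axioms.intro
        divisor_chain_rhs_axioms.intro) (use t dvd x in auto)
  have "ext1_vanishes R (loc R D.S) M"
    using assms D.S_mult_subset D.S_countable unfolding almost_cotorsion_def by blast
  then obtain \<psi> where "\<psi> \<in> lin_hom R (free_mod R (loc R D.S)) M"
    "\<forall>c\<in>carrier (pres_kernel R (loc R D.S)). \<psi> c = D.phi c"
    using D.phi_hom unfolding ext1_vanishes_def by blast
  then show "\<exists>y. vec (carrier M) y \<and> (\<forall>j. y j \<ominus>\<^bsub>M\<^esub> t j \<odot>\<^bsub>M\<^esub> y (Suc j) = x j)"
    using D.solution_from_splitting by blast
qed

section \<open>The equational criterion of flatness\<close>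

text \<open>Evaluation of a formal integer sum along any \<open>f\<close>: besides
  \<open>teval\<close> it covers the coordinate maps \<open>\<theta>\<close> in the proof of the
  equational criterion.\<close>

definition gsum :: "('m, 'e) ring_scheme \<Rightarrow> ('p \<Rightarrow> 'm) \<Rightarrow> ('p \<Rightarrow> int) \<Rightarrow> 'm" where
  "gsum G f t = (\<Oplus>\<^bsub>G\<^esub> p \<in> {p. t p \<noteq> 0}. add_pow G (t p) (f p))"

lemma teval_eq_gsum: "teval R F = gsum F (\<lambda>p. fst p \<odot>\<^bsub>F\<^esub> snd p)"
  by (simp add: fun_eq_iff teval_def gsum_def)

context abelian_group
begin

lemma add_pow_closed: "a \<in> carrier G \<Longrightarrow> add_pow G (n::int) a \<in> carrier G"
  using group.int_pow_closed[OF a_group, of a n] by (simp add: add_pow_def)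

lemma add_pow_zero: "add_pow G (0::int) a = \<zero>"
  by (simp add: add_pow_def)

lemma gsum_superset:
  assumes "finite A" "{p. t p \<noteq> 0} \<subseteq> A" "\<And>p. p \<in> A \<Longrightarrow> f p \<in> carrier G"
  shows "gsum G f t = (\<Oplus> p \<in> A. add_pow G (t p) (f p))"
  unfolding gsum_def
  by (rule add.finprod_mono_neutral_cong_left) (use assms in \<open>auto simp: add_pow_closed add_pow_zero\<close>)

lemma gsum_closed:
  assumes "finite {p. t p \<noteq> 0}" "{p. t p \<noteq> 0} \<subseteq> D" "\<And>p. p \<in> D \<Longrightarrow> f p \<in> carrier G"
  shows "gsum G f t \<in> carrier G"
  unfolding gsum_def by (rule finsum_closed) (use assms in \<open>auto simp: add_pow_closed\<close>)

lemma gsum_add: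
  assumes t: "finite {p. t p \<noteq> 0}" "{p. t p \<noteq> 0} \<subseteq> D"
    and u: "finite {p. u p \<noteq> 0}" "{p. u p \<noteq> 0} \<subseteq> D" and f: "\<And>p. p \<in> D \<Longrightarrow> f p \<in> carrier G"
  shows "gsum G f (\<lambda>p. t p + u p) = gsum G f t \<oplus> gsum G f u"
proof -
  let ?A = "{p. t p \<noteq> 0} \<union> {p. u p \<noteq> 0}"
  have A: "finite ?A" "\<And>p. p \<in> ?A \<Longrightarrow> f p \<in> carrier G" using t u f by auto
  have "gsum G f (\<lambda>p. t p + u p) = (\<Oplus> p \<in> ?A. add_pow G (t p + u p) (f p))"
    by (rule gsum_superset) (use A in auto)
  also have "\<dots> = (\<Oplus> p \<in> ?A. add_pow G (t p) (f p) \<oplus> add_pow G (u p) (f p))"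
    by (rule finsum_cong') (use A group.int_pow_mult[OF a_group] in \<open>auto simp: add_pow_def add_pow_closed[unfolded add_pow_def]\<close>)
  also have "\<dots> = (\<Oplus> p \<in> ?A. add_pow G (t p) (f p)) \<oplus> (\<Oplus> p \<in> ?A. add_pow G (u p) (f p))"
    by (rule finsum_addf) (use A in \<open>auto simp: add_pow_closed\<close>)
  also have "(\<Oplus> p \<in> ?A. add_pow G (t p) (f p)) = gsum G f t"
    by (rule gsum_superset[symmetric]) (use A in auto)
  also have "(\<Oplus> p \<in> ?A. add_pow G (u p) (f p)) = gsum G f u"
    by (rule gsum_superset[symmetric]) (use A in auto)
  finally show ?thesis .
qed

lemma gsum_tdelta: "f p \<in> carrier G \<Longrightarrow> gsum G f (tdelta p) = f p"
proof -
  assume f: "f p \<in> carrier G"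
  have "gsum G f (tdelta p) = (\<Oplus> q \<in> {p}. add_pow G (tdelta p q) (f q))"
    by (rule gsum_superset) (use f in \<open>auto simp: tdelta_def\<close>)
  also have "\<dots> = add_pow G (tdelta p p) (f p)"
    using f by (simp add: add_pow_closed)
  also have "\<dots> = f p" using f group.int_pow_1[OF a_group, of "f p"] by (simp add: tdelta_def add_pow_def)
  finally show ?thesis .
qed

end

lemma tformalD: "t \<in> tformal R I F \<Longrightarrow> finite {p. t p \<noteq> 0}" "t \<in> tformal R I F \<Longrightarrow> {p. t p \<noteq> 0} \<subseteq> I \<times> carrier F"
  by (auto simp: tformal_def)

lemma tformal_add: "t \<in> tformal R I F \<Longrightarrow> u \<in> tformal R I F \<Longrightarrow> (\<lambda>q. t q + u q) \<in> tformal R I F"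
proof -
  assume t: "t \<in> tformal R I F" and u: "u \<in> tformal R I F"
  have sub: "{p. t p + u p \<noteq> 0} \<subseteq> {p. t p \<noteq> 0} \<union> {p. u p \<noteq> 0}" by auto
  show ?thesis unfolding tformal_def
    using finite_subset[OF sub] subset_trans[OF sub] tformalD[OF t] tformalD[OF u] by auto
qed

lemma tformal_uminus: "t \<in> tformal R I F \<Longrightarrow> (\<lambda>q. - t q) \<in> tformal R I F"
  by (auto simp: tformal_def)

lemma tformal_diff: "t \<in> tformal R I F \<Longrightarrow> u \<in> tformal R I F \<Longrightarrow> (\<lambda>q. t q - u q) \<in> tformal R I F"
  using tformal_add[OF _ tformal_uminus, of t R I F u] by simp

lemma tformal_tdelta: "a \<in> I \<Longrightarrow> x \<in> carrier F \<Longrightarrow> tdelta (a, x) \<in> tformal R I F"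
  by (auto simp: tformal_def tdelta_def intro: finite_subset[of _ "{(a, x)}"])

lemma tformal_zero: "(\<lambda>q. 0) \<in> tformal R I F"
  by (simp add: tformal_def)

context module
begin

lemma gsum_formal_closed:
  assumes "t \<in> tformal R I M" "\<And>p. p \<in> I \<times> carrier M \<Longrightarrow> f p \<in> carrier M"
  shows "gsum M f t \<in> carrier M"
  using M.gsum_closed[OF tformalD[OF assms(1)]] assms(2) by blast

lemma gsum_formal_add:
  assumes "t \<in> tformal R I M" "u \<in> tformal R I M" "\<And>p. p \<in> I \<times> carrier M \<Longrightarrow> f p \<in> carrier M"
  shows "gsum M f (\<lambda>q. t q + u q) = gsum M f t \<oplus>\<^bsub>M\<^esub> gsum M f u"
  using M.gsum_add[OF tformalD[OF assms(1)] tformalD[OF assms(2)], of f] assms(3) by blast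

lemma gsum_formal_diff:
  assumes t: "t \<in> tformal R I M" and u: "u \<in> tformal R I M" and f: "\<And>p. p \<in> I \<times> carrier M \<Longrightarrow> f p \<in> carrier M"
  shows "gsum M f (\<lambda>q. t q - u q) = gsum M f t \<ominus>\<^bsub>M\<^esub> gsum M f u"
proof -
  note d = tformal_diff[OF t u]
  have "gsum M f t = gsum M f (\<lambda>q. t q - u q) \<oplus>\<^bsub>M\<^esub> gsum M f u"
    using gsum_formal_add[OF d u f] by simp
  then show ?thesis
    using gsum_formal_closed[OF d f] gsum_formal_closed[OF u f] by (simp add: add_diff_cancel)
qed

text \<open>Families in \<open>M\<^sup>k\<close> that are combinations of relation vectors of \<open>r\<close> with coefficients in \<open>M\<close>:
  for the ideal \<open>I\<close> generated by \<open>r\<close>, the quotient of \<open>M\<^sup>k\<close> by them is \<open>I \<otimes> M\<close>.\<close>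

definition relcomb :: "nat \<Rightarrow> (nat \<Rightarrow> 'a) \<Rightarrow> (nat \<Rightarrow> 'c) set" where
  "relcomb k r = {w. \<exists>q y \<rho>. vec (carrier M) y \<and> (\<forall>i. vec (carrier R) (\<rho> i)) \<and>
     (\<forall>j<q. lc (self R) k (\<lambda>i. \<rho> i j) r = \<zero>) \<and> (\<forall>i. w i = lc M q (\<rho> i) y)}"

lemma relcomb_zero: "(\<lambda>i. \<zero>\<^bsub>M\<^esub>) \<in> relcomb k r"
  unfolding relcomb_def
  by (intro CollectI exI[of _ 0] exI[of _ "\<lambda>_. \<zero>\<^bsub>M\<^esub>"] exI[of _ "\<lambda>_ _. \<zero>"]) simp

lemma relcomb_step:
  assumes w: "w \<in> relcomb k r" and s: "vec (carrier R) \<kappa>" "lc (self R) k \<kappa> r = \<zero>" and m: "m \<in> carrier M"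
  shows "(\<lambda>i. w i \<oplus>\<^bsub>M\<^esub> \<kappa> i \<odot>\<^bsub>M\<^esub> m) \<in> relcomb k r"
proof -
  obtain q y \<rho> where h: "vec (carrier M) y" "\<forall>i. vec (carrier R) (\<rho> i)"
    "\<And>j. j < q \<Longrightarrow> lc (self R) k (\<lambda>i. \<rho> i j) r = \<zero>" "\<And>i. w i = lc M q (\<rho> i) y"
    using w unfolding relcomb_def by blast
  define \<rho>' where "\<rho>' = (\<lambda>i. (\<rho> i)(q := \<kappa> i))"
  define y' where "y' = y(q := m)"
  have "lc M q (\<rho>' i) y' = lc M q (\<rho> i) y" for i
    by (rule lc_cong) (auto simp: \<rho>'_def y'_def)
  then have "w i \<oplus>\<^bsub>M\<^esub> \<kappa> i \<odot>\<^bsub>M\<^esub> m = lc M (Suc q) (\<rho>' i) y'" for i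
    using h(4) by (simp add: \<rho>'_def y'_def)
  moreover have "lc (self R) k (\<lambda>i. \<rho>' i j) r = \<zero>" if "j < Suc q" for j
    using that h(3)[of j] s by (cases "j = q") (auto simp: \<rho>'_def)
  moreover have "vec (carrier M) y'" "\<forall>i. vec (carrier R) (\<rho>' i)"
    using h m s by (auto simp: y'_def \<rho>'_def)
  ultimately show ?thesis unfolding relcomb_def by blast
qed

text \<open>For the ideal \<open>I\<close> generated by the \<open>r i\<close>, the sum of the
  tensors of \<open>r i\<close> and \<open>x i\<close> evaluates to 0, so flatness puts it into
  \<open>tspan\<close>. The maps \<open>\<theta>\<close> below carry \<open>tspan\<close> into
  \<open>relcomb k r\<close>, and carry this sum to \<open>x\<close> up to an element of
  \<open>relcomb k r\<close>.\<close>

lemma equational_criterion: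
  assumes flat: "flat R M" and r: "vec (carrier R) r" and x: "vec (carrier M) x"
    and rel: "lc M k r x = \<zero>\<^bsub>M\<^esub>"
  shows "\<exists>q y \<rho>. vec (carrier M) y \<and> (\<forall>i. vec (carrier R) (\<rho> i)) \<and>
     (\<forall>j<q. lc (self R) k r (\<lambda>i. \<rho> i j) = \<zero>) \<and> (\<forall>i<k. x i = lc M q (\<rho> i) y)"
proof -
  interpret Sm: module R "self R" by (rule R.self_module)
  define I where "I = {lc (self R) k w r |w. vec (carrier R) w}"
  have I: "ideal I R"
  proof (rule idealI[OF R.ring_axioms])
    show "subgroup I (add_monoid R)"
    proof (rule group.subgroupI[OF R.a_group])
      show "I \<subseteq> carrier (add_monoid R)" using r by (auto simp: I_def)
      show "I \<noteq> {}" unfolding I_def by blast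
      fix a b assume "a \<in> I" "b \<in> I"
      then obtain w w' where w: "vec (carrier R) w" "a = lc (self R) k w r" "vec (carrier R) w'" "b = lc (self R) k w' r"
        unfolding I_def by blast
      have "a \<oplus> b = lc (self R) k (\<lambda>i. w i \<oplus> w' i) r"
        using w r Sm.lc_add_left[of w w' r k] by simp
      then show "a \<otimes>\<^bsub>add_monoid R\<^esub> b \<in> I" unfolding I_def using w by auto
      have "\<ominus> a = lc (self R) k (\<lambda>i. (\<ominus> \<one>) \<otimes> w i) r"
        using w(1,2) r Sm.lc_smult_left[of "\<ominus> \<one>" w r k] by (simp add: R.l_minus)
      moreover have "vec (carrier R) (\<lambda>i. (\<ominus> \<one>) \<otimes> w i)" using w(1) by simp
      ultimately show "inv\<^bsub>add_monoid R\<^esub> a \<in> I" unfolding I_def a_inv_def[symmetric] by blast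
    qed
    fix a b assume "a \<in> I" and b: "b \<in> carrier R"
    then obtain w where w: "vec (carrier R) w" "a = lc (self R) k w r" unfolding I_def by blast
    have "b \<otimes> a = lc (self R) k (\<lambda>i. b \<otimes> w i) r"
      using w r b Sm.lc_smult_left[of b w r k] by simp
    moreover have "vec (carrier R) (\<lambda>i. b \<otimes> w i)" using w(1) b by simp
    ultimately show "b \<otimes> a \<in> I" unfolding I_def by blast
    then show "a \<otimes> b \<in> I" using w r b by (simp add: R.m_comm)
  qed
  interpret I: ideal I R by (rule I)
  \<comment> \<open>Coordinates of each \<open>a\<close> in \<open>I\<close> with respect to the
    \<open>r i\<close>. They are not chosen linearly in \<open>a\<close>, but every failure of
    linearity is a relation vector of \<open>r\<close>.\<close>
  have "\<forall>a. \<exists>w. vec (carrier R) w \<and> (a \<in> I \<longrightarrow> lc (self R) k w r = a)"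
  proof
    fix a
    show "\<exists>w. vec (carrier R) w \<and> (a \<in> I \<longrightarrow> lc (self R) k w r = a)"
    proof (cases "a \<in> I")
      case True
      then show ?thesis unfolding I_def by blast
    next
      case False
      then show ?thesis by (intro exI[of _ "\<lambda>_. \<zero>"]) simp
    qed
  qed
  from choice[OF this] obtain v where v: "\<And>a i. v a i \<in> carrier R" "\<And>a. a \<in> I \<Longrightarrow> lc (self R) k (v a) r = a" by blast
  have vv: "vec (carrier R) (v a)" for a using v(1) by blast
  define \<theta> where "\<theta> t i = gsum M (\<lambda>p. v (fst p) i \<odot>\<^bsub>M\<^esub> snd p) t" for t i
  have f: "v (fst p) i \<odot>\<^bsub>M\<^esub> snd p \<in> carrier M" if "p \<in> I \<times> carrier M" for p i using that v(1) by auto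
  have th: "\<theta> t i \<in> carrier M" if "t \<in> tformal R I M" for t i
    unfolding \<theta>_def by (rule gsum_formal_closed[OF that f])
  have th_add: "\<theta> (\<lambda>q. t q + u q) i = \<theta> t i \<oplus>\<^bsub>M\<^esub> \<theta> u i" if "t \<in> tformal R I M" "u \<in> tformal R I M" for t u i
    unfolding \<theta>_def by (rule gsum_formal_add[OF that f])
  have th_diff: "\<theta> (\<lambda>q. t q - u q) i = \<theta> t i \<ominus>\<^bsub>M\<^esub> \<theta> u i" if "t \<in> tformal R I M" "u \<in> tformal R I M" for t u i
    unfolding \<theta>_def by (rule gsum_formal_diff[OF that f])
  have th_delta: "\<theta> (tdelta (a, m)) i = v a i \<odot>\<^bsub>M\<^esub> m" if "a \<in> I" "m \<in> carrier M" for a m i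
    unfolding \<theta>_def using M.gsum_tdelta[of "\<lambda>p. v (fst p) i \<odot>\<^bsub>M\<^esub> snd p" "(a, m)"] v(1) that by simp
  note td = tformal_tdelta[of _ I _ M R] tformal_diff[of _ R I M]
  \<comment> \<open>A defining relation of the tensor product goes to one relation vector times one
    element of \<open>M\<close>: for additivity in the ideal and for balancing it is the failure of
    \<open>v\<close> to be linear, for additivity in the module it is zero.\<close>
  have gens: "g \<in> tformal R I M \<and> (\<exists>\<kappa> m. vec (carrier R) \<kappa> \<and> lc (self R) k \<kappa> r = \<zero> \<and> m \<in> carrier M \<and> (\<forall>i. \<theta> g i = \<kappa> i \<odot>\<^bsub>M\<^esub> m))"
    if "g \<in> tgens R I M" for g
    using that unfolding tgens_def
  proof (elim UnE CollectE exE conjE)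
    fix a a' m assume g: "g = (\<lambda>q. tdelta (a \<oplus> a', m) q - tdelta (a, m) q - tdelta (a', m) q)"
      and a: "a \<in> I" "a' \<in> I" and m: "m \<in> carrier M"
    have aa: "a \<oplus> a' \<in> I" using a by simp
    define \<kappa> where "\<kappa> = (\<lambda>i. (v (a \<oplus> a') i \<ominus> v a i) \<ominus> v a' i)"
    have "lc (self R) k \<kappa> r = \<zero>"
      unfolding \<kappa>_def using Sm.lc_diff_left[of "\<lambda>i. v (a \<oplus> a') i \<ominus> v a i" "v a'" r k]
        Sm.lc_diff_left[of "v (a \<oplus> a')" "v a" r k] r v a aa I.a_Hcarr[OF a(1)] I.a_Hcarr[OF a(2)]
      by (simp add: R.minus_eq R.a_ac R.r_neg R.r_neg1)
    moreover have "\<theta> g i = \<kappa> i \<odot>\<^bsub>M\<^esub> m" for i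
      unfolding g using a aa m v(1) by (simp add: th_diff th_delta td \<kappa>_def smult_diff_left)
    moreover have "g \<in> tformal R I M" unfolding g using a aa m by (intro td) auto
    ultimately show ?thesis using m v(1) by (intro conjI exI[of _ \<kappa>] exI[of _ m]) (auto simp: \<kappa>_def)
  next
    fix a m m' assume g: "g = (\<lambda>q. tdelta (a, m \<oplus>\<^bsub>M\<^esub> m') q - tdelta (a, m) q - tdelta (a, m') q)"
      and a: "a \<in> I" and m: "m \<in> carrier M" "m' \<in> carrier M"
    have "\<theta> g i = \<zero> \<odot>\<^bsub>M\<^esub> m" for i
      unfolding g using a m v(1) by (simp add: th_diff th_delta td smult_r_distr)
        (simp add: M.minus_eq M.a_ac M.r_neg M.r_neg1)
    moreover have "g \<in> tformal R I M" unfolding g using a m by (intro td) auto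
    moreover have "lc (self R) k (\<lambda>i. \<zero>) r = \<zero>" using Sm.lc_zero_left[of r k "\<lambda>i. \<zero>"] r by simp
    ultimately show ?thesis using m by (intro conjI exI[of _ "\<lambda>i. \<zero>"] exI[of _ m]) auto
  next
    fix b a m assume g: "g = (\<lambda>q. tdelta (b \<otimes> a, m) q - tdelta (a, b \<odot>\<^bsub>M\<^esub> m) q)"
      and b: "b \<in> carrier R" and a: "a \<in> I" and m: "m \<in> carrier M"
    have ba: "b \<otimes> a \<in> I" using a b by (simp add: I.I_l_closed)
    define \<kappa> where "\<kappa> = (\<lambda>i. v (b \<otimes> a) i \<ominus> b \<otimes> v a i)"
    have "lc (self R) k \<kappa> r = \<zero>"
      unfolding \<kappa>_def using Sm.lc_diff_left[of "v (b \<otimes> a)" "\<lambda>i. b \<otimes> v a i" r k]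
        Sm.lc_smult_left[of b "v a" r k] r v a ba b I.a_Hcarr[OF a]
      by (simp add: R.minus_eq R.r_neg)
    moreover have "\<theta> g i = \<kappa> i \<odot>\<^bsub>M\<^esub> m" for i
      unfolding g using a b ba m v(1) by (simp add: th_diff th_delta td \<kappa>_def smult_diff_left smult_assoc1 smult_lcomm)
    moreover have "g \<in> tformal R I M" unfolding g using a b ba m by (intro td) auto
    ultimately show ?thesis using m b v(1) by (intro conjI exI[of _ \<kappa>] exI[of _ m]) (auto simp: \<kappa>_def)
  qed
  have span: "t \<in> tformal R I M \<and> \<theta> t \<in> relcomb k r" if "t \<in> tspan R I M" for t
    using that
  proof (induction rule: tspan.induct)
    case tspan_zero
    have "\<theta> (\<lambda>_. 0) = (\<lambda>i. \<zero>\<^bsub>M\<^esub>)" by (simp add: fun_eq_iff \<theta>_def gsum_def)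
    then show ?case using relcomb_zero tformal_zero by simp
  next
    case (tspan_add t g)
    then obtain \<kappa> m where g: "g \<in> tformal R I M" "vec (carrier R) \<kappa>" "lc (self R) k \<kappa> r = \<zero>" "m \<in> carrier M"
      "\<And>i. \<theta> g i = \<kappa> i \<odot>\<^bsub>M\<^esub> m" using gens by blast
    have "\<theta> (\<lambda>q. t q + g q) = (\<lambda>i. \<theta> t i \<oplus>\<^bsub>M\<^esub> \<kappa> i \<odot>\<^bsub>M\<^esub> m)"
      using tspan_add g by (simp add: th_add fun_eq_iff)
    then show ?case using relcomb_step[OF _ g(2-4)] tspan_add.IH tformal_add[OF _ g(1)] by simp
  next
    case (tspan_diff t g)
    then obtain \<kappa> m where g: "g \<in> tformal R I M" "vec (carrier R) \<kappa>" "lc (self R) k \<kappa> r = \<zero>" "m \<in> carrier M"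
      "\<And>i. \<theta> g i = \<kappa> i \<odot>\<^bsub>M\<^esub> m" using gens by blast
    have m: "\<ominus>\<^bsub>M\<^esub> m \<in> carrier M" using g by simp
    have "\<theta> (\<lambda>q. t q - g q) = (\<lambda>i. \<theta> t i \<oplus>\<^bsub>M\<^esub> \<kappa> i \<odot>\<^bsub>M\<^esub> (\<ominus>\<^bsub>M\<^esub> m))"
      using tspan_diff g by (simp add: th_diff fun_eq_iff smult_r_minus M.minus_eq)
    then show ?case using relcomb_step[OF _ g(2,3) m] tspan_diff.IH tformal_diff[OF _ g(1)] by simp
  qed
  \<comment> \<open>Deltas are added one at a time, so that coinciding pairs
    \<open>(r l, x l)\<close> count with multiplicity.\<close>
  define tk where "tk = rec_nat (\<lambda>q. 0) (\<lambda>l t q. t q + tdelta (r l, x l) q)"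
  have tk: "tk 0 = (\<lambda>q. 0)" "\<And>l. tk (Suc l) = (\<lambda>q. tk l q + tdelta (r l, x l) q)" by (simp_all add: tk_def)
  have rI: "r i \<in> I" if "i < k" for i
    unfolding I_def using Sm.lc_unit_vec[of r k i] r that by (auto intro!: exI[of _ "unit_vec R i"])
  have tkf: "tk l \<in> tformal R I M" if "l \<le> k" for l
    using that by (induction l) (auto simp: tk tformal_zero intro!: tformal_add tformal_tdelta rI x[rule_format])
  have "teval R M (tk l) = lc M l r x" if "l \<le> k" for l
    using that
  proof (induction l)
    case 0 show ?case by (simp add: tk teval_def)
  next
    case (Suc l)
    have e: "fst p \<odot>\<^bsub>M\<^esub> snd p \<in> carrier M" if "p \<in> I \<times> carrier M" for p using that I.a_Hcarr by auto
    have "tdelta (r l, x l) \<in> tformal R I M" using rI[of l] Suc.prems x by (simp add: tformal_tdelta)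
    then show ?case using Suc gsum_formal_add[OF tkf _ e, of l "tdelta (r l, x l)"]
        M.gsum_tdelta[of "\<lambda>p. fst p \<odot>\<^bsub>M\<^esub> snd p" "(r l, x l)"] r x
      by (simp add: tk teval_eq_gsum)
  qed
  then have "teval R M (tk k) = \<zero>\<^bsub>M\<^esub>" using rel by simp
  then have "tk k \<in> tspan R I M" using flat I tkf[of k] unfolding flat_def by auto
  then have thQ: "\<theta> (tk k) \<in> relcomb k r" using span by blast
  have thk: "\<theta> (tk l) i = lc M l (\<lambda>l. v (r l) i) x" if "l \<le> k" for l i
    using that
  proof (induction l)
    case 0 show ?case by (simp add: tk \<theta>_def gsum_def)
  next
    case (Suc l)
    have "tdelta (r l, x l) \<in> tformal R I M" using rI[of l] Suc.prems x by (simp add: tformal_tdelta)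
    then show ?case using Suc th_add[OF tkf[of l], of "tdelta (r l, x l)" i] th_delta[of "r l" "x l" i] rI[of l] x
      by (simp add: tk)
  qed
  \<comment> \<open>\<open>v (r l)\<close> need not be the unit vector, but it differs from it by a
    relation vector, so the passage from \<open>\<theta> (tk k)\<close> to \<open>x\<close> stays in
    \<open>relcomb k r\<close>.\<close>
  define \<epsilon> where "\<epsilon> l i = unit_vec R i l \<ominus> v (r l) i" for l i
  have eps: "\<epsilon> l i \<in> carrier R" for l i using v(1) by (simp add: \<epsilon>_def)
  have "lc (self R) k (\<epsilon> l) r = \<zero>" if l: "l < k" for l
  proof -
    have "\<epsilon> l = (\<lambda>i. unit_vec R l i \<ominus> v (r l) i)" by (auto simp: \<epsilon>_def unit_vec_def)
    then show ?thesis using Sm.lc_diff_left[of "unit_vec R l" "v (r l)" r k] vv r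
        Sm.lc_unit_vec[of r k l] l v(2)[OF rI[OF l]] by (simp add: R.minus_eq R.r_neg)
  qed
  then have "(\<lambda>i. \<theta> (tk k) i \<oplus>\<^bsub>M\<^esub> lc M l (\<lambda>l. \<epsilon> l i) x) \<in> relcomb k r" if "l \<le> k" for l
    using that
  proof (induction l)
    case 0 then show ?case using thQ th[OF tkf[of k]] by simp
  next
    case (Suc l)
    have "(\<lambda>i. (\<theta> (tk k) i \<oplus>\<^bsub>M\<^esub> lc M l (\<lambda>l. \<epsilon> l i) x) \<oplus>\<^bsub>M\<^esub> \<epsilon> l i \<odot>\<^bsub>M\<^esub> x l) \<in> relcomb k r"
      by (rule relcomb_step) (use Suc eps x in auto)
    then show ?case using th[OF tkf[of k]] eps x by (simp add: M.a_assoc)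
  qed
  from this[of k] obtain q y \<rho> where q: "vec (carrier M) y" "\<forall>i. vec (carrier R) (\<rho> i)"
     "\<And>j. j < q \<Longrightarrow> lc (self R) k (\<lambda>i. \<rho> i j) r = \<zero>"
     "\<And>i. \<theta> (tk k) i \<oplus>\<^bsub>M\<^esub> lc M k (\<lambda>l. \<epsilon> l i) x = lc M q (\<rho> i) y"
    unfolding relcomb_def by blast
  have "x i = lc M q (\<rho> i) y" if i: "i < k" for i
  proof -
    have "lc M k (\<lambda>l. \<epsilon> l i) x = lc M k (\<lambda>l. unit_vec R i l) x \<ominus>\<^bsub>M\<^esub> lc M k (\<lambda>l. v (r l) i) x"
      unfolding \<epsilon>_def by (rule lc_diff_left) (use v(1) x in auto)
    also have "\<dots> = x i \<ominus>\<^bsub>M\<^esub> \<theta> (tk k) i" using thk[of k i] lc_unit_vec[OF x, of k i] i by simp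
    finally show ?thesis using q(4)[of i] th[OF tkf[of k], of i] x
      by (simp add: M.minus_eq M.a_ac M.r_neg M.r_neg1 M.r_neg2)
  qed
  moreover have "lc (self R) k r (\<lambda>i. \<rho> i j) = \<zero>" if "j < q" for j
    using q(3)[OF that] R.dot_comm[of r "\<lambda>i. \<rho> i j" k] q(2) r by simp
  ultimately show ?thesis using q(1,2) by blast
qed

end

section \<open>Flat modules as sequential colimits\<close>

text \<open>Among the factorisations of \<open>x\<close> through finite free modules take one with
  maximal set \<open>V\<close> of annihilated vectors. A relation \<open>v\<close> of
  \<open>x\<close> becomes a relation \<open>u\<close> of \<open>y\<close>; the equational criterion
  factors \<open>y\<close> further so as to kill \<open>u\<close>. The composite annihilates
  \<open>v\<close> and all of \<open>V\<close>, so by maximality \<open>v\<close> was annihilated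
  already.\<close>

lemma (in module) kill_relations:
  assumes noeth: "noetherian_cring R" and flat: "flat R M" and x: "vec (carrier M) x"
  shows "\<exists>q y \<rho>. vec (carrier M) y \<and> (\<forall>i. vec (carrier R) (\<rho> i)) \<and> (\<forall>i<k. x i = lc M q (\<rho> i) y) \<and>
    (\<forall>v. vec (carrier R) v \<longrightarrow> lc M k v x = \<zero>\<^bsub>M\<^esub> \<longrightarrow> (\<forall>j<q. lc (self R) k v (\<lambda>i. \<rho> i j) = \<zero>))"
proof -
  interpret Nr: noetherian_cring R by (rule noeth)
  interpret Sm: module R "self R" by (rule R.self_module)
  define P where "P w \<longleftrightarrow> (case w of (q, y, \<rho>) \<Rightarrow> vec (carrier M) y \<and> (\<forall>i. vec (carrier R) (\<rho> i)) \<and>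
    (\<forall>i<k. x i = lc M q (\<rho> i) y))" for w :: "nat \<times> (nat \<Rightarrow> 'c) \<times> (nat \<Rightarrow> nat \<Rightarrow> 'a)"
  define V where "V w = (case w of (q, y, \<rho>) \<Rightarrow>
    {v. vec (carrier R) v \<and> (\<forall>j<q. lc (self R) k v (\<lambda>i. \<rho> i j) = \<zero>)})" for w :: "nat \<times> (nat \<Rightarrow> 'c) \<times> (nat \<Rightarrow> nat \<Rightarrow> 'a)"
  have P0: "P (k, x, \<lambda>i. unit_vec R i)" using x by (simp add: P_def lc_unit_vec)
  have Vsub: "R.vsub k (V w)" if "P w" for w
  proof -
    obtain q y \<rho> where w: "w = (q, y, \<rho>)" by (cases w)
    have \<rho>: "\<rho> i j \<in> carrier R" for i j using that by (simp add: P_def w)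
    show ?thesis unfolding R.vsub_def
    proof (intro conjI ballI allI impI)
      fix v v' assume v: "v \<in> V w" and v': "vec (carrier R) v'" "\<forall>i<k. v i = v' i"
      have "lc (self R) k v' (\<lambda>i. \<rho> i j) = lc (self R) k v (\<lambda>i. \<rho> i j)" for j
        by (rule Sm.lc_cong) (use v' in auto)
      then show "v' \<in> V w" using v v' by (simp add: V_def w)
    next
      show "(\<lambda>i. \<zero>) \<in> V w" using Sm.lc_zero_left[of _ k "\<lambda>i. \<zero>"] \<rho> by (simp add: V_def w)
    next
      fix v v' assume "v \<in> V w" "v' \<in> V w"
      then show "(\<lambda>i. v i \<oplus> v' i) \<in> V w" using Sm.lc_add_left[of v v' _ k] \<rho> by (simp add: V_def w)
    next
      fix a v assume "a \<in> carrier R" "v \<in> V w"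
      then show "(\<lambda>i. a \<otimes> v i) \<in> V w" using Sm.lc_smult_left[of a v _ k] \<rho> by (simp add: V_def w)
    qed (auto simp: V_def w)
  qed
  obtain w where Pw: "P w" and max: "\<And>w'. P w' \<Longrightarrow> V w \<subseteq> V w' \<Longrightarrow> V w' = V w"
    using Nr.vsub_maximal[of P "(k, x, \<lambda>i. unit_vec R i)" k V, OF P0 Vsub] by blast
  obtain q y \<rho> where w: "w = (q, y, \<rho>)" by (cases w)
  have y: "vec (carrier M) y" and \<rho>: "\<And>i j. \<rho> i j \<in> carrier R" and xy: "\<And>i. i < k \<Longrightarrow> x i = lc M q (\<rho> i) y"
    using Pw by (simp_all add: P_def w)
  have "v \<in> V w" if v: "vec (carrier R) v" and rel: "lc M k v x = \<zero>\<^bsub>M\<^esub>" for v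
  proof -
    define u where "u j = lc (self R) k v (\<lambda>i. \<rho> i j)" for j
    have u: "vec (carrier R) u" using v \<rho> by (simp add: u_def)
    have "lc M q u y = lc M k v (\<lambda>i. lc M q (\<rho> i) y)"
      unfolding u_def by (rule lc_assoc) (use v \<rho> y in auto)
    also have "\<dots> = lc M k v x" by (rule lc_cong) (use xy in auto)
    finally have "lc M q u y = \<zero>\<^bsub>M\<^esub>" using rel by simp
    from equational_criterion[OF flat u y this] obtain q' y' \<rho>' where y': "vec (carrier M) y'"
      and \<rho>': "\<And>i j. \<rho>' i j \<in> carrier R" and kill: "\<And>j. j < q' \<Longrightarrow> lc (self R) q u (\<lambda>i. \<rho>' i j) = \<zero>"
      and yy': "\<And>i. i < q \<Longrightarrow> y i = lc M q' (\<rho>' i) y'" by blast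
    define \<rho>2 where "\<rho>2 i j = lc (self R) q (\<rho> i) (\<lambda>l. \<rho>' l j)" for i j
    have \<rho>2: "\<rho>2 i j \<in> carrier R" for i j using \<rho> \<rho>' by (simp add: \<rho>2_def)
    have "x i = lc M q' (\<rho>2 i) y'" if i: "i < k" for i
    proof -
      have "x i = lc M q (\<rho> i) (\<lambda>l. lc M q' (\<rho>' l) y')"
        unfolding xy[OF i] by (rule lc_cong) (use yy' in auto)
      also have "\<dots> = lc M q' (\<rho>2 i) y'"
        unfolding \<rho>2_def by (rule lc_assoc[symmetric]) (use \<rho> \<rho>' y' in auto)
      finally show ?thesis .
    qed
    then have P2: "P (q', y', \<rho>2)" using y' \<rho>2 by (simp add: P_def)
    have eq: "lc (self R) k v' (\<lambda>i. \<rho>2 i j) = lc (self R) q (\<lambda>l. lc (self R) k v' (\<lambda>i. \<rho> i l)) (\<lambda>l. \<rho>' l j)"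
      if "vec (carrier R) v'" for v' j
      unfolding \<rho>2_def using Sm.lc_assoc[of v' \<rho> "\<lambda>l. \<rho>' l j" q k] that \<rho> \<rho>' by simp
    have "V w \<subseteq> V (q', y', \<rho>2)"
    proof
      fix v' assume "v' \<in> V w"
      then have v': "vec (carrier R) v'" "\<And>j. j < q \<Longrightarrow> lc (self R) k v' (\<lambda>i. \<rho> i j) = \<zero>"
        by (auto simp: V_def w)
      have "lc (self R) k v' (\<lambda>i. \<rho>2 i j) = \<zero>" for j
        unfolding eq[OF v'(1)] using Sm.lc_zero_left[of "\<lambda>l. \<rho>' l j" q] v'(2) \<rho>' by simp
      then show "v' \<in> V (q', y', \<rho>2)" using v'(1) by (simp add: V_def)
    qed
    then have "V (q', y', \<rho>2) = V w" by (rule max[OF P2])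
    moreover have "v \<in> V (q', y', \<rho>2)"
      using v kill eq[OF v] by (simp add: V_def u_def[symmetric])
    ultimately show ?thesis by simp
  qed
  then show ?thesis using y \<rho> xy unfolding V_def w by (intro exI[of _ q] exI[of _ y] exI[of _ \<rho>]) auto
qed

text \<open>Each stage applies \<open>kill_relations\<close> and then adjoins the next generator of
  \<open>M\<close> as one more basis vector. The images of the stages increase and contain all
  generators, hence exhaust \<open>M\<close>.\<close>

lemma (in module) telescope_exists:
  assumes noeth: "noetherian_cring R" and flat: "flat R M" and cg: "countably_generated R M"
  shows "\<exists>k A x. (\<forall>n i j. A n i j \<in> carrier R) \<and> (\<forall>n. vec (carrier M) (x n)) \<and>
    (\<forall>n. \<forall>i<k n. x n i = lc M (k (Suc n)) (A n i) (x (Suc n))) \<and>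
    (\<forall>n v. vec (carrier R) v \<longrightarrow> lc M (k n) v (x n) = \<zero>\<^bsub>M\<^esub> \<longrightarrow>
       (\<forall>j<k (Suc n). lc (self R) (k n) v (\<lambda>i. A n i j) = \<zero>)) \<and>
    (\<forall>z\<in>carrier M. \<exists>n v. vec (carrier R) v \<and> z = lc M (k n) v (x n))"
proof -
  interpret Sm: module R "self R" by (rule R.self_module)
  obtain U where U: "U \<subseteq> carrier M" "countable U"
    "carrier M = {lin_comb R M c |c. c \<in> coeffs R M \<and> {x. c x \<noteq> \<zero>} \<subseteq> U}"
    using cg unfolding countably_generated_def by blast
  \<comment> \<open>Zero is inserted because \<open>from_nat_into\<close> enumerates nonempty sets
    only.\<close>
  define u where "u = from_nat_into (insert \<zero>\<^bsub>M\<^esub> U)"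
  have u: "range u = insert \<zero>\<^bsub>M\<^esub> U" unfolding u_def using U(2) by (intro range_from_nat_into) auto
  have uM: "u n \<in> carrier M" for n using rangeI[of u n] U(1) unfolding u by auto
  define Q where "Q n s s' A \<longleftrightarrow> (case s of (l, x) \<Rightarrow> case s' of (l', x') \<Rightarrow>
     (\<forall>i j. A i j \<in> carrier R) \<and> (\<forall>i<l. x i = lc M l' (A i) x') \<and>
     (\<forall>v. vec (carrier R) v \<longrightarrow> lc M l v x = \<zero>\<^bsub>M\<^esub> \<longrightarrow> (\<forall>j<l'. lc (self R) l v (\<lambda>i. A i j) = \<zero>)) \<and>
     (\<exists>v. vec (carrier R) v \<and> u n = lc M l' v x'))"
    for n and s s' :: "nat \<times> (nat \<Rightarrow> 'c)" and A
  have step: "\<exists>s'. vec (carrier M) (snd s') \<and> (\<exists>A. Q n s s' A)" if s: "vec (carrier M) (snd s)" for s n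
  proof -
    obtain l x where lx: "s = (l, x)" by (cases s)
    have x: "vec (carrier M) x" using s lx by simp
    obtain q y \<rho> where y: "vec (carrier M) y" and \<rho>: "\<And>i j. \<rho> i j \<in> carrier R"
      and xy: "\<And>i. i < l \<Longrightarrow> x i = lc M q (\<rho> i) y"
      and kill: "\<And>v j. vec (carrier R) v \<Longrightarrow> lc M l v x = \<zero>\<^bsub>M\<^esub> \<Longrightarrow> j < q \<Longrightarrow> lc (self R) l v (\<lambda>i. \<rho> i j) = \<zero>"
      using kill_relations[OF noeth flat x, of l] by blast
    define y' where "y' = y(q := u n)"
    \<comment> \<open>A zero column for the adjoined vector disturbs neither the factorisation nor
      the killing of relations.\<close>
    define A where "A i = (\<rho> i)(q := \<zero>)" for i
    have y': "vec (carrier M) y'" using y uM by (simp add: y'_def)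
    have A: "A i j \<in> carrier R" for i j using \<rho> by (simp add: A_def)
    have xA: "x i = lc M (Suc q) (A i) y'" if i: "i < l" for i
    proof -
      have "lc M q (A i) y' = lc M q (\<rho> i) y" by (rule lc_cong) (auto simp: A_def y'_def)
      then show ?thesis using xy[OF i] uM y \<rho> by (simp add: A_def y'_def)
    qed
    have killA: "lc (self R) l v (\<lambda>i. A i j) = \<zero>"
      if "vec (carrier R) v" "lc M l v x = \<zero>\<^bsub>M\<^esub>" "j < Suc q" for v j
      using kill[OF that(1,2), of j] that Sm.lc_zero_right[of v l] by (cases "j = q") (auto simp: A_def)
    have "u n = lc M (Suc q) (unit_vec R q) y'" 
      unfolding lc_unit_vec[OF y'] by (simp add: y'_def)
    then have "\<exists>v. vec (carrier R) v \<and> u n = lc M (Suc q) v y'" using unit_vec_vec by blast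
    then have "Q n s (Suc q, y') A" unfolding Q_def lx prod.case using A xA killA by blast
    then show ?thesis using y' by (intro exI[of _ "(Suc q, y')"]) auto
  qed
  have "\<exists>f. \<forall>n. vec (carrier M) (snd (f n)) \<and> (\<exists>A. Q n (f n) (f (Suc n)) A)"
  proof (rule dependent_nat_choice)
    show "\<exists>s :: nat \<times> (nat \<Rightarrow> 'c). vec (carrier M) (snd s)" by (intro exI[of _ "(0, \<lambda>_. \<zero>\<^bsub>M\<^esub>)"]) simp
  qed (rule step)
  then obtain f where f: "\<And>n. vec (carrier M) (snd (f n))" and "\<forall>n. \<exists>A. Q n (f n) (f (Suc n)) A" by blast
  from choice[OF this(2)] obtain A where A: "\<And>n. Q n (f n) (f (Suc n)) (A n)" by blast
  define k where "k n = fst (f n)" for n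
  define x where "x n = snd (f n)" for n
  have x: "vec (carrier M) (x n)" for n using f by (simp add: x_def)
  have QA: "\<And>i j. A n i j \<in> carrier R" "\<And>i. i < k n \<Longrightarrow> x n i = lc M (k (Suc n)) (A n i) (x (Suc n))"
     "\<And>v j. vec (carrier R) v \<Longrightarrow> lc M (k n) v (x n) = \<zero>\<^bsub>M\<^esub> \<Longrightarrow> j < k (Suc n) \<Longrightarrow> lc (self R) (k n) v (\<lambda>i. A n i j) = \<zero>"
     "\<exists>v. vec (carrier R) v \<and> u n = lc M (k (Suc n)) v (x (Suc n))" for n
    using A[of n] unfolding Q_def k_def x_def by (auto simp: case_prod_unfold)
  define Sp where "Sp n = {lc M (k n) v (x n) |v. vec (carrier R) v}" for n
  have "Sp n \<subseteq> Sp (Suc n)" for n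
  proof
    fix z assume "z \<in> Sp n"
    then obtain v where v: "vec (carrier R) v" "z = lc M (k n) v (x n)" unfolding Sp_def by blast
    have "z = lc M (k n) v (\<lambda>i. lc M (k (Suc n)) (A n i) (x (Suc n)))"
      unfolding v(2) by (rule lc_cong) (use QA(2) in auto)
    also have "\<dots> = lc M (k (Suc n)) (\<lambda>j. lc (self R) (k n) v (\<lambda>i. A n i j)) (x (Suc n))"
      by (rule lc_assoc[symmetric]) (use v QA(1) x in auto)
    finally show "z \<in> Sp (Suc n)" unfolding Sp_def using v QA(1) by auto
  qed
  then have mono: "Sp n \<subseteq> Sp m" if "n \<le> m" for n m using lift_Suc_mono_le[of Sp] that by blast
  have Sp_add: "z \<oplus>\<^bsub>M\<^esub> z' \<in> (\<Union>n. Sp n)" if z: "z \<in> (\<Union>n. Sp n)" "z' \<in> (\<Union>n. Sp n)" for z z'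
  proof -
    obtain n n' where "z \<in> Sp n" "z' \<in> Sp n'" using z by blast
    then have "z \<in> Sp (max n n')" "z' \<in> Sp (max n n')" using mono by (meson max.cobounded1 max.cobounded2 subsetD)+
    then obtain v v' where v: "vec (carrier R) v" "vec (carrier R) v'"
       "z = lc M (k (max n n')) v (x (max n n'))" "z' = lc M (k (max n n')) v' (x (max n n'))" unfolding Sp_def by blast
    have "z \<oplus>\<^bsub>M\<^esub> z' = lc M (k (max n n')) (\<lambda>i. v i \<oplus> v' i) (x (max n n'))"
      unfolding v(3,4) by (rule lc_add_left[symmetric]) (use v x in auto)
    moreover have "vec (carrier R) (\<lambda>i. v i \<oplus> v' i)" using v by simp
    ultimately show ?thesis unfolding Sp_def by blast
  qed
  have Sp_smult: "a \<odot>\<^bsub>M\<^esub> z \<in> (\<Union>n. Sp n)" if z: "z \<in> (\<Union>n. Sp n)" and a: "a \<in> carrier R" for a z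
  proof -
    obtain n v where v: "vec (carrier R) v" "z = lc M (k n) v (x n)" using z unfolding Sp_def by blast
    have "a \<odot>\<^bsub>M\<^esub> z = lc M (k n) (\<lambda>i. a \<otimes> v i) (x n)"
      unfolding v(2) by (rule lc_smult_left[symmetric]) (use a v x in auto)
    moreover have "vec (carrier R) (\<lambda>i. a \<otimes> v i)" using v a by simp
    ultimately show ?thesis unfolding Sp_def by blast
  qed
  have uSp: "u n \<in> (\<Union>n. Sp n)" for n using QA(4)[of n] unfolding Sp_def by blast
  then have USp: "z \<in> (\<Union>n. Sp n)" if "z \<in> insert \<zero>\<^bsub>M\<^esub> U" for z using u that by (metis imageE)
  have span: "z \<in> (\<Union>n. Sp n)" if "z \<in> carrier M" for z
  proof -
    obtain c where c: "c \<in> coeffs R M" "{x. c x \<noteq> \<zero>} \<subseteq> U" "z = lin_comb R M c" using U(3) \<open>z \<in> carrier M\<close> by auto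
    have "(\<Oplus>\<^bsub>M\<^esub> x \<in> B. c x \<odot>\<^bsub>M\<^esub> x) \<in> (\<Union>n. Sp n)" if "finite B" "B \<subseteq> U" for B
      using that
    proof (induction B rule: finite_induct)
      case empty
      then show ?case using USp by simp
    next
      case (insert b B)
      have "(\<Oplus>\<^bsub>M\<^esub> x \<in> insert b B. c x \<odot>\<^bsub>M\<^esub> x) = c b \<odot>\<^bsub>M\<^esub> b \<oplus>\<^bsub>M\<^esub> (\<Oplus>\<^bsub>M\<^esub> x \<in> B. c x \<odot>\<^bsub>M\<^esub> x)"
        by (rule M.finsum_insert) (use insert coeffsD(1)[OF c(1)] U(1) in auto)
      then show ?case using insert Sp_add Sp_smult USp coeffsD(1)[OF c(1)] by simp
    qed
    then show ?thesis unfolding c(3) lin_comb_def using coeffsD(2)[OF c(1)] c(2) by blast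
  qed
  have span': "\<exists>n v. vec (carrier R) v \<and> z = lc M (k n) v (x n)" if "z \<in> carrier M" for z
    using span[OF that] unfolding Sp_def by blast
  show ?thesis
    by (rule exI[of _ k], rule exI[of _ A], rule exI[of _ x]) (use QA(1-3) x span' in blast)
qed

lemma lin_hom_lc:
  assumes M: "module R M" and N: "module R N" and h: "h \<in> lin_hom R M N"
    and v: "vec (carrier R) v" and x: "vec (carrier M) x"
  shows "h (lc M k v x) = lc N k v (\<lambda>i. h (x i))"
proof -
  interpret M: module R M by (rule M)
  interpret N: module R N by (rule N)
  have "h (\<zero>\<^bsub>R\<^esub> \<odot>\<^bsub>M\<^esub> \<zero>\<^bsub>M\<^esub>) = \<zero>\<^bsub>R\<^esub> \<odot>\<^bsub>N\<^esub> h \<zero>\<^bsub>M\<^esub>" by (rule lin_homD(3)[OF h]) auto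
  then have "h \<zero>\<^bsub>M\<^esub> = \<zero>\<^bsub>N\<^esub>" using lin_homD(1)[OF h M.M.zero_closed] by simp
  then show ?thesis using v x by (induction k) (simp_all add: lin_homD(2,3)[OF h])
qed

lemma lin_hom_diff:
  assumes M: "module R M" and N: "module R N" and h: "h \<in> lin_hom R M N"
    and x: "x \<in> carrier M" and y: "y \<in> carrier M"
  shows "h (x \<ominus>\<^bsub>M\<^esub> y) = h x \<ominus>\<^bsub>N\<^esub> h y"
proof -
  interpret M: module R M by (rule M)
  interpret N: module R N by (rule N)
  have "h (x \<ominus>\<^bsub>M\<^esub> y) \<oplus>\<^bsub>N\<^esub> h y = h x"
    using lin_homD(2)[OF h, of "x \<ominus>\<^bsub>M\<^esub> y" y] x y by (simp add: M.diff_add_cancel)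
  then show ?thesis
    using N.add_diff_cancel[of "h (x \<ominus>\<^bsub>M\<^esub> y)" "h y"] lin_homD(1)[OF h] x y by simp
qed

section \<open>Vanishing of Ext for the colimit\<close>

locale flat_telescope = F: module R F + C: telescope R C k A
  for R (structure) and F (structure) and C (structure) and k A +
  fixes x
  assumes x_closed [simp]: "x n i \<in> carrier F"
    and x_eq: "i < k n \<Longrightarrow> x n i = lc F (k (Suc n)) (A n i) (x (Suc n))"
    and kill: "vec (carrier R) v \<Longrightarrow> lc F (k n) v (x n) = \<zero>\<^bsub>F\<^esub> \<Longrightarrow> j < k (Suc n) \<Longrightarrow>
       lc (self R) (k n) v (\<lambda>i. A n i j) = \<zero>\<^bsub>R\<^esub>"
    and span: "z \<in> carrier F \<Longrightarrow> \<exists>n v. vec (carrier R) v \<and> z = lc F (k n) v (x n)"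
begin

sublocale P: module R "free_mod R F"
  by (rule F.free_mod_module)

lemmas lcomb_hom = F.lin_comb_hom

lemma lin_comb_closed: "c \<in> coeffs R F \<Longrightarrow> lin_comb R F c \<in> carrier F"
  using lin_homD(1)[OF lcomb_hom] by simp

lemma single_closed: "single R (x n i) \<in> coeffs R F"
  by (rule F.single_coeffs) simp

text \<open>A lift of L_n -> F to the free module on \<open>F\<close>. These lifts do not commute
  with the transition maps; the defect is \<open>kk\<close>.\<close>

definition lam where "lam n v = lc (free_mod R F) (k n) v (\<lambda>i. single R (x n i))"

lemma lam_closed: "vec (carrier R) v \<Longrightarrow> lam n v \<in> coeffs R F"
  unfolding lam_def using P.lc_closed[of v "\<lambda>i. single R (x n i)" "k n"] single_closed by simp

lemma lin_comb_lam: "vec (carrier R) v \<Longrightarrow> lin_comb R F (lam n v) = lc F (k n) v (x n)"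
  unfolding lam_def
  using lin_hom_lc[OF P.module_axioms F.module_axioms lcomb_hom, of v "\<lambda>i. single R (x n i)" "k n"] single_closed
  by (simp add: lin_comb_eq_fsum F.fsum_single)

definition nxt where "nxt n v = (\<lambda>j. lc (self R) (k n) v (\<lambda>i. A n i j))"

lemma nxt_closed [simp]: "vec (carrier R) v \<Longrightarrow> nxt n v j \<in> carrier R"
  by (simp add: nxt_def)

lemma lc_nxt: "vec (carrier R) v \<Longrightarrow> lc F (k (Suc n)) (nxt n v) (x (Suc n)) = lc F (k n) v (x n)"
  unfolding nxt_def
  using F.lc_assoc[of v "A n" "x (Suc n)" "k (Suc n)" "k n"] F.lc_cong[of "k n" v v "x n" "\<lambda>i. lc F (k (Suc n)) (A n i) (x (Suc n))"] x_eq
  by simp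

text \<open>The values are relations of \<open>F\<close>, so a homomorphism \<open>\<phi>\<close> on
  the relation module yields the family \<open>\<phi> (kk n i)\<close>, the one that has to be a
  boundary. Zero from \<open>k n\<close> on keeps all values in the relation module.\<close>

definition kk where
  "kk n i = (if i < k n then single R (x n i) \<ominus>\<^bsub>free_mod R F\<^esub> lam (Suc n) (A n i) else \<zero>\<^bsub>free_mod R F\<^esub>)"

lemma diff_closed: "c \<in> coeffs R F \<Longrightarrow> d \<in> coeffs R F \<Longrightarrow> c \<ominus>\<^bsub>free_mod R F\<^esub> d \<in> coeffs R F"
  using P.M.minus_closed[of c d] by simp

lemma kernel_diff:
  assumes "c \<in> coeffs R F" "d \<in> coeffs R F" "lin_comb R F c = lin_comb R F d"
  shows "c \<ominus>\<^bsub>free_mod R F\<^esub> d \<in> carrier (pres_kernel R F)"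
  using lin_hom_diff[OF P.module_axioms F.module_axioms lcomb_hom, of c d] assms
    diff_closed[of c d] lin_comb_closed F.diff_self by simp

lemma kernel_zero: "\<zero>\<^bsub>free_mod R F\<^esub> \<in> carrier (pres_kernel R F)"
  using P.M.zero_closed by (simp add: lin_comb_def)

lemma kk_kernel: "kk n i \<in> carrier (pres_kernel R F)"
proof (cases "i < k n")
  case True
  have "lin_comb R F (single R (x n i)) = x n i" by (simp add: lin_comb_eq_fsum F.fsum_single)
  then show ?thesis unfolding kk_def using True
    by (simp only: if_True)
      (intro kernel_diff single_closed lam_closed, simp, simp only: lin_comb_lam C.A_closed x_eq[OF True, symmetric] simp_thms)
next
  case False
  then show ?thesis unfolding kk_def by (simp only: if_False kernel_zero)
qed

lemma lc_kk:
  assumes v: "vec (carrier R) v"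
  shows "lc (free_mod R F) (k n) v (kk n) = lam n v \<ominus>\<^bsub>free_mod R F\<^esub> lam (Suc n) (nxt n v)"
proof -
  have "lc (free_mod R F) (k n) v (kk n)
    = lc (free_mod R F) (k n) v (\<lambda>i. single R (x n i) \<ominus>\<^bsub>free_mod R F\<^esub> lam (Suc n) (A n i))"
    by (rule P.lc_cong) (auto simp: kk_def)
  also have "\<dots> = lam n v \<ominus>\<^bsub>free_mod R F\<^esub> lc (free_mod R F) (k n) v (\<lambda>i. lam (Suc n) (A n i))"
    unfolding lam_def[of n v] by (rule P.lc_diff_right) (use v single_closed lam_closed in auto)
  also have "lc (free_mod R F) (k n) v (\<lambda>i. lam (Suc n) (A n i)) = lam (Suc n) (nxt n v)"
    unfolding lam_def nxt_def by (rule P.lc_assoc[symmetric]) (use v single_closed in auto)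
  finally show ?thesis .
qed

context
  fixes \<phi> y
  assumes phi: "\<phi> \<in> lin_hom R (pres_kernel R F) C"
    and y [simp]: "\<And>n i. y n i \<in> carrier C"
    and y_eq: "\<And>n i. i < k n \<Longrightarrow> \<phi> (kk n i) = y n i \<ominus>\<^bsub>C\<^esub> lc C (k (Suc n)) (A n i) (y (Suc n))"
begin

lemma phi_closed: "c \<in> carrier (pres_kernel R F) \<Longrightarrow> \<phi> c \<in> carrier C"
  by (rule lin_homD(1)[OF phi])

lemma phi_add: "c \<in> carrier (pres_kernel R F) \<Longrightarrow> d \<in> carrier (pres_kernel R F) \<Longrightarrow>
    \<phi> (c \<oplus>\<^bsub>free_mod R F\<^esub> d) = \<phi> c \<oplus>\<^bsub>C\<^esub> \<phi> d"
  using lin_homD(2)[OF phi, of c d] by simp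

lemma phi_smult: "a \<in> carrier R \<Longrightarrow> c \<in> carrier (pres_kernel R F) \<Longrightarrow>
    \<phi> (a \<odot>\<^bsub>free_mod R F\<^esub> c) = a \<odot>\<^bsub>C\<^esub> \<phi> c"
  using lin_homD(3)[OF phi, of a c] by simp

lemma phi_zero: "\<phi> \<zero>\<^bsub>free_mod R F\<^esub> = \<zero>\<^bsub>C\<^esub>"
  using phi_smult[OF F.R.zero_closed kernel_zero] phi_closed[OF kernel_zero] by simp

lemma kernel_add: "c \<in> carrier (pres_kernel R F) \<Longrightarrow> d \<in> carrier (pres_kernel R F) \<Longrightarrow>
    c \<oplus>\<^bsub>free_mod R F\<^esub> d \<in> carrier (pres_kernel R F)"
  using lin_homD(2)[OF lcomb_hom, of c d] F.coeffs_add[of c F d] by simp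

lemma kernel_smult: "a \<in> carrier R \<Longrightarrow> c \<in> carrier (pres_kernel R F) \<Longrightarrow>
    a \<odot>\<^bsub>free_mod R F\<^esub> c \<in> carrier (pres_kernel R F)"
  using lin_homD(3)[OF lcomb_hom, of a c] F.coeffs_smult[of a c F] by simp

lemma phi_lc:
  assumes v: "vec (carrier R) v" and d: "vec (carrier (pres_kernel R F)) d"
  shows "lc (free_mod R F) l v d \<in> carrier (pres_kernel R F) \<and>
    \<phi> (lc (free_mod R F) l v d) = lc C l v (\<lambda>i. \<phi> (d i))"
proof (induction l)
  case 0
  show ?case using kernel_zero phi_zero by (simp only: lc.simps)
next
  case (Suc l)
  have "v l \<odot>\<^bsub>free_mod R F\<^esub> d l \<in> carrier (pres_kernel R F)"
    by (rule kernel_smult) (use v d in blast)+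
  then show ?case
    using Suc phi_add phi_smult[of "v l" "d l"] v d kernel_add unfolding lc.simps by metis
qed

definition rep where "rep c n v \<longleftrightarrow> vec (carrier R) v \<and> lin_comb R F c = lc F (k n) v (x n)"

text \<open>The value forced at \<open>c\<close> on an extension of \<open>\<phi>\<close> that takes
  \<open>lam n v\<close> to the combination of \<open>y n\<close> with coefficients
  \<open>v\<close>: \<open>c\<close> is split into \<open>lam n v\<close> and a relation.\<close>

definition W where "W c n v = lc C (k n) v (y n) \<oplus>\<^bsub>C\<^esub> \<phi> (c \<ominus>\<^bsub>free_mod R F\<^esub> lam n v)"

lemma rep_kernel: "c \<in> coeffs R F \<Longrightarrow> rep c n v \<Longrightarrow> c \<ominus>\<^bsub>free_mod R F\<^esub> lam n v \<in> carrier (pres_kernel R F)"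
  unfolding rep_def by (rule kernel_diff) (auto simp: lam_closed lin_comb_lam)

lemma W_closed: "c \<in> coeffs R F \<Longrightarrow> rep c n v \<Longrightarrow> W c n v \<in> carrier C"
  unfolding W_def using phi_closed[OF rep_kernel[of c n v]] by (auto simp: rep_def)

text \<open>Passing to the next level, the combination of \<open>y n\<close> loses, by
  \<open>y_eq\<close>, the value of \<open>\<phi>\<close> at the combination of the
  \<open>kk n i\<close>; by \<open>lc_kk\<close> the second summand of \<open>W\<close> gains the
  same value.\<close>

lemma rep_next:
  assumes c: "c \<in> coeffs R F" and r: "rep c n v"
  shows "rep c (Suc n) (nxt n v)" "W c (Suc n) (nxt n v) = W c n v"
proof -
  have v: "vec (carrier R) v" using r by (simp add: rep_def)
  show r': "rep c (Suc n) (nxt n v)" using r lc_nxt[OF v] by (simp add: rep_def)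
  let ?y' = "lc C (k (Suc n)) (nxt n v) (y (Suc n))"
  have lck: "\<phi> (lc (free_mod R F) (k n) v (kk n)) = lc C (k n) v (\<lambda>i. \<phi> (kk n i))"
    "lc (free_mod R F) (k n) v (kk n) \<in> carrier (pres_kernel R F)"
    using phi_lc[OF v, of "kk n" "k n"] kk_kernel by blast+
  have ph: "\<phi> (kk n i) \<in> carrier C" for i by (rule phi_closed[OF kk_kernel])
  have "lc C (k n) v (y n) = lc C (k n) v (\<lambda>i. \<phi> (kk n i) \<oplus>\<^bsub>C\<^esub> lc C (k (Suc n)) (A n i) (y (Suc n)))"
    by (rule C.lc_cong) (auto simp: y_eq C.diff_add_cancel)
  also have "\<dots> = lc C (k n) v (\<lambda>i. \<phi> (kk n i)) \<oplus>\<^bsub>C\<^esub> lc C (k n) v (\<lambda>i. lc C (k (Suc n)) (A n i) (y (Suc n)))"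
    by (rule C.lc_add_right) (use v ph in auto)
  also have "lc C (k n) v (\<lambda>i. lc C (k (Suc n)) (A n i) (y (Suc n))) = ?y'"
    unfolding nxt_def by (rule C.lc_assoc[symmetric]) (use v in auto)
  finally have e: "lc C (k n) v (y n) = \<phi> (lc (free_mod R F) (k n) v (kk n)) \<oplus>\<^bsub>C\<^esub> ?y'" using lck by simp
  have "lc (free_mod R F) (k n) v (kk n) \<oplus>\<^bsub>free_mod R F\<^esub> (c \<ominus>\<^bsub>free_mod R F\<^esub> lam n v)
     = (c \<ominus>\<^bsub>free_mod R F\<^esub> lam n v) \<oplus>\<^bsub>free_mod R F\<^esub> (lam n v \<ominus>\<^bsub>free_mod R F\<^esub> lam (Suc n) (nxt n v))"
    unfolding lc_kk[OF v] by (rule P.M.a_comm) (use c v lam_closed diff_closed in auto)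
  also have "\<dots> = c \<ominus>\<^bsub>free_mod R F\<^esub> lam (Suc n) (nxt n v)"
    by (rule P.diff_cancel_mid) (use c v lam_closed in auto)
  finally have "\<phi> (c \<ominus>\<^bsub>free_mod R F\<^esub> lam (Suc n) (nxt n v))
     = \<phi> (lc (free_mod R F) (k n) v (kk n)) \<oplus>\<^bsub>C\<^esub> \<phi> (c \<ominus>\<^bsub>free_mod R F\<^esub> lam n v)"
    using phi_add[OF lck(2) rep_kernel[OF c r]] by simp
  then show "W c (Suc n) (nxt n v) = W c n v"
    unfolding W_def e using phi_closed[OF lck(2)] phi_closed[OF rep_kernel[OF c r]] v
    by (simp add: C.M.a_ac)
qed

lemma rep_lift:
  assumes c: "c \<in> coeffs R F" and r: "rep c n v" and "n \<le> m"
  shows "\<exists>w. rep c m w \<and> W c m w = W c n v"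
  using \<open>n \<le> m\<close>
proof (induction m rule: dec_induct)
  case base
  then show ?case using r by blast
next
  case (step m)
  then show ?case using rep_next[OF c] by metis
qed

text \<open>Coordinate vectors of the same element of \<open>F\<close> differ by a relation, which
  the next transition map kills. They agree one level up, and \<open>rep_next\<close> carries this
  back.\<close>

lemma W_unique_level:
  assumes c: "c \<in> coeffs R F" and v: "rep c n v" and w: "rep c n w"
  shows "W c n v = W c n w"
proof -
  interpret Sm: module R "self R" by (rule F.R.self_module)
  have vv: "vec (carrier R) v" and ww: "vec (carrier R) w" using v w by (auto simp: rep_def)
  have "lc F (k n) (\<lambda>i. v i \<ominus>\<^bsub>R\<^esub> w i) (x n) = \<zero>\<^bsub>F\<^esub>"
    using F.lc_diff_left[OF vv ww, of "x n" "k n"] v w F.diff_self[of "lc F (k n) w (x n)"] ww by (simp add: rep_def)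
  then have "lc (self R) (k n) (\<lambda>i. v i \<ominus>\<^bsub>R\<^esub> w i) (\<lambda>i. A n i j) = \<zero>\<^bsub>R\<^esub>" if "j < k (Suc n)" for j
    using kill[of "\<lambda>i. v i \<ominus>\<^bsub>R\<^esub> w i" n j] that vv ww by simp
  then have nx: "nxt n v j = nxt n w j" if "j < k (Suc n)" for j
    using Sm.lc_diff_left[OF vv ww, of "\<lambda>i. A n i j" "k n"] that Sm.diff_zeroD[of "nxt n v j" "nxt n w j"] vv ww
    by (simp add: nxt_def)
  have "lc C (k (Suc n)) (nxt n v) (y (Suc n)) = lc C (k (Suc n)) (nxt n w) (y (Suc n))"
    by (rule C.lc_cong) (use nx in auto)
  moreover have "lam (Suc n) (nxt n v) = lam (Suc n) (nxt n w)"
    unfolding lam_def by (rule P.lc_cong) (use nx in auto)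
  ultimately have "W c (Suc n) (nxt n v) = W c (Suc n) (nxt n w)" by (simp add: W_def)
  then show ?thesis using rep_next(2)[OF c v] rep_next(2)[OF c w] by simp
qed

lemma W_unique:
  assumes c: "c \<in> coeffs R F" and v: "rep c n v" and w: "rep c m w"
  shows "W c n v = W c m w"
proof -
  obtain v' where v': "rep c (max n m) v'" "W c (max n m) v' = W c n v" using rep_lift[OF c v, of "max n m"] by auto
  obtain w' where w': "rep c (max n m) w'" "W c (max n m) w' = W c m w" using rep_lift[OF c w, of "max n m"] by auto
  show ?thesis using W_unique_level[OF c v'(1) w'(1)] v' w' by simp
qed

lemma rep_exists: "c \<in> coeffs R F \<Longrightarrow> \<exists>n v. rep c n v"
  using span[of "lin_comb R F c"] lin_comb_closed[of c] unfolding rep_def by auto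

definition \<psi> where "\<psi> c = (SOME z. \<exists>n v. rep c n v \<and> z = W c n v)"

lemma psi_eq: "c \<in> coeffs R F \<Longrightarrow> rep c n v \<Longrightarrow> \<psi> c = W c n v"
  unfolding \<psi>_def by (rule some_equality) (use W_unique in blast)+

lemma lam_add: "vec (carrier R) v \<Longrightarrow> vec (carrier R) w \<Longrightarrow>
    lam n (\<lambda>i. v i \<oplus> w i) = lam n v \<oplus>\<^bsub>free_mod R F\<^esub> lam n w"
  unfolding lam_def by (rule P.lc_add_left) (use single_closed in auto)

lemma lam_smult: "a \<in> carrier R \<Longrightarrow> vec (carrier R) v \<Longrightarrow>
    lam n (\<lambda>i. a \<otimes> v i) = a \<odot>\<^bsub>free_mod R F\<^esub> lam n v"
  unfolding lam_def by (rule P.lc_smult_left) (use single_closed in auto)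

lemma psi_add:
  assumes c: "c \<in> coeffs R F" and d: "d \<in> coeffs R F"
  shows "\<psi> (c \<oplus>\<^bsub>free_mod R F\<^esub> d) = \<psi> c \<oplus>\<^bsub>C\<^esub> \<psi> d"
proof -
  obtain n v m w where "rep c n v" "rep d m w" using rep_exists c d by meson
  then obtain l v' w' where v: "rep c l v'" and w: "rep d l w'"
    using rep_lift[OF c, of n v "max n m"] rep_lift[OF d, of m w "max n m"] by auto
  have vw: "vec (carrier R) v'" "vec (carrier R) w'" using v w by (auto simp: rep_def)
  have cd: "c \<oplus>\<^bsub>free_mod R F\<^esub> d \<in> coeffs R F" using F.coeffs_add[OF c d] by simp
  have r: "rep (c \<oplus>\<^bsub>free_mod R F\<^esub> d) l (\<lambda>i. v' i \<oplus> w' i)"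
    using v w lin_homD(2)[OF lcomb_hom, of c d] c d F.lc_add_left[OF vw, of "x l" "k l"]
    unfolding rep_def by (simp del: free_mod_simps(3))
  have "(c \<oplus>\<^bsub>free_mod R F\<^esub> d) \<ominus>\<^bsub>free_mod R F\<^esub> (lam l v' \<oplus>\<^bsub>free_mod R F\<^esub> lam l w')
     = (c \<ominus>\<^bsub>free_mod R F\<^esub> lam l v') \<oplus>\<^bsub>free_mod R F\<^esub> (d \<ominus>\<^bsub>free_mod R F\<^esub> lam l w')"
    by (rule P.add_diff) (use c d vw lam_closed in auto)
  then have "W (c \<oplus>\<^bsub>free_mod R F\<^esub> d) l (\<lambda>i. v' i \<oplus> w' i) = W c l v' \<oplus>\<^bsub>C\<^esub> W d l w'"
    unfolding W_def lam_add[OF vw]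
    using phi_add[OF rep_kernel[OF c v] rep_kernel[OF d w]] C.lc_add_left[OF vw, of "y l" "k l"]
      phi_closed[OF rep_kernel[OF c v]] phi_closed[OF rep_kernel[OF d w]] vw
    by (simp add: C.M.a_ac del: free_mod_simps(3))
  then show ?thesis using psi_eq[OF cd r] psi_eq[OF c v] psi_eq[OF d w] by simp
qed

lemma psi_smult:
  assumes a: "a \<in> carrier R" and c: "c \<in> coeffs R F"
  shows "\<psi> (a \<odot>\<^bsub>free_mod R F\<^esub> c) = a \<odot>\<^bsub>C\<^esub> \<psi> c"
proof -
  obtain l v where v: "rep c l v" using rep_exists c by meson
  have vv: "vec (carrier R) v" using v by (auto simp: rep_def)
  have ac: "a \<odot>\<^bsub>free_mod R F\<^esub> c \<in> coeffs R F" using F.coeffs_smult[OF a c] by simp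
  have r: "rep (a \<odot>\<^bsub>free_mod R F\<^esub> c) l (\<lambda>i. a \<otimes> v i)"
    using v lin_homD(3)[OF lcomb_hom, of a c] a c F.lc_smult_left[OF a vv, of "x l" "k l"]
    unfolding rep_def by (simp del: free_mod_simps(4))
  have "a \<odot>\<^bsub>free_mod R F\<^esub> c \<ominus>\<^bsub>free_mod R F\<^esub> a \<odot>\<^bsub>free_mod R F\<^esub> lam l v
     = a \<odot>\<^bsub>free_mod R F\<^esub> (c \<ominus>\<^bsub>free_mod R F\<^esub> lam l v)"
    by (rule P.smult_diff[symmetric]) (use a c vv lam_closed in auto)
  then have "W (a \<odot>\<^bsub>free_mod R F\<^esub> c) l (\<lambda>i. a \<otimes> v i) = a \<odot>\<^bsub>C\<^esub> W c l v"
    unfolding W_def lam_smult[OF a vv]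
    using phi_smult[OF a rep_kernel[OF c v]] C.lc_smult_left[OF a vv, of "y l" "k l"]
      phi_closed[OF rep_kernel[OF c v]] vv a
    by (simp add: C.smult_r_distr del: free_mod_simps(4))
  then show ?thesis using psi_eq[OF ac r] psi_eq[OF c v] by simp
qed

lemma psi_hom: "\<psi> \<in> lin_hom R (free_mod R F) C"
  unfolding lin_hom_def
proof (intro CollectI conjI ballI funcsetI)
  fix c assume "c \<in> carrier (free_mod R F)"
  then have c: "c \<in> coeffs R F" by simp
  then obtain n v where "rep c n v" using rep_exists by meson
  then show "\<psi> c \<in> carrier C" using psi_eq[OF c] W_closed[OF c] by simp
qed (use psi_add psi_smult in \<open>auto simp only: free_mod_simps(1)\<close>)

lemma psi_extends:
  assumes c': "c \<in> carrier (pres_kernel R F)"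
  shows "\<psi> c = \<phi> c"
proof -
  have c: "c \<in> coeffs R F" "lin_comb R F c = \<zero>\<^bsub>F\<^esub>" using c' by auto
  \<comment> \<open>A relation is represented by the zero vector, for which \<open>W\<close> reduces
    to \<open>\<phi>\<close>.\<close>
  have r: "rep c 0 (\<lambda>i. \<zero>\<^bsub>R\<^esub>)" using c F.lc_zero_left[of "x 0" "k 0" "\<lambda>i. \<zero>\<^bsub>R\<^esub>"] by (simp add: rep_def)
  have "lam 0 (\<lambda>i. \<zero>\<^bsub>R\<^esub>) = \<zero>\<^bsub>free_mod R F\<^esub>"
    unfolding lam_def by (rule P.lc_zero_left) (use single_closed in auto)
  moreover have "c \<ominus>\<^bsub>free_mod R F\<^esub> \<zero>\<^bsub>free_mod R F\<^esub> = c"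
    unfolding P.M.minus_eq P.minus_zero_module by (rule P.M.r_zero) (simp add: c)
  ultimately show ?thesis
    using psi_eq[OF c(1) r] C.lc_zero_left[of "y 0" "k 0" "\<lambda>i. \<zero>\<^bsub>R\<^esub>"] phi_closed[OF c'] by (simp add: W_def)
qed

end

text \<open>Solvability is applied to the family \<open>\<phi> (kk n i)\<close>; the solution
  \<open>y\<close> is the datum from which the extension \<open>\<psi>\<close> is built.\<close>

lemma ext1_vanishes_if_solvable:
  assumes sol: "C.solvable_mod {\<zero>\<^bsub>C\<^esub>}"
  shows "ext1_vanishes R F C"
  unfolding ext1_vanishes_def
proof
  fix \<phi> assume phi: "\<phi> \<in> lin_hom R (pres_kernel R F) C"
  have "\<forall>n i. \<phi> (kk n i) \<in> carrier C" using lin_homD(1)[OF phi kk_kernel] by blast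
  then obtain y where y: "\<And>n i. y n i \<in> carrier C"
    and e: "\<And>n i. i < k n \<Longrightarrow> \<phi> (kk n i) \<ominus>\<^bsub>C\<^esub> C.bdry y n i \<in> {\<zero>\<^bsub>C\<^esub>}"
    using sol[unfolded C.solvable_mod_def, rule_format, of "\<lambda>n i. \<phi> (kk n i)"] by blast
  have "\<phi> (kk n i) = y n i \<ominus>\<^bsub>C\<^esub> lc C (k (Suc n)) (A n i) (y (Suc n))" if "i < k n" for n i
    using C.diff_zeroD[of "\<phi> (kk n i)" "C.bdry y n i"] e[OF that] lin_homD(1)[OF phi kk_kernel] y
    by (simp add: C.bdry_def)
  note hyps = phi y this
  show "\<exists>\<psi>\<in>lin_hom R (free_mod R F) C. \<forall>c\<in>carrier (pres_kernel R F). \<psi> c = \<phi> c"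
    using psi_hom[OF hyps] psi_extends[OF hyps] by blast
qed

end

theorem theorem2p4:
  fixes R :: "'r ring" and F :: "('r, 'm) module" and C :: "('r, 'c) module"
  assumes "noetherian_ring R"
    and "module R F"
    and "countably_generated R F"
    and "flat R F"
    and "module R C"
    and "almost_cotorsion R C"
  shows "ext1_vanishes R F C"
proof -
  interpret F: module R F by (rule assms(2))
  interpret C: module R C by (rule assms(5))
  have noeth: "noetherian_cring R"
    by (intro noetherian_cring.intro assms(1) F.R.is_cring)
  obtain k A x where A: "\<forall>n i j. A n i j \<in> carrier R" and x: "\<forall>n. vec (carrier F) (x n)"
    and tel: "\<forall>n. \<forall>i<k n. x n i = lc F (k (Suc n)) (A n i) (x (Suc n))"
      "\<forall>n v. vec (carrier R) v \<longrightarrow> lc F (k n) v (x n) = \<zero>\<^bsub>F\<^esub> \<longrightarrow>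
         (\<forall>j<k (Suc n). lc (self R) (k n) v (\<lambda>i. A n i j) = \<zero>\<^bsub>R\<^esub>)"
      "\<forall>z\<in>carrier F. \<exists>n v. vec (carrier R) v \<and> z = lc F (k n) v (x n)"
    using F.telescope_exists[OF noeth assms(4,3)] by blast
  interpret T: flat_telescope R F C k A x
    by (intro flat_telescope.intro flat_telescope_axioms.intro telescope.intro telescope_axioms.intro assms(2,5))
      (use A x tel in blast)+
  show ?thesis
    by (rule T.ext1_vanishes_if_solvable[OF T.C.solvable_if_chain_solvable[OF noeth
            C.chain_solvable_if_almost_cotorsion[OF assms(6)]]])
qed


end
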